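(* In the setting described in the context, fix a sequence $\{(n,m_n)\}_{n\ge1}$ with $m_n\to+\infty$. Assume that $b,\sigma:\mathbb R\to\mathbb R$ are continuously differentiable with bounded first derivatives and that $\sigma(r)\ne0$ for every $r\in\mathbb R$. Assume moreover: (1) $g_n\to g$ in $C(\overline{\mathcal O_T})$ as $n\to\infty$; (2) $\displaystyle\sup_{(t,x)\in\overline{\mathcal O_T}}\int_0^t\int_{\mathcal O}\left|G_n(t,\lfloor s\rfloor_n;x,z)-G_{t-s}(x,z)\right|^2dz\,ds\to0$ as $n\to\infty$; (3) there is a nonincreasing integrable function $\varrho:(0,T]\to[0,\infty)$, independent of $n$, such that $\int_{\mathcal O}|G_n(t,r;x,z)|^2dz\le\varrho(t-r)$ for all $n\ge1$, $0\le r<t\le T$, $x\in\overline{\mathcal O}$; (4) $\displaystyle\lim_{\delta\downarrow0}\ \sup\Big\{\int_0^{t'}\!\!\int_{\mathcal O}|G_{t-s}(x,z)-G_{t'-s}(x',z)|^2dz\,ds:\ 0\le t'\le t\le T,\ x,x'\in\overline{\mathcal O},\ |t-t'|+|x-x'|\le\delta\Big\}=0$; (5) $\displaystyle\int_0^T\int_{\mathcal O}|G_{T-s}(x_0,z)|^2dz\,ds>0$; (6) there are operators $Q_n:L^2(\mathcal O_T)\to\mathcal X_n$ with $Q_nh\to h$ in $L^2(\mathcal O_T)$ for every $h\in L^2(\mathcal O_T)$. Then for every $y\in\mathbb R$, $I^{n,m_n}(y)\to I(y)$ as $n\to\infty$. In particular, let $y\in\mathbb R$ with $I(y)<+\infty$,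 let $\epsilon_n\ge0$, $\epsilon_n\to0$, and let $h_n\in\mathcal X_n$ satisfy $\Upsilon_n(h_n)(T,x_0)=y$ and $\frac12\|h_n\|_{L^2(\mathcal O_T)}^2\le I^{n,m_n}(y)+\epsilon_n$; put $u_n:=\Upsilon_n(h_n)$. Then there exist a subsequence $\{n_k\}$ and $h^*\in L^2(\mathcal O_T)$ such that, with $u^*:=\Upsilon(h^* )$, $h_{n_k}\to h^*$ in $L^2(\mathcal O_T)$, $u_{n_k}\to u^*$ in $C(\overline{\mathcal O_T})$, $u^*(T,x_0)=y$ and $\frac12\|h^*\|_{L^2(\mathcal O_T)}^2=I(y)$; consequently $h^*$ attains the infimum defining $I(y)$, and $u^*$ minimizes the functional $\mathcal J_y$ over $C(\overline{\mathcal O_T})$. If the minimizer $h$ in the definition of $I(y)$ is unique, then the full sequences satisfy $h_n\to h^*$ in $L^2(\mathcal O_T)$ and $u_n\to u^*$ in $C(\overline{\mathcal O_T})$.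
   Context: Setting. $T>0$; $\mathcal O\subset\mathbb R^d$ is a bounded domain with $|\partial\mathcal O|=0$; $x_0\in\mathcal O$ is fixed; $\mathcal O_T=(0,T)\times\mathcal O$, $\overline{\mathcal O_T}=[0,T]\times\overline{\mathcal O}$, and $C(\overline{\mathcal O_T})$ carries the sup norm. Continuous problem: $G_t(x,z)$ ($0<t\le T$, $x\in\overline{\mathcal O}$, $z\in\mathcal O$) is a measurable real kernel, the Green function of a linear space-time differential operator $\mathcal L$ with given boundary conditions (the solution of $\mathcal Lv=\varphi$ with zero initial values is $v(t,x)=\int_0^t\int_{\mathcal O}G_{t-s}(x,z)\varphi(s,z)dzds$), and $g\in C(\overline{\mathcal O_T})$ is the solution of the homogeneous linear problem; $\mathcal L$ enters only through $G$ and $g$. Standing well-posedness: for every $h\in L^2(\mathcal O_T)$ the skeleton equation $$u(t,x)=g(t,x)+\int_0^t\int_{\mathcal O}G_{t-s}(x,z)[b(u(s,z))+\sigma(u(s,z))h(s,z)]dz\,ds$$ has a unique solution $u=:\Upsilon(h)\in C(\overline{\mathcal O_T})$. Discrete problem: for each $n\ge1$, $m_n\in\mathbb N^+$, $\tau_n=T/m_n$, $t_j=j\tau_n$, $\lfloor s\rfloor_n:=t_j$ for $s\in[t_j,t_{j+1})$ and $\lfloor T\rfloor_n:=t_{m_n-1}$. $\mathscr T_n$ is a finite mesh of $\mathcal O$ into cells, $\kappa_n:\mathcal O\to\overline{\mathcal O}$ is constant on every cell, and $\sup_{z\in\mathcal O}|z-\kappa_n(z)|\to0$. $\mathcal X_n\subset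 L^2(\mathcal O_T)$ is the finite-dimensional space of functions that are constant on each space-time cell $[t_j,t_{j+1})\times K$, $K\in\mathscr T_n$. $G_n(t,r;x,z)$ ($0\le r<t\le T$, $x\in\overline{\mathcal O}$, $z\in\mathcal O$) is a measurable real kernel (the Green function induced by a numerical scheme) and $g_n\in C(\overline{\mathcal O_T})$. For every $h_n\in\mathcal X_n$ the discrete skeleton equation $$u_n(t,x)=g_n(t,x)+\int_0^t\int_{\mathcal O}G_n(t,\lfloor s\rfloor_n;x,z)\big[b(u_n(\lfloor s\rfloor_n,\kappa_n(z)))+\sigma(u_n(\lfloor s\rfloor_n,\kappa_n(z)))h_n(s,z)\big]dz\,ds$$ has a unique solution $u_n=:\Upsilon_n(h_n)\in C(\overline{\mathcal O_T})$, and $\Upsilon_n:\mathcal X_n\to C(\overline{\mathcal O_T})$ is continuous. Rate functions (with $\inf\emptyset=+\infty$): $I(y)=\inf\{\frac12\|h\|^2_{L^2(\mathcal O_T)}: h\in L^2(\mathcal O_T),\ \Upsilon(h)(T,x_0)=y\}$, $I^{n,m_n}(y)=\inf\{\frac12\|h_n\|^2_{L^2(\mathcal O_T)}: h_n\in\mathcal X_n,\ \Upsilon_n(h_n)(T,x_0)=y\}$. For $f\in C(\overline{\mathcal O_T})$, $\mathcal J_y(f)=\inf\{\frac12\|h\|^2_{L^2(\mathcal O_T)}: h\in L^2(\mathcal O_T),\ \Upsilon(h)=f,\ f(T,x_0)=y\}$. *)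

theory Defs
  imports "HOL-Analysis.Analysis"
begin

definition cyl :: "real \<Rightarrow> 'a::euclidean_space set \<Rightarrow> (real \<times> 'a) set" where
  "cyl T D = {0<..<T} \<times> D"

definition ccyl :: "real \<Rightarrow> 'a::euclidean_space set \<Rightarrow> (real \<times> 'a) set" where
  "ccyl T D = {0..T} \<times> closure D"

text \<open>Continuous functions on \<open>S\<close>, with the usual convention (as for \<^const>\<open>cfunspace\<close>) that
  they are undefined outside \<open>S\<close>, so that equality on \<open>S\<close> is equality.  The supremum norm is only
  used for compact nonempty \<open>S\<close>, where the supremum exists.\<close>

definition Cspace :: "'b::topological_space set \<Rightarrow> ('b \<Rightarrow> real) set" where
  "Cspace S = {f \<in> extensional S. continuous_on S f}"

definition sup_norm :: "'b set \<Rightarrow> ('b \<Rightarrow> real) \<Rightarrow> real" where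
  "sup_norm S f = (SUP p\<in>S. \<bar>f p\<bar>)"

text \<open>Elements of \<open>L\<^sup>2(S)\<close> are given by Borel representatives, whose values outside \<open>S\<close> are
  irrelevant; two representatives are the same element iff they agree almost everywhere on \<open>S\<close>.\<close>

definition L2 :: "'b::euclidean_space set \<Rightarrow> ('b \<Rightarrow> real) set" where
  "L2 S = {h. set_borel_measurable lborel S h \<and> set_integrable lborel S (\<lambda>p. (h p)\<^sup>2)}"

definition L2_norm_on :: "'b::euclidean_space set \<Rightarrow> ('b \<Rightarrow> real) \<Rightarrow> real" where
  "L2_norm_on S h = sqrt (LINT p:S|lborel. (h p)\<^sup>2)"

definition L2_eq :: "'b::euclidean_space set \<Rightarrow> ('b \<Rightarrow> real) \<Rightarrow> ('b \<Rightarrow> real) \<Rightarrow> bool" where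
  "L2_eq S h h' \<longleftrightarrow> (AE p in lborel. p \<in> S \<longrightarrow> h p = h' p)"

text \<open>Integrability is demanded explicitly because the integral of a nonintegrable
  function is \<open>0\<close> by convention.  In both equations \<open>G t x z\<close> stands for \<open>G\<^sub>t(x,z)\<close> and
  \<open>Gn t r x z\<close> for \<open>G\<^sub>n(t,r;x,z)\<close>.\<close>

definition skeleton_solution ::
  "real \<Rightarrow> 'a::euclidean_space set \<Rightarrow> (real \<Rightarrow> 'a \<Rightarrow> 'a \<Rightarrow> real) \<Rightarrow> (real \<Rightarrow> real) \<Rightarrow> (real \<Rightarrow> real)
    \<Rightarrow> (real \<times> 'a \<Rightarrow> real) \<Rightarrow> (real \<times> 'a \<Rightarrow> real) \<Rightarrow> (real \<times> 'a \<Rightarrow> real) \<Rightarrow> bool" where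
  "skeleton_solution T D G b \<sigma> g h u \<longleftrightarrow>
     u \<in> Cspace (ccyl T D) \<and>
     (\<forall>t\<in>{0..T}. \<forall>x\<in>closure D.
        set_integrable lborel ({0<..<t} \<times> D)
          (\<lambda>(s, z). G (t - s) x z * (b (u (s, z)) + \<sigma> (u (s, z)) * h (s, z))) \<and>
        u (t, x) = g (t, x) +
          (LINT s:{0<..<t}|lborel. LINT z:D|lborel.
             G (t - s) x z * (b (u (s, z)) + \<sigma> (u (s, z)) * h (s, z))))"

definition skeleton_map ::
  "real \<Rightarrow> 'a::euclidean_space set \<Rightarrow> (real \<Rightarrow> 'a \<Rightarrow> 'a \<Rightarrow> real) \<Rightarrow> (real \<Rightarrow> real) \<Rightarrow> (real \<Rightarrow> real)
    \<Rightarrow> (real \<times> 'a \<Rightarrow> real) \<Rightarrow> (real \<times> 'a \<Rightarrow> real) \<Rightarrow> (real \<times> 'a \<Rightarrow> real)" where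
  "skeleton_map T D G b \<sigma> g h = (THE u. skeleton_solution T D G b \<sigma> g h u)"

definition grid_time :: "real \<Rightarrow> nat \<Rightarrow> nat \<Rightarrow> real" where
  "grid_time T m j = real j * (T / real m)"

definition grid_floor :: "real \<Rightarrow> nat \<Rightarrow> real \<Rightarrow> real" where
  "grid_floor T m s =
     (if s = T then grid_time T m (m - 1) else grid_time T m (nat \<lfloor>s / (T / real m)\<rfloor>))"

definition finite_mesh :: "'a::euclidean_space set \<Rightarrow> 'a set set \<Rightarrow> bool" where
  "finite_mesh D \<T> \<longleftrightarrow> finite \<T> \<and> partition_on D \<T> \<and> \<T> \<subseteq> sets borel"

definition mesh_functions ::
  "real \<Rightarrow> 'a::euclidean_space set \<Rightarrow> nat \<Rightarrow> 'a set set \<Rightarrow> (real \<times> 'a \<Rightarrow> real) set" where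
  "mesh_functions T D m \<T> =
     {h \<in> L2 (cyl T D). \<forall>j<m. \<forall>K\<in>\<T>. h constant_on ({grid_time T m j..<grid_time T m (Suc j)} \<times> K)}"

definition discrete_skeleton_solution ::
  "real \<Rightarrow> 'a::euclidean_space set \<Rightarrow> nat \<Rightarrow> ('a \<Rightarrow> 'a) \<Rightarrow> (real \<Rightarrow> real \<Rightarrow> 'a \<Rightarrow> 'a \<Rightarrow> real)
    \<Rightarrow> (real \<Rightarrow> real) \<Rightarrow> (real \<Rightarrow> real)
    \<Rightarrow> (real \<times> 'a \<Rightarrow> real) \<Rightarrow> (real \<times> 'a \<Rightarrow> real) \<Rightarrow> (real \<times> 'a \<Rightarrow> real) \<Rightarrow> bool" where
  "discrete_skeleton_solution T D m \<kappa> Gn b \<sigma> gn h u \<longleftrightarrow>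
     u \<in> Cspace (ccyl T D) \<and>
     (\<forall>t\<in>{0..T}. \<forall>x\<in>closure D.
        set_integrable lborel ({0<..<t} \<times> D)
          (\<lambda>(s, z). Gn t (grid_floor T m s) x z *
             (b (u (grid_floor T m s, \<kappa> z)) + \<sigma> (u (grid_floor T m s, \<kappa> z)) * h (s, z))) \<and>
        u (t, x) = gn (t, x) +
          (LINT s:{0<..<t}|lborel. LINT z:D|lborel.
             Gn t (grid_floor T m s) x z *
               (b (u (grid_floor T m s, \<kappa> z)) + \<sigma> (u (grid_floor T m s, \<kappa> z)) * h (s, z))))"

definition discrete_skeleton_map ::
  "real \<Rightarrow> 'a::euclidean_space set \<Rightarrow> nat \<Rightarrow> ('a \<Rightarrow> 'a) \<Rightarrow> (real \<Rightarrow> real \<Rightarrow> 'a \<Rightarrow> 'a \<Rightarrow> real)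
    \<Rightarrow> (real \<Rightarrow> real) \<Rightarrow> (real \<Rightarrow> real)
    \<Rightarrow> (real \<times> 'a \<Rightarrow> real) \<Rightarrow> (real \<times> 'a \<Rightarrow> real) \<Rightarrow> (real \<times> 'a \<Rightarrow> real)" where
  "discrete_skeleton_map T D m \<kappa> Gn b \<sigma> gn h =
     (THE u. discrete_skeleton_solution T D m \<kappa> Gn b \<sigma> gn h u)"

text \<open>\<open>rate_function (cyl T D) H \<Upsilon> (T, x\<^sub>0)\<close> is the rate function \<open>I\<close> for \<open>H = L2 (cyl T D)\<close>, and
  \<open>I\<^bsup>n,m\<^esup>\<close> for \<open>H = mesh_functions T D m \<T>\<close> and the discrete solution map.
  In \<^typ>\<open>ereal\<close>, the infimum of the empty set is \<open>\<infinity>\<close>.\<close>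

definition rate_function ::
  "'b::euclidean_space set \<Rightarrow> ('b \<Rightarrow> real) set \<Rightarrow> (('b \<Rightarrow> real) \<Rightarrow> 'b \<Rightarrow> real) \<Rightarrow> 'b \<Rightarrow> real \<Rightarrow> ereal" where
  "rate_function S H \<Upsilon> p y =
     Inf {ereal (1/2 * (L2_norm_on S h)\<^sup>2) | h. h \<in> H \<and> \<Upsilon> h p = y}"

definition rate_minimizer ::
  "'b::euclidean_space set \<Rightarrow> ('b \<Rightarrow> real) set \<Rightarrow> (('b \<Rightarrow> real) \<Rightarrow> 'b \<Rightarrow> real) \<Rightarrow> 'b \<Rightarrow> real
    \<Rightarrow> ('b \<Rightarrow> real) \<Rightarrow> bool" where
  "rate_minimizer S H \<Upsilon> p y h \<longleftrightarrow>
     h \<in> H \<and> \<Upsilon> h p = y \<and> ereal (1/2 * (L2_norm_on S h)\<^sup>2) = rate_function S H \<Upsilon> p y"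

definition path_functional ::
  "'b::euclidean_space set \<Rightarrow> ('b \<Rightarrow> real) set \<Rightarrow> (('b \<Rightarrow> real) \<Rightarrow> 'b \<Rightarrow> real) \<Rightarrow> 'b \<Rightarrow> real
    \<Rightarrow> ('b \<Rightarrow> real) \<Rightarrow> ereal" where
  "path_functional S H \<Upsilon> p y f =
     Inf {ereal (1/2 * (L2_norm_on S h)\<^sup>2) | h. h \<in> H \<and> \<Upsilon> h = f \<and> f p = y}"

end

theory Submission
  imports Defs
begin

text \<open>If controls \<open>h\<^sub>n\<close> converge weakly to \<open>h\<close> in \<open>L\<^sup>2\<close>, the discrete solutions \<open>\<Upsilon>\<^sub>n h\<^sub>n\<close> converge
  uniformly to \<open>\<Upsilon> h\<close>: comparing with \<open>u = \<Upsilon> h\<close> directly, the only term involving \<open>h\<^sub>n - h\<close> is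
  \<open>\<langle>G(t,x), \<sigma>(u) (h\<^sub>n - h)\<rangle>\<close>, which vanishes uniformly because \<open>(t,x) \<mapsto> G(t,x) \<in> L\<^sup>2\<close> is continuous
  on a compact set, and the remaining feedback term is absorbed in a norm weighted by
  \<open>exp (- \<beta> t)\<close>. With weak compactness of bounded sets of controls this bounds the discrete rate
  functions from below and yields the convergence of near-minimisers, strongly since their norms
  converge too.

  For the upper bound, \<open>\<sigma> \<noteq> 0\<close> allows any integrand to be realised by a control. So \<open>\<Upsilon> h\<close> can be moved up
  or down by small multiples of \<open>\<langle>G(t,x), G(T,x\<^sub>0)\<rangle>\<close>, whose value at \<open>(T,x\<^sub>0)\<close> is positive; the
  intermediate value theorem between the two discretised controls reaches \<open>y\<close> exactly.\<close>

section \<open>Square-integrable functions\<close>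

text \<open>The majorant \<open>\<rho>\<close> bounds only the discrete kernels, and the continuity
  hypothesis on \<open>G\<close> compares two kernels only on their common time interval; size
  estimates for \<open>G\<close> by itself are therefore inherited from the discrete kernels in the
  limit. No continuity of the discrete kernels in (t,x) is assumed, which is why the comparison
  starts from the fixed function \<open>\<Upsilon> h\<close>: its coefficient \<sigma>(u) does not
  move with n, and its modulus of continuity controls the grid error. Since \<open>\<rho>\<close>
  may be singular at 0, the contraction is drawn from its Laplace transform, which tends to 0.

  The endpoint constraint is exact, whereas a discretised control meets it only approximately.
  Correcting the defect requires a direction in which the endpoint really moves; nondegeneracy makes
  the kernel at (T,x0) such a direction.

  All functions are representatives on the cylinder with restricted Lebesgue measure. Separability,
  on which weak compactness rests, comes from the operators \<open>Q n\<close>: the countably many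
  indicators of mesh cells span a dense set.\<close>

definition square_integrable :: "'a measure \<Rightarrow> ('a \<Rightarrow> real) set" where
  "square_integrable M = {f \<in> borel_measurable M. integrable M (\<lambda>x. (f x)\<^sup>2)}"

definition l2_inner :: "'a measure \<Rightarrow> ('a \<Rightarrow> real) \<Rightarrow> ('a \<Rightarrow> real) \<Rightarrow> real" where
  "l2_inner M f g = (\<integral>x. f x * g x \<partial>M)"

definition l2_norm :: "'a measure \<Rightarrow> ('a \<Rightarrow> real) \<Rightarrow> real" where
  "l2_norm M f = sqrt (\<integral>x. (f x)\<^sup>2 \<partial>M)"

lemma square_integrableD:
  assumes "f \<in> square_integrable M"
  shows square_integrable_measurable[measurable_dest]: "f \<in> borel_measurable M"
    and square_integrable_integrable: "integrable M (\<lambda>x. (f x)\<^sup>2)"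
  using assms by (auto simp: square_integrable_def)

lemma square_integrable_mult:
  assumes "f \<in> square_integrable M" "g \<in> square_integrable M"
  shows "integrable M (\<lambda>x. f x * g x)"
proof (rule Bochner_Integration.integrable_bound)
  show "integrable M (\<lambda>x. (f x)\<^sup>2 + (g x)\<^sup>2)"
    using assms by (auto simp: square_integrable_def)
  have "\<bar>a * c\<bar> \<le> a\<^sup>2 + c\<^sup>2" for a c :: real
  proof -
    have "2 * (\<bar>a\<bar> * \<bar>c\<bar>) \<le> \<bar>a\<bar>\<^sup>2 + \<bar>c\<bar>\<^sup>2"
      using sum_squares_bound[of "\<bar>a\<bar>" "\<bar>c\<bar>"] by simp
    moreover have "0 \<le> \<bar>a\<bar> * \<bar>c\<bar>" by simp
    ultimately show ?thesis unfolding abs_mult power2_abs by linarith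
  qed
  then show "AE x in M. norm (f x * g x) \<le> norm ((f x)\<^sup>2 + (g x)\<^sup>2)"
    by auto
  show "(\<lambda>x. f x * g x) \<in> borel_measurable M"
    using assms by (auto simp: square_integrable_def)
qed

lemma square_integrable_bound:
  assumes "f \<in> square_integrable M" "g \<in> borel_measurable M"
    and "AE x in M. \<bar>g x\<bar> \<le> \<bar>f x\<bar>"
  shows "g \<in> square_integrable M"
proof -
  have "AE x in M. norm ((g x)\<^sup>2) \<le> norm ((f x)\<^sup>2)"
    using assms(3) by eventually_elim (simp add: abs_le_square_iff)
  then have "integrable M (\<lambda>x. (g x)\<^sup>2)"
    using assms by (intro Bochner_Integration.integrable_bound[of M "\<lambda>x. (f x)\<^sup>2" "\<lambda>x. (g x)\<^sup>2"])
      (auto simp: square_integrable_def)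
  then show ?thesis
    using assms by (simp add: square_integrable_def)
qed

lemma square_integrable_cmult:
  "f \<in> square_integrable M \<Longrightarrow> (\<lambda>x. c * f x) \<in> square_integrable M"
  by (auto simp: square_integrable_def power_mult_distrib)

lemma square_integrable_add:
  assumes "f \<in> square_integrable M" "g \<in> square_integrable M"
  shows "(\<lambda>x. f x + g x) \<in> square_integrable M"
proof -
  have "integrable M (\<lambda>x. (f x)\<^sup>2 + (g x)\<^sup>2 + 2 * (f x * g x))"
    using assms square_integrable_mult[OF assms]
    by (auto simp: square_integrable_def)
  then have "integrable M (\<lambda>x. (f x + g x)\<^sup>2)"
    by (rule back_subst[of "integrable M"]) (auto simp: power2_sum)
  then show ?thesis using assms by (auto simp: square_integrable_def)
qed

lemma square_integrable_diff:
  assumes "f \<in> square_integrable M" "g \<in> square_integrable M"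
  shows "(\<lambda>x. f x - g x) \<in> square_integrable M"
  using square_integrable_add[OF assms(1) square_integrable_cmult[OF assms(2), of "-1"]] by simp

lemma square_integrable_abs:
  "f \<in> square_integrable M \<Longrightarrow> (\<lambda>x. \<bar>f x\<bar>) \<in> square_integrable M"
  by (auto simp: square_integrable_def)

lemma (in finite_measure) square_integrable_const:
  "(\<lambda>x. c) \<in> square_integrable M"
  by (auto simp: square_integrable_def)

lemma square_integrable_bounded_mult:
  assumes "f \<in> square_integrable M" "g \<in> borel_measurable M"
    and "\<And>x. x \<in> space M \<Longrightarrow> \<bar>g x\<bar> \<le> B"
  shows "(\<lambda>x. g x * f x) \<in> square_integrable M"
proof (rule square_integrable_bound[OF square_integrable_cmult[OF assms(1), of B]])
  show "(\<lambda>x. g x * f x) \<in> borel_measurable M"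
    using assms by (auto simp: square_integrable_def)
  show "AE x in M. \<bar>g x * f x\<bar> \<le> \<bar>B * f x\<bar>"
  proof (rule AE_I2)
    fix x assume "x \<in> space M"
    then have "\<bar>g x\<bar> \<le> \<bar>B\<bar>" using assms(3) by force
    then show "\<bar>g x * f x\<bar> \<le> \<bar>B * f x\<bar>" by (simp add: abs_mult mult_right_mono)
  qed
qed

section \<open>Inner product, norm and the Cauchy-Schwarz inequality\<close>

lemma l2_norm_nonneg: "0 \<le> l2_norm M f"
  by (simp add: l2_norm_def)

lemma l2_norm_power2: "(l2_norm M f)\<^sup>2 = (\<integral>x. (f x)\<^sup>2 \<partial>M)"
  by (simp add: l2_norm_def)

lemma l2_inner_self: "l2_inner M f f = (l2_norm M f)\<^sup>2"
  unfolding l2_norm_power2 by (simp add: l2_inner_def power2_eq_square)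

lemma l2_inner_commute: "l2_inner M f g = l2_inner M g f"
  by (simp add: l2_inner_def mult.commute)

lemma l2_inner_add_right:
  assumes "f \<in> square_integrable M" "g \<in> square_integrable M" "h \<in> square_integrable M"
  shows "l2_inner M f (\<lambda>x. g x + h x) = l2_inner M f g + l2_inner M f h"
  using square_integrable_mult[OF assms(1,2)] square_integrable_mult[OF assms(1,3)]
  by (simp add: l2_inner_def distrib_left)

lemma l2_inner_diff_right:
  assumes "f \<in> square_integrable M" "g \<in> square_integrable M" "h \<in> square_integrable M"
  shows "l2_inner M f (\<lambda>x. g x - h x) = l2_inner M f g - l2_inner M f h"
  using square_integrable_mult[OF assms(1,2)] square_integrable_mult[OF assms(1,3)]
  by (simp add: l2_inner_def right_diff_distrib)

lemma l2_inner_diff_left: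
  assumes "f \<in> square_integrable M" "g \<in> square_integrable M" "h \<in> square_integrable M"
  shows "l2_inner M (\<lambda>x. g x - h x) f = l2_inner M g f - l2_inner M h f"
  using l2_inner_diff_right[OF assms] by (simp add: l2_inner_commute)

lemma l2_inner_cmult_right: "l2_inner M f (\<lambda>x. c * g x) = c * l2_inner M f g"
  by (simp add: l2_inner_def mult.left_commute)

lemma l2_inner_sum_right:
  assumes "f \<in> square_integrable M" "\<And>i. i \<in> A \<Longrightarrow> g i \<in> square_integrable M"
  shows "l2_inner M f (\<lambda>x. \<Sum>i\<in>A. g i x) = (\<Sum>i\<in>A. l2_inner M f (g i))"
  unfolding l2_inner_def sum_distrib_left
  by (rule Bochner_Integration.integral_sum) (rule square_integrable_mult[OF assms(1) assms(2)])

text \<open>This polynomial in \<open>c\<close> is the common source of Cauchy-Schwarz, the triangle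
  inequality, the variational argument behind the Riesz representation, and the passage from weak to
  strong convergence.\<close>

lemma l2_norm_add_power2:
  assumes "f \<in> square_integrable M" "g \<in> square_integrable M"
  shows "(l2_norm M (\<lambda>x. f x + c * g x))\<^sup>2
    = (l2_norm M f)\<^sup>2 + 2 * c * l2_inner M f g + c\<^sup>2 * (l2_norm M g)\<^sup>2"
proof -
  have "(\<lambda>x. (f x + c * g x)\<^sup>2) = (\<lambda>x. (f x)\<^sup>2 + (2 * c) * (f x * g x) + c\<^sup>2 * (g x)\<^sup>2)"
    by (simp add: power2_eq_square algebra_simps)
  then show ?thesis
    using assms square_integrable_mult[OF assms]
    by (simp add: l2_norm_power2 l2_inner_def square_integrable_def)
qed

text \<open>The quadratic polynomial t -> |f + t g|^2 is nonnegative; its value at the minimiser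
  -b/c is a - b^2/c. If c = 0 the polynomial is affine in t and can be nonnegative everywhere only
  if b = 0.\<close>

lemma abs_l2_inner_le:
  assumes "f \<in> square_integrable M" "g \<in> square_integrable M"
  shows "\<bar>l2_inner M f g\<bar> \<le> l2_norm M f * l2_norm M g"
proof -
  define a c where "a = (l2_norm M f)\<^sup>2" and "c = (l2_norm M g)\<^sup>2"
  define b where "b = l2_inner M f g"
  have pos: "0 \<le> a + 2 * t * b + t\<^sup>2 * c" for t
    using l2_norm_add_power2[OF assms, of t] zero_le_power2[of "l2_norm M (\<lambda>x. f x + t * g x)"]
    by (simp add: a_def b_def c_def)
  have "c \<ge> 0" by (simp add: c_def)
  have "b\<^sup>2 \<le> a * c"
  proof (cases "c = 0")
    case True
    have "b = 0"
    proof (rule ccontr)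
      assume "b \<noteq> 0"
      \<comment> \<open>At this point the affine expression a + 2tb equals -1.\<close>
      then show False using pos[of "- (a + 1) / (2 * b)"] True by (simp add: field_simps)
    qed
    then show ?thesis using True by simp
  next
    case False
    with \<open>c \<ge> 0\<close> have "c > 0" by simp
    have "a + 2 * (- b / c) * b + (- b / c)\<^sup>2 * c = a - b\<^sup>2 / c"
      using \<open>c > 0\<close> by (simp add: field_simps power2_eq_square)
    with pos[of "- b / c"] have "b\<^sup>2 / c \<le> a" by simp
    then show ?thesis using \<open>c > 0\<close> by (simp add: field_simps)
  qed
  then have "\<bar>b\<bar>\<^sup>2 \<le> (l2_norm M f * l2_norm M g)\<^sup>2"
    by (simp add: a_def c_def power_mult_distrib)
  then show ?thesis
    unfolding b_def by (rule power2_le_imp_le) (simp add: l2_norm_nonneg)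
qed

lemma l2_norm_triangle:
  assumes "f \<in> square_integrable M" "g \<in> square_integrable M"
  shows "l2_norm M (\<lambda>x. f x + g x) \<le> l2_norm M f + l2_norm M g"
proof (rule power2_le_imp_le)
  show "(l2_norm M (\<lambda>x. f x + g x))\<^sup>2 \<le> (l2_norm M f + l2_norm M g)\<^sup>2"
    using l2_norm_add_power2[OF assms, of 1] abs_l2_inner_le[OF assms]
    by (simp add: power2_sum)
qed (simp add: l2_norm_nonneg)

lemma l2_norm_cmult: "l2_norm M (\<lambda>x. c * f x) = \<bar>c\<bar> * l2_norm M f"
  by (simp add: l2_norm_def power_mult_distrib real_sqrt_mult)

lemma l2_norm_minus_commute: "l2_norm M (\<lambda>x. f x - g x) = l2_norm M (\<lambda>x. g x - f x)"
  by (simp add: l2_norm_def power2_commute)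

lemma l2_norm_triangle_diff:
  assumes "f \<in> square_integrable M" "g \<in> square_integrable M"
  shows "l2_norm M f \<le> l2_norm M g + l2_norm M (\<lambda>x. f x - g x)"
  using l2_norm_triangle[OF assms(2) square_integrable_diff[OF assms]] by simp

lemma l2_norm_mono:
  assumes "f \<in> square_integrable M" "g \<in> borel_measurable M"
    and "AE x in M. \<bar>g x\<bar> \<le> \<bar>f x\<bar>"
  shows "l2_norm M g \<le> l2_norm M f"
proof -
  have "(\<integral>x. (g x)\<^sup>2 \<partial>M) \<le> (\<integral>x. (f x)\<^sup>2 \<partial>M)"
  proof (rule integral_mono_AE)
    show "AE x in M. (g x)\<^sup>2 \<le> (f x)\<^sup>2"
      using assms(3) by eventually_elim (simp add: abs_le_square_iff)
  qed (use square_integrable_bound[OF assms] assms(1) in \<open>auto simp: square_integrable_def\<close>)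
  then show ?thesis by (simp add: l2_norm_def)
qed

section \<open>From extended nonnegative integrals to norms\<close>

lemma square_integrable_nnI:
  assumes "f \<in> borel_measurable M" "(\<integral>\<^sup>+x. ennreal ((f x)\<^sup>2) \<partial>M) < \<infinity>"
  shows "f \<in> square_integrable M"
  using assms by (auto simp: square_integrable_def intro!: integrableI_bounded)

lemma nn_integral_power2_eq:
  assumes "f \<in> square_integrable M"
  shows "(\<integral>\<^sup>+x. ennreal ((f x)\<^sup>2) \<partial>M) = ennreal ((l2_norm M f)\<^sup>2)"
  using assms by (simp add: l2_norm_power2 square_integrable_def nn_integral_eq_integral)

lemma l2_norm_le_nnI:
  assumes "(\<integral>\<^sup>+x. ennreal ((f x)\<^sup>2) \<partial>M) \<le> ennreal (c\<^sup>2)" "0 \<le> c" "f \<in> borel_measurable M"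
  shows "l2_norm M f \<le> c"
proof -
  have "f \<in> square_integrable M"
    by (rule square_integrable_nnI) (use assms in \<open>auto intro: le_less_trans\<close>)
  then have "ennreal ((l2_norm M f)\<^sup>2) \<le> ennreal (c\<^sup>2)"
    using assms(1) by (simp add: nn_integral_power2_eq)
  then show ?thesis
    using assms(2) by (simp add: abs_le_square_iff[symmetric] l2_norm_nonneg)
qed

text \<open>Riesz--Fischer on a finite measure space: a rapidly converging subsequence converges almost
  everywhere because its increments are summable in \<open>L\<^sup>1\<close>; Fatou's lemma does the rest.\<close>

lemma (in finite_measure) l2_complete:
  fixes v :: "nat \<Rightarrow> 'a \<Rightarrow> real"
  assumes v: "\<And>n. v n \<in> square_integrable M"
    and Cau: "\<And>e. e > 0 \<Longrightarrow> \<exists>N. \<forall>i\<ge>N. \<forall>j\<ge>N. l2_norm M (\<lambda>x. v i x - v j x) < e"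
  obtains w where "w \<in> square_integrable M" "(\<lambda>n. l2_norm M (\<lambda>x. v n x - w x)) \<longlonglongrightarrow> 0"
proof -
  have [measurable]: "v n \<in> borel_measurable M" for n using v by (auto simp: square_integrable_def)
  have "\<exists>N. \<forall>i\<ge>N. \<forall>j\<ge>N. l2_norm M (\<lambda>x. v i x - v j x) < (1/2)^k" for k :: nat
    by (rule Cau) simp
  then obtain N where N: "\<And>k i j. i \<ge> N k \<Longrightarrow> j \<ge> N k \<Longrightarrow> l2_norm M (\<lambda>x. v i x - v j x) < (1/2)^k"
    by metis
  \<comment> \<open>The thresholds \<open>N k\<close> need not be monotone. Summing them gives a
    monotone index above each \<open>N k\<close>, and the summand \<open>k\<close> makes it tend to
    infinity.\<close>
  define r where "r = (\<lambda>k. k + (\<Sum>i\<le>k. N i))"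
  have rN: "r k \<ge> N k" for k
    unfolding r_def by (rule trans_le_add2) (simp add: member_le_sum)
  have r_mono: "r k \<le> r (Suc k)" for k by (simp add: r_def)
  have r_ge: "r k \<ge> k" for k by (simp add: r_def)
  define d where "d = (\<lambda>k x. v (r (Suc k)) x - v (r k) x)"
  have d_sq: "d k \<in> square_integrable M" for k unfolding d_def by (intro square_integrable_diff v)
  have d_norm: "l2_norm M (d k) \<le> (1/2)^k" for k
    using N[of k "r (Suc k)" "r k"] rN[of k] r_mono[of k] unfolding d_def by fastforce
  have [measurable]: "d k \<in> borel_measurable M" for k using d_sq by (auto simp: square_integrable_def)
  \<comment> \<open>Cauchy-Schwarz against the constant 1 turns the \<open>L\<^sup>2\<close> bounds
    of the increments into \<open>L\<^sup>1\<close> bounds; finiteness of the measure makes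
    \<open>c\<close> meaningful.\<close>
  define c where "c = l2_norm M (\<lambda>x. 1)"
  have c0: "c \<ge> 0" by (simp add: c_def l2_norm_nonneg)
  have d_int: "(\<integral>\<^sup>+x. ennreal \<bar>d k x\<bar> \<partial>M) \<le> ennreal (c * (1/2)^k)" for k
  proof -
    have "l2_inner M (\<lambda>x. \<bar>d k x\<bar>) (\<lambda>x. 1) \<le> l2_norm M (\<lambda>x. \<bar>d k x\<bar>) * c"
      unfolding c_def
      using abs_l2_inner_le[OF square_integrable_abs[OF d_sq[of k]] square_integrable_const[of 1]] by simp
    also have "l2_norm M (\<lambda>x. \<bar>d k x\<bar>) = l2_norm M (d k)" by (simp add: l2_norm_def)
    also have "l2_norm M (d k) * c \<le> (1/2)^k * c" using d_norm c0 by (rule mult_right_mono)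
    finally have "(\<integral>x. \<bar>d k x\<bar> \<partial>M) \<le> c * (1/2)^k" by (simp add: l2_inner_def mult.commute)
    moreover have "integrable M (\<lambda>x. \<bar>d k x\<bar>)"
      using square_integrable_mult[OF square_integrable_abs[OF d_sq[of k]] square_integrable_const[of 1]] by simp
    ultimately show ?thesis
      by (subst nn_integral_eq_integral) (auto intro!: ennreal_leI)
  qed
  have "(\<integral>\<^sup>+x. (\<Sum>k. ennreal \<bar>d k x\<bar>) \<partial>M) = (\<Sum>k. \<integral>\<^sup>+x. ennreal \<bar>d k x\<bar> \<partial>M)"
    by (rule nn_integral_suminf) simp
  also have "\<dots> \<le> (\<Sum>k. ennreal (c * (1/2)^k))"
    by (intro suminf_le d_int) auto
  also have "\<dots> = ennreal (\<Sum>k. c * (1/2)^k)"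
    by (rule suminf_ennreal2) (use c0 in \<open>auto intro!: summable_mult\<close>)
  also have "\<dots> < \<infinity>" by simp
  finally have "AE x in M. (\<Sum>k. ennreal \<bar>d k x\<bar>) \<noteq> \<infinity>"
    by (intro nn_integral_PInf_AE) auto
  then have conv: "AE x in M. convergent (\<lambda>k. v (r k) x)"
  proof eventually_elim
    case (elim x)
    then have "summable (\<lambda>k. \<bar>d k x\<bar>)" by (intro summable_suminf_not_top) auto
    then have "summable (\<lambda>k. d k x)" by (rule summable_rabs_cancel)
    then have "convergent (\<lambda>n. \<Sum>k<n. d k x)" by (simp add: summable_iff_convergent)
    moreover have "(\<Sum>k<n. d k x) = v (r n) x - v (r 0) x" for n
      unfolding d_def by (rule sum_lessThan_telescope)
    ultimately have "convergent (\<lambda>n. v (r n) x - v (r 0) x)" by simp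
    then show ?case
      using convergent_add[OF _ convergent_const[of "v (r 0) x"]] by fastforce
  qed
  define w where "w = (\<lambda>x. lim (\<lambda>k. v (r k) x))"
  have [measurable]: "w \<in> borel_measurable M" unfolding w_def by measurable
  have lims: "AE x in M. (\<lambda>k. v (r k) x) \<longlonglongrightarrow> w x"
    using conv by eventually_elim (simp add: w_def convergent_LIMSEQ_iff)
  \<comment> \<open>Fatou is applied along the subsequence with \<open>n\<close> kept fixed, so the
    estimate covers the full sequence and not only the subsequence.\<close>
  have fatou: "(\<integral>\<^sup>+x. ennreal ((v n x - w x)\<^sup>2) \<partial>M) \<le> ennreal (((1/2)^k)\<^sup>2)" if "n \<ge> N k" for n k
  proof -
    have "(\<integral>\<^sup>+x. ennreal ((v n x - w x)\<^sup>2) \<partial>M)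
      = (\<integral>\<^sup>+x. liminf (\<lambda>i. ennreal ((v n x - v (r i) x)\<^sup>2)) \<partial>M)"
    proof (rule nn_integral_cong_AE, use lims in eventually_elim)
      case (elim x)
      have "(\<lambda>i. ennreal ((v n x - v (r i) x)\<^sup>2)) \<longlonglongrightarrow> ennreal ((v n x - w x)\<^sup>2)"
        by (intro tendsto_ennrealI tendsto_intros elim)
      then show ?case by (metis lim_imp_Liminf trivial_limit_sequentially)
    qed
    also have "\<dots> \<le> liminf (\<lambda>i. \<integral>\<^sup>+x. ennreal ((v n x - v (r i) x)\<^sup>2) \<partial>M)"
      by (rule nn_integral_liminf) measurable
    also have "\<dots> \<le> limsup (\<lambda>i. \<integral>\<^sup>+x. ennreal ((v n x - v (r i) x)\<^sup>2) \<partial>M)"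
      by (rule Liminf_le_Limsup) simp
    also have "\<dots> \<le> ennreal (((1/2)^k)\<^sup>2)"
    proof (rule Limsup_bounded, rule eventually_sequentiallyI[of "N k"])
      fix i assume "i \<ge> N k"
      then have "r i \<ge> N k" using r_ge[of i] by simp
      then have "l2_norm M (\<lambda>x. v n x - v (r i) x) \<le> (1/2)^k" using N[OF that] by fastforce
      then show "(\<integral>\<^sup>+x. ennreal ((v n x - v (r i) x)\<^sup>2) \<partial>M) \<le> ennreal (((1/2)^k)\<^sup>2)"
        by (subst nn_integral_power2_eq)
          (auto intro!: ennreal_leI power_mono l2_norm_nonneg square_integrable_diff v)
    qed
    finally show ?thesis .
  qed
  have sq: "(\<lambda>x. v (N 0) x - w x) \<in> square_integrable M"
    by (rule square_integrable_nnI) (use fatou[of 0 "N 0"] in \<open>auto intro: le_less_trans\<close>)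
  have w: "w \<in> square_integrable M"
    using square_integrable_diff[OF v[of "N 0"] sq] by simp
  have bnd: "l2_norm M (\<lambda>x. v n x - w x) \<le> (1/2)^k" if "n \<ge> N k" for n k
    by (rule l2_norm_le_nnI[OF fatou[OF that]]) auto
  have "(\<lambda>n. l2_norm M (\<lambda>x. v n x - w x)) \<longlonglongrightarrow> 0"
  proof (rule LIMSEQ_I)
    fix e :: real assume "e > 0"
    then obtain k where "(1/2::real)^k < e" using real_arch_pow_inv[of e "1/2"] by auto
    then show "\<exists>no. \<forall>n\<ge>no. norm (l2_norm M (\<lambda>x. v n x - w x) - 0) < e"
      using bnd by (auto intro!: exI[of _ "N k"] simp: l2_norm_nonneg intro: le_less_trans)
  qed
  with w show thesis by (rule that)
qed

text \<open>The representing function minimises \<open>v \<mapsto> \<parallel>v\<parallel>\<^sup>2/2 - l v\<close>; the parallelogram identity makes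
  minimising sequences Cauchy.\<close>

lemma (in finite_measure) l2_riesz:
  fixes l :: "('a \<Rightarrow> real) \<Rightarrow> real"
  assumes add: "\<And>f g c. f \<in> square_integrable M \<Longrightarrow> g \<in> square_integrable M \<Longrightarrow>
      l (\<lambda>x. f x + c * g x) = l f + c * l g"
    and bnd: "\<And>f. f \<in> square_integrable M \<Longrightarrow> \<bar>l f\<bar> \<le> B * l2_norm M f"
  obtains w where "w \<in> square_integrable M" "\<And>f. f \<in> square_integrable M \<Longrightarrow> l f = l2_inner M w f"
proof -
  let ?H = "square_integrable M"
  define \<Phi> where "\<Phi> v = (l2_norm M v)\<^sup>2 / 2 - l v" for v
  \<comment> \<open>With N the norm of v, the functional is at least N^2/2 - B N, which is ((N -
    B)^2 - B^2)/2.\<close>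
  have low: "- (B\<^sup>2 / 2) \<le> \<Phi> v" if "v \<in> ?H" for v
  proof -
    have "0 \<le> (l2_norm M v - B)\<^sup>2" by simp
    then show ?thesis using bnd[OF that] by (simp add: \<Phi>_def power2_diff mult.commute)
  qed
  have mem: "(\<lambda>x. f x + c * g x) \<in> ?H" if "f \<in> ?H" "g \<in> ?H" for f g c
    using that by (intro square_integrable_add square_integrable_cmult)
  have \<Phi>_add: "\<Phi> (\<lambda>x. f x + c * g x) = \<Phi> f + c * (l2_inner M f g - l g) + c\<^sup>2 / 2 * (l2_norm M g)\<^sup>2"
    if "f \<in> ?H" "g \<in> ?H" for f g c
    using l2_norm_add_power2[OF that, of c] add[OF that, of c]
    by (simp add: \<Phi>_def field_simps)
  define I where "I = Inf (\<Phi> ` ?H)"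
  have bb: "bdd_below (\<Phi> ` ?H)" using low by (auto intro!: bdd_belowI2)
  have ne: "?H \<noteq> {}" using square_integrable_const by auto
  have I_le: "I \<le> \<Phi> v" if "v \<in> ?H" for v
    unfolding I_def using bb that by (intro cInf_lower) auto
  have "\<exists>v\<in>?H. \<Phi> v < I + e" if "e > 0" for e
    using cInf_lessD[of "\<Phi> ` ?H" "I + e"] ne that unfolding I_def by auto
  then have "\<forall>n. \<exists>v\<in>?H. \<Phi> v < I + 1 / real (Suc n)" by simp
  then obtain v where vH: "\<And>n. v n \<in> ?H" and v: "\<And>n. \<Phi> (v n) < I + 1 / real (Suc n)" by metis
  \<comment> \<open>With k = g - f, the value at the midpoint f + k/2 is at least \<open>I\<close>,
    and \<open>\<Phi> f + \<Phi> g\<close> exceeds twice that value by exactly |k|^2/4.\<close>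
  have par: "(l2_norm M (\<lambda>x. f x - g x))\<^sup>2 / 4 \<le> \<Phi> f + \<Phi> g - 2 * I" if fg: "f \<in> ?H" "g \<in> ?H" for f g
  proof -
    define k where "k = (\<lambda>x. g x - f x)"
    have k: "k \<in> ?H" unfolding k_def using fg by (intro square_integrable_diff)
    have "g = (\<lambda>x. f x + 1 * k x)" by (simp add: k_def)
    then have "\<Phi> g = \<Phi> (\<lambda>x. f x + 1 * k x)" by simp
    then have 1: "\<Phi> g = \<Phi> f + (l2_inner M f k - l k) + (l2_norm M k)\<^sup>2 / 2"
      using \<Phi>_add[OF fg(1) k, of 1] by simp
    have 2: "I \<le> \<Phi> f + (l2_inner M f k - l k) / 2 + (l2_norm M k)\<^sup>2 / 8"
      using I_le[OF mem[OF fg(1) k, of "1/2"]] \<Phi>_add[OF fg(1) k, of "1/2"]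
      by (simp add: power_divide)
    have 3: "l2_norm M (\<lambda>x. f x - g x) = l2_norm M k" unfolding k_def by (rule l2_norm_minus_commute)
    have "N / 4 \<le> a + c - 2 * J" if "c = a + (p - q) + N / 2" "J \<le> a + (p - q) / 2 + N / 8" for N a c p q J :: real
      using that by argo
    from this[OF 1 2] show ?thesis unfolding 3 .
  qed
  obtain w where w: "w \<in> ?H" and lim: "(\<lambda>n. l2_norm M (\<lambda>x. v n x - w x)) \<longlonglongrightarrow> 0"
  proof (rule l2_complete[of v])
    fix e :: real assume e: "e > 0"
    \<comment> \<open>By \<open>par\<close>, |v i - v j|^2 < 4 (1/(i+1) + 1/(j+1)), hence the
      8.\<close>
    obtain N where N: "1 / real (Suc N) < e\<^sup>2 / 8"
      using nat_approx_posE[of "e\<^sup>2 / 8"] e by auto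
    have "l2_norm M (\<lambda>x. v i x - v j x) < e" if "i \<ge> N" "j \<ge> N" for i j
    proof -
      have "1 / real (Suc i) \<le> 1 / real (Suc N)" "1 / real (Suc j) \<le> 1 / real (Suc N)"
        using that by (auto intro!: divide_left_mono)
      then have "(l2_norm M (\<lambda>x. v i x - v j x))\<^sup>2 < e\<^sup>2"
        using par[OF vH[of i] vH[of j]] v[of i] v[of j] N by linarith
      then show ?thesis using e by (simp add: power2_less_imp_less)
    qed
    then show "\<exists>N. \<forall>i\<ge>N. \<forall>j\<ge>N. l2_norm M (\<lambda>x. v i x - v j x) < e" by blast
  qed (use vH in auto)
  \<comment> \<open>Expanding \<open>\<Phi> (v n)\<close> around \<open>w\<close> and dropping the
    nonnegative square leaves terms linear in |v n - w|, which vanish in the limit.\<close>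
  have \<Phi>w: "\<Phi> w \<le> I"
  proof (rule LIMSEQ_le_const)
    have "(\<lambda>n. I + 1 / real (Suc n)) \<longlonglongrightarrow> I + 0"
      by (intro tendsto_intros LIMSEQ_Suc[OF lim_1_over_n])
    then have a: "(\<lambda>n. I + 1 / real (Suc n)) \<longlonglongrightarrow> I" by simp
    define K where "K = l2_norm M w + \<bar>B\<bar>"
    let ?d = "\<lambda>n. l2_norm M (\<lambda>x. v n x - w x)"
    have "(\<lambda>n. I + 1 / real (Suc n) + K * ?d n) \<longlonglongrightarrow> I + K * 0"
      by (intro tendsto_intros a lim)
    then show "(\<lambda>n. I + 1 / real (Suc n) + K * ?d n) \<longlonglongrightarrow> I" by simp
    have "\<Phi> w \<le> I + 1 / real (Suc n) + K * ?d n" for n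
    proof -
      define k where "k = (\<lambda>x. v n x - w x)"
      have k: "k \<in> ?H" unfolding k_def by (intro square_integrable_diff vH w)
      have "v n = (\<lambda>x. w x + 1 * k x)" by (simp add: k_def)
      then have "\<Phi> (v n) = \<Phi> (\<lambda>x. w x + 1 * k x)" by simp
      then have "\<Phi> (v n) = \<Phi> w + (l2_inner M w k - l k) + (l2_norm M k)\<^sup>2 / 2"
        using \<Phi>_add[OF w k, of 1] by simp
      then have "\<Phi> w \<le> \<Phi> (v n) - l2_inner M w k + l k" by simp
      also have "\<dots> \<le> \<Phi> (v n) + l2_norm M w * l2_norm M k + B * l2_norm M k"
        using abs_l2_inner_le[OF w k] bnd[OF k] by linarith
      also have "\<dots> \<le> \<Phi> (v n) + K * l2_norm M k"
        using mult_right_mono[OF abs_ge_self[of B] l2_norm_nonneg[of M k]]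
        by (simp add: K_def algebra_simps)
      also have "\<dots> \<le> I + 1 / real (Suc n) + K * ?d n" using v[of n] by (simp add: k_def)
      finally show ?thesis .
    qed
    then show "\<exists>N. \<forall>n\<ge>N. \<Phi> w \<le> I + 1 / real (Suc n) + K * ?d n" by blast
  qed
  have "l f = l2_inner M w f" if f: "f \<in> ?H" for f
  proof -
    define a where "a = l2_inner M w f - l f"
    define q where "q = (l2_norm M f)\<^sup>2 / 2"
    have q: "q \<ge> 0" by (simp add: q_def)
    have pos: "0 \<le> t * a + t\<^sup>2 * q" for t
      using I_le[OF mem[OF w f, of t]] \<Phi>_add[OF w f, of t] \<Phi>w by (simp add: a_def q_def)
    \<comment> \<open>The optimal t would be -a/(2q), but q may be 0. Dividing by 1 + q instead
      still yields the negative value -a^2/(1+q)^2 unless a = 0.\<close>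
    have "0 \<le> (- a / (1 + q)) * a + (- a / (1 + q))\<^sup>2 * q" by (rule pos)
    also have "\<dots> = - (a\<^sup>2 / (1 + q)\<^sup>2)"
    proof -
      have "1 + q > 0" using q by simp
      then show ?thesis by (simp add: divide_simps power2_eq_square) (simp add: algebra_simps)
    qed
    finally have "a\<^sup>2 / (1 + q)\<^sup>2 \<le> 0" by simp
    then have "a = 0" using q by (simp add: divide_le_0_iff)
    then show ?thesis by (simp add: a_def)
  qed
  with w show thesis by (rule that)
qed

section \<open>Weak convergence\<close>

definition l2_weak_limit :: "'a measure \<Rightarrow> (nat \<Rightarrow> 'a \<Rightarrow> real) \<Rightarrow> ('a \<Rightarrow> real) \<Rightarrow> bool" where
  "l2_weak_limit M h w \<longleftrightarrow>
     (\<forall>\<phi>\<in>square_integrable M. (\<lambda>i. l2_inner M (h i) \<phi>) \<longlonglongrightarrow> l2_inner M w \<phi>)"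

lemma l2_strong_imp_weak_limit:
  assumes "\<And>i. h i \<in> square_integrable M" "w \<in> square_integrable M"
    and "(\<lambda>i. l2_norm M (\<lambda>x. h i x - w x)) \<longlonglongrightarrow> 0"
  shows "l2_weak_limit M h w"
  unfolding l2_weak_limit_def
proof
  fix \<phi> assume \<phi>: "\<phi> \<in> square_integrable M"
  have "(\<lambda>i. l2_inner M (h i) \<phi> - l2_inner M w \<phi>) \<longlonglongrightarrow> 0"
  proof (rule Lim_null_comparison)
    show "(\<lambda>i. l2_norm M (\<lambda>x. h i x - w x) * l2_norm M \<phi>) \<longlonglongrightarrow> 0"
      using tendsto_mult_right[OF assms(3), of "l2_norm M \<phi>"] by simp
    show "\<forall>\<^sub>F i in sequentially. norm (l2_inner M (h i) \<phi> - l2_inner M w \<phi>)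
        \<le> l2_norm M (\<lambda>x. h i x - w x) * l2_norm M \<phi>"
      using abs_l2_inner_le[OF square_integrable_diff[OF assms(1,2)] \<phi>]
      by (simp add: l2_inner_diff_left[OF \<phi> assms(1,2)])
  qed
  then show "(\<lambda>i. l2_inner M (h i) \<phi>) \<longlonglongrightarrow> l2_inner M w \<phi>"
    by (simp add: LIM_zero_iff)
qed

text \<open>Weak lower semicontinuity of the norm, by testing against the limit \<open>w\<close>
  itself. The bounds \<open>c i\<close> may vary, so that it serves both for a uniform bound and for
  convergent norms.\<close>

lemma l2_norm_weak_limit_le:
  assumes "l2_weak_limit M h w" "\<And>i. h i \<in> square_integrable M" "w \<in> square_integrable M"
    and le: "\<And>i. l2_norm M (h i) \<le> c i" and lim: "c \<longlonglongrightarrow> d"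
  shows "l2_norm M w \<le> d"
proof -
  have "(l2_norm M w)\<^sup>2 \<le> d * l2_norm M w"
    unfolding l2_inner_self[symmetric]
  proof (rule LIMSEQ_le)
    show "(\<lambda>i. l2_inner M (h i) w) \<longlonglongrightarrow> l2_inner M w w"
      using assms(1,3) by (auto simp: l2_weak_limit_def)
    show "(\<lambda>i. c i * l2_norm M w) \<longlonglongrightarrow> d * l2_norm M w"
      by (intro tendsto_intros lim)
    have "l2_inner M (h i) w \<le> c i * l2_norm M w" for i
      using abs_l2_inner_le[OF assms(2,3), of i] mult_right_mono[OF le[of i] l2_norm_nonneg[of M w]]
      by linarith
    then show "\<exists>N. \<forall>i\<ge>N. l2_inner M (h i) w \<le> c i * l2_norm M w" by blast
  qed
  moreover have "0 \<le> c i" for i using l2_norm_nonneg le by (rule order_trans)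
  then have "0 \<le> d" by (intro LIMSEQ_le_const[OF lim]) auto
  ultimately show ?thesis
    using l2_norm_nonneg[of M w] by (cases "l2_norm M w = 0") (auto simp: power2_eq_square)
qed

text \<open>The Radon-Riesz property: in the expansion of |h i - w|^2 the mixed term converges by
  weak convergence and the first term by convergence of norms.\<close>

lemma l2_weak_limit_imp_strong:
  assumes "l2_weak_limit M h w" "\<And>i. h i \<in> square_integrable M" "w \<in> square_integrable M"
    and "(\<lambda>i. l2_norm M (h i)) \<longlonglongrightarrow> l2_norm M w"
  shows "(\<lambda>i. l2_norm M (\<lambda>x. h i x - w x)) \<longlonglongrightarrow> 0"
proof -
  have eq: "(l2_norm M (\<lambda>x. h i x - w x))\<^sup>2
      = (l2_norm M (h i))\<^sup>2 - 2 * l2_inner M (h i) w + (l2_norm M w)\<^sup>2" for i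
    using l2_norm_add_power2[OF assms(2,3), of i "-1"] by simp
  have "(\<lambda>i. l2_inner M (h i) w) \<longlonglongrightarrow> (l2_norm M w)\<^sup>2"
    using assms(1,3) by (auto simp: l2_weak_limit_def l2_inner_self)
  then have "(\<lambda>i. (l2_norm M (\<lambda>x. h i x - w x))\<^sup>2)
      \<longlonglongrightarrow> (l2_norm M w)\<^sup>2 - 2 * (l2_norm M w)\<^sup>2 + (l2_norm M w)\<^sup>2"
    unfolding eq by (intro tendsto_intros assms)
  then have "(\<lambda>i. sqrt ((l2_norm M (\<lambda>x. h i x - w x))\<^sup>2)) \<longlonglongrightarrow> sqrt 0"
    by (intro tendsto_real_sqrt) simp
  then show ?thesis by (simp add: l2_norm_nonneg)
qed

section \<open>Weak sequential compactness and uniformity over compact families\<close>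

lemma convergent_subseq_countable:
  fixes a :: "nat \<Rightarrow> 'b \<Rightarrow> real"
  assumes "countable J" "\<And>i j. j \<in> J \<Longrightarrow> \<bar>a i j\<bar> \<le> B j"
  obtains r :: "nat \<Rightarrow> nat" where "strict_mono r" "\<And>j. j \<in> J \<Longrightarrow> convergent (\<lambda>i. a (r i) j)"
proof -
  \<comment> \<open>For empty \<open>J\<close> the enumeration returns arbitrary points, where
    nothing is known about \<open>a\<close>; the default 0 and the absolute values in
    \<open>S\<close> keep the sequence inside the product.\<close>
  define a' where "a' i n = (if from_nat_into J n \<in> J then a i (from_nat_into J n) else 0)" for i n
  define S where "S = PiE UNIV (\<lambda>n::nat. {- \<bar>B (from_nat_into J n)\<bar> .. \<bar>B (from_nat_into J n)\<bar>})"
  \<comment> \<open>Tychonoff replaces the diagonal argument: a countable product of compact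
    intervals is compact, and sequentially so because the function space over the naturals is first
    countable.\<close>
  have "compactin (product_topology (\<lambda>_. euclidean) UNIV) S"
    unfolding S_def compactin_PiE by simp
  then have "compact S" by (simp add: euclidean_product_topology)
  then have "seq_compact S" by (rule compact_imp_seq_compact)
  moreover have "a' i n \<in> {- \<bar>B (from_nat_into J n)\<bar> .. \<bar>B (from_nat_into J n)\<bar>}" for i n
    using assms(2)[of "from_nat_into J n" i] by (auto simp: a'_def)
  then have "\<forall>i. a' i \<in> S" by (auto simp: S_def)
  ultimately obtain l and r :: "nat \<Rightarrow> nat" where r: "strict_mono r" "(a' \<circ> r) \<longlonglongrightarrow> l"
    by (metis seq_compactE)
  have "convergent (\<lambda>i. a (r i) j)" if "j \<in> J" for j
  proof -
    have "(\<lambda>i. a' (r i) (to_nat_on J j)) \<longlonglongrightarrow> l (to_nat_on J j)"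
    proof -
      have "isCont (\<lambda>x::nat \<Rightarrow> real. x (to_nat_on J j)) l"
        by (metis UNIV_I continuous_on_eq_continuous_at continuous_on_product_coordinates open_UNIV)
      from isCont_tendsto_compose[OF this r(2)] show ?thesis by (simp add: o_def)
    qed
    moreover have "a' i (to_nat_on J j) = a i j" for i
      using assms(1) that by (simp add: a'_def)
    ultimately show ?thesis by (auto simp: convergent_def)
  qed
  with r(1) show thesis by (rule that)
qed

text \<open>A subsequence converges when tested against the countable set \<open>E\<close>, hence
  against its span; the uniform norm bound carries this over to the closure of the span, and the
  limit functional is represented by Riesz. The equation for \<open>\<psi>\<close> is asked
  pointwise on the space only, since a representative may be arbitrary elsewhere.\<close>

lemma (in finite_measure) l2_weakly_compact:
  fixes h :: "nat \<Rightarrow> 'a \<Rightarrow> real"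
  assumes h: "\<And>i. h i \<in> square_integrable M" and B: "\<And>i. l2_norm M (h i) \<le> B"
    and E: "countable E" "E \<subseteq> square_integrable M"
    and dense: "\<And>\<phi> e. \<phi> \<in> square_integrable M \<Longrightarrow> e > 0 \<Longrightarrow>
      \<exists>\<psi> F a. \<psi> \<in> square_integrable M \<and> l2_norm M (\<lambda>x. \<phi> x - \<psi> x) < e \<and> F \<subseteq> E \<and>
        (\<forall>x\<in>space M. \<psi> x = (\<Sum>f\<in>F. a f * f x))"
  obtains r :: "nat \<Rightarrow> nat" and w
  where "strict_mono r" "w \<in> square_integrable M" "l2_weak_limit M (\<lambda>i. h (r i)) w"
proof -
  let ?H = "square_integrable M"
  have B0: "0 \<le> B" using l2_norm_nonneg[of M "h 0"] B[of 0] by linarith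
  have hb: "\<bar>l2_inner M (h i) \<phi>\<bar> \<le> B * l2_norm M \<phi>" if "\<phi> \<in> ?H" for i \<phi>
    using abs_l2_inner_le[OF h[of i] that] mult_right_mono[OF B[of i] l2_norm_nonneg[of M \<phi>]]
    by linarith
  obtain r :: "nat \<Rightarrow> nat"
    where r: "strict_mono r" and conv: "\<And>f. f \<in> E \<Longrightarrow> convergent (\<lambda>i. l2_inner M (h (r i)) f)"
    by (rule convergent_subseq_countable[OF E(1), of "\<lambda>i. l2_inner M (h i)" "\<lambda>f. B * l2_norm M f"])
      (use hb E(2) in auto)
  have conv_all: "convergent (\<lambda>i. l2_inner M (h (r i)) \<phi>)" if \<phi>: "\<phi> \<in> ?H" for \<phi>
    unfolding Cauchy_convergent_iff[symmetric]
  proof (rule CauchyI)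
    fix e :: real assume e: "e > 0"
    \<comment> \<open>Two approximation errors of at most e/4 and a Cauchy error below e/2 add up to
      less than e; B + 1 avoids division by zero.\<close>
    define e' where "e' = e / (4 * (B + 1))"
    have e': "e' > 0" using e B0 by (simp add: e'_def)
    obtain \<psi> F a where \<psi>: "\<psi> \<in> ?H" "l2_norm M (\<lambda>x. \<phi> x - \<psi> x) < e'" and F: "F \<subseteq> E"
      and \<psi>F: "\<And>x. x \<in> space M \<Longrightarrow> \<psi> x = (\<Sum>f\<in>F. a f * f x)"
      using dense[OF \<phi> e'] by blast
    have "l2_inner M (h (r i)) \<psi> = (\<Sum>f\<in>F. a f * l2_inner M (h (r i)) f)" for i
    proof -
      have "l2_inner M (h (r i)) \<psi> = l2_inner M (h (r i)) (\<lambda>x. \<Sum>f\<in>F. a f * f x)"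
        unfolding l2_inner_def by (rule Bochner_Integration.integral_cong) (auto simp: \<psi>F)
      also have "\<dots> = (\<Sum>f\<in>F. l2_inner M (h (r i)) (\<lambda>x. a f * f x))"
        by (rule l2_inner_sum_right) (use h E F in \<open>auto intro!: square_integrable_cmult\<close>)
      finally show ?thesis by (simp add: l2_inner_cmult_right)
    qed
    moreover have "convergent (\<lambda>i. \<Sum>f\<in>F. a f * l2_inner M (h (r i)) f)"
      using F conv by (intro convergent_sum convergent_mult convergent_const) auto
    ultimately have "Cauchy (\<lambda>i. l2_inner M (h (r i)) \<psi>)" by (simp add: Cauchy_convergent_iff)
    then obtain N where N: "\<And>i j. i \<ge> N \<Longrightarrow> j \<ge> N \<Longrightarrow>
        norm (l2_inner M (h (r i)) \<psi> - l2_inner M (h (r j)) \<psi>) < e / 2"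
      using CauchyD[of _ "e / 2"] e by (metis half_gt_zero)
    have close: "\<bar>l2_inner M (h i) \<phi> - l2_inner M (h i) \<psi>\<bar> \<le> e / 4" for i
    proof -
      have "\<bar>l2_inner M (h i) \<phi> - l2_inner M (h i) \<psi>\<bar> \<le> B * l2_norm M (\<lambda>x. \<phi> x - \<psi> x)"
        using hb[OF square_integrable_diff[OF \<phi> \<psi>(1)], of i] l2_inner_diff_right[OF h[of i] \<phi> \<psi>(1)] by simp
      also have "\<dots> \<le> (B + 1) * e'"
        using \<psi>(2) B0 by (intro mult_mono) (auto simp: l2_norm_nonneg)
      also have "\<dots> = e / 4" using B0 by (simp add: e'_def divide_simps)
      finally show ?thesis .
    qed
    have "norm (l2_inner M (h (r i)) \<phi> - l2_inner M (h (r j)) \<phi>) < e" if "i \<ge> N" "j \<ge> N" for i j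
      using N[OF that] close[of "r i"] close[of "r j"] unfolding real_norm_def by linarith
    then show "\<exists>N. \<forall>i\<ge>N. \<forall>j\<ge>N.
        norm (l2_inner M (h (r i)) \<phi> - l2_inner M (h (r j)) \<phi>) < e" by blast
  qed
  define l where "l \<phi> = lim (\<lambda>i. l2_inner M (h (r i)) \<phi>)" for \<phi>
  have l: "(\<lambda>i. l2_inner M (h (r i)) \<phi>) \<longlonglongrightarrow> l \<phi>" if "\<phi> \<in> ?H" for \<phi>
    using conv_all[OF that] by (simp add: l_def convergent_LIMSEQ_iff)
  obtain w where w: "w \<in> ?H" "\<And>f. f \<in> ?H \<Longrightarrow> l f = l2_inner M w f"
  proof (rule l2_riesz[of l B])
    fix f g c assume fg: "f \<in> ?H" "g \<in> ?H"
    have "(\<lambda>i. l2_inner M (h (r i)) f + c * l2_inner M (h (r i)) g) \<longlonglongrightarrow> l f + c * l g"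
      by (intro tendsto_intros l fg)
    then have "(\<lambda>i. l2_inner M (h (r i)) (\<lambda>x. f x + c * g x)) \<longlonglongrightarrow> l f + c * l g"
      using fg by (simp add: l2_inner_add_right[OF h] square_integrable_cmult l2_inner_cmult_right)
    moreover have "(\<lambda>i. l2_inner M (h (r i)) (\<lambda>x. f x + c * g x)) \<longlonglongrightarrow> l (\<lambda>x. f x + c * g x)"
      by (intro l square_integrable_add square_integrable_cmult fg)
    ultimately show "l (\<lambda>x. f x + c * g x) = l f + c * l g" by (metis LIMSEQ_unique)
  next
    fix f assume f: "f \<in> ?H"
    show "\<bar>l f\<bar> \<le> B * l2_norm M f"
      by (rule LIMSEQ_le_const2[OF tendsto_rabs[OF l[OF f]]]) (use hb[OF f] in blast)
  qed blast
  have "l2_weak_limit M (\<lambda>i. h (r i)) w"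
    unfolding l2_weak_limit_def using l w(2) by metis
  with r w(1) show thesis by (rule that)
qed

text \<open>Equicontinuity reduces the compact index set to a finite net, where weak convergence is
  uniform; between net points the error is bounded by the oscillation of \<open>\<psi>\<close> times
  the bounded norms of \<open>h i - w\<close>.\<close>

lemma l2_weak_limit_uniform:
  fixes \<psi> :: "'b::metric_space \<Rightarrow> 'a \<Rightarrow> real"
  assumes C: "compact C" and \<psi>: "\<And>p. p \<in> C \<Longrightarrow> \<psi> p \<in> square_integrable M"
    and equi: "\<And>e. e > 0 \<Longrightarrow> \<exists>d>0. \<forall>p\<in>C. \<forall>q\<in>C. dist p q < d \<longrightarrow> l2_norm M (\<lambda>x. \<psi> p x - \<psi> q x) < e"
    and h: "\<And>i. h i \<in> square_integrable M" and B: "\<And>i. l2_norm M (h i) \<le> B"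
    and w: "w \<in> square_integrable M" and lim: "l2_weak_limit M h w"
    and e: "e > 0"
  shows "\<forall>\<^sub>F i in sequentially. \<forall>p\<in>C. \<bar>l2_inner M (\<psi> p) (\<lambda>x. h i x - w x)\<bar> < e"
proof -
  define B' where "B' = B + l2_norm M w + 1"
  have "0 \<le> B" using l2_norm_nonneg[of M "h 0"] B[of 0] by linarith
  then have B': "B' > 0" using l2_norm_nonneg[of M w] by (simp add: B'_def)
  have hw: "(\<lambda>x. h i x - w x) \<in> square_integrable M" for i by (intro square_integrable_diff h w)
  have hwB: "l2_norm M (\<lambda>x. h i x - w x) \<le> B'" for i
    using l2_norm_triangle[OF h[of i] square_integrable_cmult[OF w, of "-1"]] B[of i]
      l2_norm_cmult[of M "-1" w] by (simp add: B'_def)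
  obtain d where d: "d > 0" and dd: "\<And>p q. p \<in> C \<Longrightarrow> q \<in> C \<Longrightarrow> dist p q < d \<Longrightarrow>
      l2_norm M (\<lambda>x. \<psi> p x - \<psi> q x) < e / (2 * B')"
    using equi[of "e / (2 * B')"] e B' by fastforce
  obtain F where F: "finite F" "F \<subseteq> C" "C \<subseteq> (\<Union>q\<in>F. ball q d)"
    using compactE_image[OF C, of C "\<lambda>q. ball q d"] d by (metis UN_I centre_in_ball open_ball subsetI)
  have "\<forall>\<^sub>F i in sequentially. \<bar>l2_inner M (\<psi> q) (\<lambda>x. h i x - w x)\<bar> < e / 2" if "q \<in> F" for q
  proof -
    have q: "\<psi> q \<in> square_integrable M" using \<psi> F that by auto
    have "(\<lambda>i. l2_inner M (h i) (\<psi> q)) \<longlonglongrightarrow> l2_inner M w (\<psi> q)"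
      using lim q by (auto simp: l2_weak_limit_def)
    then have "\<forall>\<^sub>F i in sequentially. dist (l2_inner M (h i) (\<psi> q)) (l2_inner M w (\<psi> q)) < e / 2"
      using e by (intro tendstoD) auto
    then show ?thesis
      by eventually_elim
        (simp add: dist_real_def l2_inner_commute[of M "\<psi> q"] l2_inner_diff_left[OF q h w])
  qed
  then have "\<forall>\<^sub>F i in sequentially. \<forall>q\<in>F. \<bar>l2_inner M (\<psi> q) (\<lambda>x. h i x - w x)\<bar> < e / 2"
    using F(1) by (simp add: eventually_ball_finite)
  then show ?thesis
  proof eventually_elim
    case (elim i)
    show ?case
    proof
      fix p assume p: "p \<in> C"
      then obtain q where q: "q \<in> F" "dist p q < d" using F(3) by (auto simp: dist_commute)
      have qC: "q \<in> C" using q F by auto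
      have "\<bar>l2_inner M (\<lambda>x. \<psi> p x - \<psi> q x) (\<lambda>x. h i x - w x)\<bar>
          \<le> l2_norm M (\<lambda>x. \<psi> p x - \<psi> q x) * l2_norm M (\<lambda>x. h i x - w x)"
        using p qC by (intro abs_l2_inner_le square_integrable_diff \<psi> h w)
      also have "\<dots> \<le> e / (2 * B') * B'"
        using dd[OF p qC q(2)] hwB[of i] e B' by (intro mult_mono) (auto simp: l2_norm_nonneg)
      also have "\<dots> = e / 2" using B' by simp
      finally show "\<bar>l2_inner M (\<psi> p) (\<lambda>x. h i x - w x)\<bar> < e"
        using bspec[OF elim q(1)] l2_inner_diff_left[OF hw[of i] \<psi>[OF p] \<psi>[OF qC]] by argo
    qed
  qed
qed

section \<open>Space-time integrals and mesh functions\<close>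

lemma restrict_lborel_measurable_iff:
  fixes S :: "'b::euclidean_space set"
  assumes "S \<in> sets borel"
  shows "f \<in> borel_measurable (restrict_space lborel S) \<longleftrightarrow> set_borel_measurable lborel S (f :: 'b \<Rightarrow> real)"
  using assms by (simp add: borel_measurable_restrict_space_iff set_borel_measurable_def)

lemma L2_eq_square_integrable:
  fixes S :: "'b::euclidean_space set"
  assumes "S \<in> sets borel"
  shows "L2 S = square_integrable (restrict_space lborel S)"
  using assms
  by (auto simp: L2_def square_integrable_def restrict_lborel_measurable_iff integrable_restrict_space
      set_integrable_def)

lemma L2_norm_on_eq_l2_norm:
  fixes S :: "'b::euclidean_space set"
  assumes "S \<in> sets borel"
  shows "L2_norm_on S h = l2_norm (restrict_space lborel S) h"
  using assms by (simp add: L2_norm_on_def l2_norm_def integral_restrict_space set_lebesgue_integral_def)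

lemma cyl_borel: "open D \<Longrightarrow> cyl T D \<in> sets borel"
  unfolding cyl_def by (intro borel_open open_Times) auto

lemma compact_ccyl: "bounded D \<Longrightarrow> compact (ccyl T D)"
  unfolding ccyl_def by (intro compact_Times) (auto simp: compact_closure)

lemma nn_integral_iterated_cyl:
  fixes f :: "real \<times> 'a::euclidean_space \<Rightarrow> ennreal"
  assumes "open D" "t \<le> T"
    and meas: "(\<lambda>p. if fst p < t then f p else 0) \<in> borel_measurable (restrict_space lborel (cyl T D))"
  shows "(\<integral>\<^sup>+s\<in>{0<..<t}. (\<integral>\<^sup>+z\<in>D. f (s, z) \<partial>lborel) \<partial>lborel)
    = (\<integral>\<^sup>+p. (if fst p < t then f p else 0) \<partial>restrict_space lborel (cyl T D))"
proof -
  let ?f = "\<lambda>p. (if fst p < t then f p else 0) * indicator (cyl T D) p"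
  have cyl: "cyl T D \<in> sets borel" using assms(1) by (rule cyl_borel)
  have m: "?f \<in> borel_measurable (lborel \<Otimes>\<^sub>M lborel)"
    using meas cyl by (simp add: borel_measurable_restrict_space_iff_ennreal lborel_prod)
  have "(\<integral>\<^sup>+p. (if fst p < t then f p else 0) \<partial>restrict_space lborel (cyl T D)) = (\<integral>\<^sup>+p. ?f p \<partial>lborel)"
    using cyl by (subst nn_integral_restrict_space) auto
  also have "\<dots> = (\<integral>\<^sup>+s. \<integral>\<^sup>+z. ?f (s, z) \<partial>lborel \<partial>lborel)"
    using lborel.nn_integral_fst[OF m] by (simp add: lborel_prod)
  also have "\<dots> = (\<integral>\<^sup>+s\<in>{0<..<t}. (\<integral>\<^sup>+z\<in>D. f (s, z) \<partial>lborel) \<partial>lborel)"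
  proof (rule nn_integral_cong)
    fix s
    show "(\<integral>\<^sup>+z. ?f (s, z) \<partial>lborel) = (\<integral>\<^sup>+z\<in>D. f (s, z) \<partial>lborel) * indicator {0<..<t} s"
    proof (cases "s \<in> {0<..<t}")
      case True
      then have "(\<lambda>z. ?f (s, z)) = (\<lambda>z. f (s, z) * indicator D z)"
        using assms(2) by (auto simp: cyl_def indicator_def)
      then show ?thesis using True by simp
    next
      case False
      then have eq: "(\<lambda>z. ?f (s, z)) = (\<lambda>z. 0)" by (auto simp: cyl_def indicator_def)
      show ?thesis unfolding eq using False by simp
    qed
  qed
  finally show ?thesis by simp
qed

lemma set_integrable_cyl_iff:
  fixes f :: "real \<times> 'a::euclidean_space \<Rightarrow> real"
  assumes "open D" "t \<le> T"
  shows "set_integrable lborel ({0<..<t} \<times> D) f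
    \<longleftrightarrow> integrable (restrict_space lborel (cyl T D)) (\<lambda>p. if fst p < t then f p else 0)"
proof -
  have "indicator ({0<..<t} \<times> D) p *\<^sub>R f p = indicator (cyl T D) p *\<^sub>R (if fst p < t then f p else 0)" for p
    using assms(2) by (cases p) (auto simp: cyl_def indicator_def)
  then show ?thesis
    using cyl_borel[OF assms(1)] by (simp add: set_integrable_def integrable_restrict_space)
qed

lemma set_integral_iterated_cyl:
  fixes f :: "real \<times> 'a::euclidean_space \<Rightarrow> real"
  assumes "open D" "t \<le> T" and int: "set_integrable lborel ({0<..<t} \<times> D) f"
  shows "(LINT s:{0<..<t}|lborel. LINT z:D|lborel. f (s, z))
    = (\<integral>p. (if fst p < t then f p else 0) \<partial>restrict_space lborel (cyl T D))"
proof -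
  let ?f = "\<lambda>p. indicator ({0<..<t} \<times> D) p *\<^sub>R f p"
  have m: "integrable (lborel \<Otimes>\<^sub>M lborel) ?f"
    using int by (simp add: set_integrable_def lborel_prod)
  have "indicator ({0<..<t} \<times> D) p *\<^sub>R f p = indicator (cyl T D) p *\<^sub>R (if fst p < t then f p else 0)" for p
    using assms(2) by (cases p) (auto simp: cyl_def indicator_def)
  then have "(\<integral>p. (if fst p < t then f p else 0) \<partial>restrict_space lborel (cyl T D)) = (\<integral>p. ?f p \<partial>lborel)"
    using cyl_borel[OF assms(1)] by (simp add: integral_restrict_space)
  also have "\<dots> = (\<integral>s. \<integral>z. ?f (s, z) \<partial>lborel \<partial>lborel)"
    using lborel_pair.integral_fst'[OF m] by (simp add: lborel_prod)
  also have "\<dots> = (LINT s:{0<..<t}|lborel. LINT z:D|lborel. f (s, z))"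
    unfolding set_lebesgue_integral_def
  proof (rule Bochner_Integration.integral_cong[OF refl])
    fix s
    have "(\<lambda>z. ?f (s, z)) = (\<lambda>z. indicator {0<..<t} s *\<^sub>R (indicator D z *\<^sub>R f (s, z)))"
      by (auto simp: indicator_def)
    then show "(\<integral>z. ?f (s, z) \<partial>lborel)
      = indicator {0<..<t} s *\<^sub>R (\<integral>z. indicator D z *\<^sub>R f (s, z) \<partial>lborel)"
      by simp
  qed
  finally show ?thesis by simp
qed

section \<open>The time grid and mesh functions\<close>

lemma grid_floor_bounds:
  assumes "0 \<le> s" "s < T" "m > 0"
  shows "0 \<le> grid_floor T m s" "grid_floor T m s \<le> s" "s < grid_floor T m s + T / real m"
proof -
  have \<tau>: "T / real m > 0" using assms by simp
  define k where "k = \<lfloor>s / (T / real m)\<rfloor>"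
  have k0: "k \<ge> 0" using assms \<tau> by (simp add: k_def)
  have k: "of_int k \<le> s / (T / real m)" "s / (T / real m) < of_int k + 1"
    unfolding k_def by linarith+
  have eq: "grid_floor T m s = of_int k * (T / real m)"
    unfolding grid_floor_def grid_time_def k_def[symmetric] using assms k0 by simp
  show "0 \<le> grid_floor T m s" unfolding eq using k0 \<tau> by (intro mult_nonneg_nonneg) auto
  show "grid_floor T m s \<le> s" using k(1) \<tau> unfolding eq by (simp only: pos_le_divide_eq)
  have "s < (of_int k + 1) * (T / real m)" using k(2) \<tau> by (simp only: pos_divide_less_eq)
  then show "s < grid_floor T m s + T / real m" unfolding eq distrib_right by simp
qed

lemma grid_floor_measurable[measurable]: "grid_floor T m \<in> borel_measurable borel"
  unfolding grid_floor_def[abs_def] grid_time_def by measurable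

lemma grid_time_cell:
  assumes "0 < s" "s < T" "m > 0"
  shows "\<exists>!j. j < m \<and> s \<in> {grid_time T m j..<grid_time T m (Suc j)}"
proof -
  have \<tau>: "T / real m > 0" using assms by simp
  define q where "q = s / (T / real m)"
  have iff: "s \<in> {grid_time T m j..<grid_time T m (Suc j)} \<longleftrightarrow> real j \<le> q \<and> q < real j + 1" for j
    unfolding q_def pos_le_divide_eq[OF \<tau>] pos_divide_less_eq[OF \<tau>]
    by (auto simp: grid_time_def add.commute)
  have q: "0 \<le> q" "q < real m" using assms by (auto simp: q_def field_simps)
  show ?thesis unfolding iff
  proof (rule ex1I[of _ "nat \<lfloor>q\<rfloor>"])
    show "nat \<lfloor>q\<rfloor> < m \<and> real (nat \<lfloor>q\<rfloor>) \<le> q \<and> q < real (nat \<lfloor>q\<rfloor>) + 1"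
      using q by (auto; linarith)
    show "j = nat \<lfloor>q\<rfloor>" if "j < m \<and> real j \<le> q \<and> q < real j + 1" for j
      using that by linarith
  qed
qed

text \<open>The cells partition the cylinder, so one summand survives at each point. This places
  mesh functions in the linear span of cell indicators, the family that makes the space of controls
  separable.\<close>

lemma mesh_functions_sum:
  assumes h: "h \<in> mesh_functions T D m \<T>" and mesh: "finite_mesh D \<T>" and "m > 0"
  obtains c where "\<And>p. p \<in> cyl T D \<Longrightarrow>
    h p = (\<Sum>(j, K)\<in>{..<m} \<times> \<T>. c j K * indicator ({grid_time T m j..<grid_time T m (Suc j)} \<times> K) p)"
proof -
  let ?C = "\<lambda>j K. {grid_time T m j..<grid_time T m (Suc j)} \<times> K"
  have "\<exists>c. \<forall>p\<in>?C j K. h p = c" if "j < m" "K \<in> \<T>" for j K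
    using h that by (auto simp: mesh_functions_def constant_on_def)
  then obtain c where c: "\<And>j K p. j < m \<Longrightarrow> K \<in> \<T> \<Longrightarrow> p \<in> ?C j K \<Longrightarrow> h p = c j K"
    by metis
  have fin: "finite ({..<m} \<times> \<T>)" using mesh by (simp add: finite_mesh_def)
  have part: "partition_on D \<T>" using mesh by (simp add: finite_mesh_def)
  have "h p = (\<Sum>(j, K)\<in>{..<m} \<times> \<T>. c j K * indicator (?C j K) p)" if p: "p \<in> cyl T D" for p
  proof -
    obtain s z where sz: "p = (s, z)" "0 < s" "s < T" "z \<in> D" using p by (auto simp: cyl_def)
    obtain j where j: "j < m" "s \<in> {grid_time T m j..<grid_time T m (Suc j)}"
      and ju: "\<And>j'. j' < m \<Longrightarrow> s \<in> {grid_time T m j'..<grid_time T m (Suc j')} \<Longrightarrow> j' = j"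
      using grid_time_cell[OF sz(2,3) \<open>m > 0\<close>] by blast
    obtain K where K: "K \<in> \<T>" "z \<in> K" using partition_onD1[OF part] sz by auto
    have Ku: "K' = K" if "K' \<in> \<T>" "z \<in> K'" for K'
      using partition_onD2[OF part] that K by (auto simp: disjoint_def)
    have "(\<Sum>(j, K)\<in>{..<m} \<times> \<T>. c j K * indicator (?C j K) p)
        = (\<Sum>q\<in>{..<m} \<times> \<T>. if q = (j, K) then c j K else 0)"
    proof (rule sum.cong[OF refl], clarify)
      fix j' K' assume "j' < m" "K' \<in> \<T>"
      then have "p \<in> ?C j' K' \<longleftrightarrow> (j', K') = (j, K)"
        using ju[of j'] Ku[of K'] j K sz(1) by blast
      then show "c j' K' * indicator (?C j' K') p = (if (j', K') = (j, K) then c j K else 0)"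
        by (auto simp: indicator_def)
    qed
    also have "\<dots> = c j K" using j K fin by (simp add: sum.delta')
    also have "\<dots> = h p" using c[of j K p] j K sz by auto
    finally show ?thesis by simp
  qed
  then show thesis by (rule that)
qed

lemma mesh_functions_cell_indicator_square_integrable:
  assumes "open D" "bounded D" "finite_mesh D \<T>" "K \<in> \<T>"
  shows "(indicator ({a..<b} \<times> K) :: real \<times> 'a::euclidean_space \<Rightarrow> real)
    \<in> square_integrable (restrict_space lborel (cyl T D))"
proof -
  have "emeasure lborel (cyl T D) < \<infinity>"
    unfolding cyl_def by (intro emeasure_bounded_finite bounded_Times) (use assms in auto)
  then interpret finite_measure "restrict_space lborel (cyl T D)"
    using cyl_borel[OF assms(1)] by (intro finite_measureI) (simp add: emeasure_restrict_space)
  have "K \<in> sets borel" using assms by (auto simp: finite_mesh_def)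
  then have "{a..<b} \<times> K \<in> sets (borel \<Otimes>\<^sub>M borel)" by (intro pair_measureI) auto
  then have "{a..<b} \<times> K \<in> sets borel" unfolding borel_prod .
  then have [measurable]: "(indicator ({a..<b} \<times> K) :: _ \<Rightarrow> real) \<in> borel_measurable (restrict_space lborel (cyl T D))"
    by (intro measurable_restrict_space1) auto
  show ?thesis
    by (rule square_integrable_bound[OF square_integrable_const[of 1]]) auto
qed

text \<open>An element of \<open>Cspace\<close> is \<open>undefined\<close> off the closed cylinder,
  so only its truncation there is claimed to be Borel.\<close>

lemma Cspace_measurable:
  assumes "open D" "bounded D" "u \<in> Cspace (ccyl T D)"
  shows "(\<lambda>p. indicator (ccyl T D) p * u p) \<in> borel_measurable borel"
proof -
  have "closed (ccyl T D)" using compact_ccyl[OF assms(2)] by (rule compact_imp_closed)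
  then show ?thesis
    using borel_measurable_continuous_on_indicator[of "ccyl T D" u] assms(3)
    by (simp add: Cspace_def borel_closed)
qed

lemma bounded_Cspace:
  assumes "bounded D" "u \<in> Cspace (ccyl T D)"
  obtains R where "R > 0" "\<And>p. p \<in> ccyl T D \<Longrightarrow> \<bar>u p\<bar> \<le> R"
proof -
  have "bounded (u ` ccyl T D)"
    using assms compact_ccyl[OF assms(1), of T]
    by (intro compact_imp_bounded compact_continuous_image) (auto simp: Cspace_def)
  then show thesis using that by (auto simp: bounded_pos)
qed

lemma bounded_image_continuous:
  fixes f :: "real \<Rightarrow> real"
  assumes "continuous_on UNIV f"
  obtains B where "B > 0" "\<And>r. \<bar>r\<bar> \<le> R \<Longrightarrow> \<bar>f r\<bar> \<le> (B::real)"
proof -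
  have "bounded (f ` {-R..R})"
    by (intro compact_imp_bounded compact_continuous_image continuous_on_subset[OF assms]) auto
  then obtain B where "B > 0" "\<forall>y\<in>f ` {-R..R}. norm y \<le> B" unfolding bounded_pos by blast
  then show thesis by (intro that[of B]) (auto simp: abs_le_iff)
qed

lemma exp_double_power2: "exp (2 * \<beta> * t) = (exp (\<beta> * t))\<^sup>2" for \<beta> t :: real
  by (simp add: power2_eq_square exp_add[symmetric])

section \<open>Kernels of the skeleton equations\<close>

text \<open>\<open>L\<close> is one Lipschitz constant for both coefficients, obtained from the
  bounds on their derivatives. The assumptions about steering the endpoint and about the operators
  \<open>Q n\<close> join in a second locale.\<close>

locale skeleton_scheme =
  fixes T :: real and D :: "'a::euclidean_space set"
    and G :: "real \<Rightarrow> 'a \<Rightarrow> 'a \<Rightarrow> real" and g :: "real \<times> 'a \<Rightarrow> real"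
    and b \<sigma> :: "real \<Rightarrow> real" and L :: real
    and m :: "nat \<Rightarrow> nat" and \<T> :: "nat \<Rightarrow> 'a set set" and \<kappa> :: "nat \<Rightarrow> 'a \<Rightarrow> 'a"
    and Gn :: "nat \<Rightarrow> real \<Rightarrow> real \<Rightarrow> 'a \<Rightarrow> 'a \<Rightarrow> real" and gn :: "nat \<Rightarrow> real \<times> 'a \<Rightarrow> real"
  assumes T_pos: "T > 0"
    and D_open: "open D" and D_bounded: "bounded D" and D_nonempty: "D \<noteq> {}"
    and G_measurable: "set_borel_measurable borel ({0<..T} \<times> closure D \<times> D) (\<lambda>(t, x, z). G t x z)"
    and g_Cspace: "g \<in> Cspace (ccyl T D)"
    and skeleton_ex1: "\<And>h. h \<in> L2 (cyl T D) \<Longrightarrow> \<exists>!u. skeleton_solution T D G b \<sigma> g h u"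
    and m_pos: "\<And>n. n \<ge> 1 \<Longrightarrow> m n > 0"
    and mesh: "\<And>n. n \<ge> 1 \<Longrightarrow> finite_mesh D (\<T> n)"
    and \<kappa>_range: "\<And>n z. n \<ge> 1 \<Longrightarrow> z \<in> D \<Longrightarrow> \<kappa> n z \<in> closure D"
    and \<kappa>_constant: "\<And>n K. n \<ge> 1 \<Longrightarrow> K \<in> \<T> n \<Longrightarrow> \<kappa> n constant_on K"
    and \<kappa>_lim: "(\<lambda>n. SUP z\<in>D. norm (z - \<kappa> n z)) \<longlonglongrightarrow> 0"
    and Gn_measurable: "\<And>n. n \<ge> 1 \<Longrightarrow> set_borel_measurable borel
           {(t, r, x, z). 0 \<le> r \<and> r < t \<and> t \<le> T \<and> x \<in> closure D \<and> z \<in> D}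
           (\<lambda>(t, r, x, z). Gn n t r x z)"
    and gn_Cspace: "\<And>n. n \<ge> 1 \<Longrightarrow> gn n \<in> Cspace (ccyl T D)"
    and discrete_ex1: "\<And>n h. n \<ge> 1 \<Longrightarrow> h \<in> mesh_functions T D (m n) (\<T> n) \<Longrightarrow>
           \<exists>!u. discrete_skeleton_solution T D (m n) (\<kappa> n) (Gn n) b \<sigma> (gn n) h u"
    and m_lim: "filterlim m at_top sequentially"
    and b_lipschitz: "\<And>r r'. \<bar>b r - b r'\<bar> \<le> L * \<bar>r - r'\<bar>"
    and \<sigma>_lipschitz: "\<And>r r'. \<bar>\<sigma> r - \<sigma> r'\<bar> \<le> L * \<bar>r - r'\<bar>"
    and gn_lim: "(\<lambda>n. sup_norm (ccyl T D) (\<lambda>p. gn n p - g p)) \<longlonglongrightarrow> 0"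
    and Gn_lim: "(\<lambda>n. SUP (t, x)\<in>ccyl T D.
                \<integral>\<^sup>+s\<in>{0<..<t}. (\<integral>\<^sup>+z\<in>D.
                  ennreal (\<bar>Gn n t (grid_floor T (m n) s) x z - G (t - s) x z\<bar>\<^sup>2) \<partial>lborel) \<partial>lborel)
             \<longlonglongrightarrow> 0"
    and Gn_bound: "\<exists>\<rho> :: real \<Rightarrow> real. antimono_on {0<..T} \<rho> \<and> set_integrable lborel {0<..T} \<rho> \<and>
               (\<forall>r\<in>{0<..T}. 0 \<le> \<rho> r) \<and>
               (\<forall>n\<ge>1. \<forall>t r x. 0 \<le> r \<and> r < t \<and> t \<le> T \<and> x \<in> closure D \<longrightarrow>
                  (\<integral>\<^sup>+z\<in>D. ennreal (\<bar>Gn n t r x z\<bar>\<^sup>2) \<partial>lborel) \<le> ennreal (\<rho> (t - r)))"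
    and G_equicontinuous: "((\<lambda>\<delta>. SUP (t, t', x, x') \<in> {(t, t', x, x'). 0 \<le> t' \<and> t' \<le> t \<and> t \<le> T \<and>
                        x \<in> closure D \<and> x' \<in> closure D \<and> \<bar>t - t'\<bar> + norm (x - x') \<le> \<delta>}.
                 \<integral>\<^sup>+s\<in>{0<..<t'}. (\<integral>\<^sup>+z\<in>D.
                   ennreal (\<bar>G (t - s) x z - G (t' - s) x' z\<bar>\<^sup>2) \<partial>lborel) \<partial>lborel)
              \<longlongrightarrow> 0) (at_right 0)"
begin

abbreviation S :: "(real \<times> 'a) set" where "S \<equiv> cyl T D"
abbreviation C :: "(real \<times> 'a) set" where "C \<equiv> ccyl T D"
abbreviation M :: "(real \<times> 'a) measure" where "M \<equiv> restrict_space lborel (cyl T D)"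
abbreviation X :: "nat \<Rightarrow> (real \<times> 'a \<Rightarrow> real) set" where "X n \<equiv> mesh_functions T D (m n) (\<T> n)"
abbreviation \<Upsilon> :: "(real \<times> 'a \<Rightarrow> real) \<Rightarrow> real \<times> 'a \<Rightarrow> real" where "\<Upsilon> \<equiv> skeleton_map T D G b \<sigma> g"
abbreviation \<Upsilon>n :: "nat \<Rightarrow> (real \<times> 'a \<Rightarrow> real) \<Rightarrow> real \<times> 'a \<Rightarrow> real" where
  "\<Upsilon>n n \<equiv> discrete_skeleton_map T D (m n) (\<kappa> n) (Gn n) b \<sigma> (gn n)"

text \<open>The first argument is the evaluation point (t,x), the second the integration variable
  (s,z). Extension by zero to s >= t makes both equations read u = g + inner product of the kernel
  with \<open>F\<close> over the whole cylinder; \<open>P n\<close> is the map onto grid points at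
  which the discrete equation evaluates its solution.\<close>

definition K :: "real \<times> 'a \<Rightarrow> real \<times> 'a \<Rightarrow> real" where
  "K q p = (if fst p < fst q then G (fst q - fst p) (snd q) (snd p) else 0)"

definition Kn :: "nat \<Rightarrow> real \<times> 'a \<Rightarrow> real \<times> 'a \<Rightarrow> real" where
  "Kn n q p = (if fst p < fst q then Gn n (fst q) (grid_floor T (m n) (fst p)) (snd q) (snd p) else 0)"

definition F :: "(real \<times> 'a \<Rightarrow> real) \<Rightarrow> (real \<times> 'a \<Rightarrow> real) \<Rightarrow> real \<times> 'a \<Rightarrow> real" where
  "F v h p = b (v p) + \<sigma> (v p) * h p"

definition P :: "nat \<Rightarrow> real \<times> 'a \<Rightarrow> real \<times> 'a" where
  "P n p = (grid_floor T (m n) (fst p), \<kappa> n (snd p))"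

section \<open>The cylinder as a finite measure space\<close>

lemma S_borel: "S \<in> sets borel"
  using D_open by (rule cyl_borel)

lemma space_M: "space M = S"
  using S_borel by (simp add: space_restrict_space)

lemma L2_eq: "L2 S = square_integrable M"
  using S_borel by (rule L2_eq_square_integrable)

lemma L2_norm_eq: "L2_norm_on S h = l2_norm M h"
  using S_borel by (rule L2_norm_on_eq_l2_norm)

lemma X_square_integrable: "h \<in> X n \<Longrightarrow> h \<in> square_integrable M"
  by (simp add: mesh_functions_def L2_eq)

sublocale M: finite_measure M
proof
  have "emeasure lborel S < \<infinity>"
    unfolding cyl_def by (intro emeasure_bounded_finite bounded_Times) (use D_bounded in auto)
  then show "emeasure M (space M) \<noteq> \<infinity>"
    using S_borel by (simp add: emeasure_restrict_space)
qed

lemma L_nonneg: "0 \<le> L"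
  using b_lipschitz[of 1 0] by simp

lemma S_sub: "p \<in> S \<Longrightarrow> p \<in> C"
  using closure_subset by (auto simp: cyl_def ccyl_def)

lemma C_compact: "compact C"
  using D_bounded by (rule compact_ccyl)

lemma C_nonempty: "C \<noteq> {}"
  using T_pos D_nonempty by (auto simp: ccyl_def)

lemma P_in_C: "n \<ge> 1 \<Longrightarrow> p \<in> S \<Longrightarrow> P n p \<in> C"
  using grid_floor_bounds[of "fst p" T "m n"] m_pos[of n] \<kappa>_range[of n "snd p"]
  by (auto simp: P_def cyl_def ccyl_def)

section \<open>Measurability and square integrability of the integrands\<close>

lemma b_cont: "continuous_on UNIV b" and \<sigma>_cont: "continuous_on UNIV \<sigma>"
proof -
  have "continuous_on UNIV f" if lip: "\<And>r r'. \<bar>f r - f r'\<bar> \<le> L * \<bar>r - r'\<bar>" for f :: "real \<Rightarrow> real"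
  proof (rule lipschitz_on_continuous_on)
    show "L-lipschitz_on UNIV f"
      using lip L_nonneg by (auto simp: lipschitz_on_def dist_real_def)
  qed
  then show "continuous_on UNIV b" "continuous_on UNIV \<sigma>" using b_lipschitz \<sigma>_lipschitz by auto
qed

lemma b_measurable[measurable]: "b \<in> borel_measurable borel"
  and \<sigma>_measurable[measurable]: "\<sigma> \<in> borel_measurable borel"
  using b_cont \<sigma>_cont by (auto intro: borel_measurable_continuous_onI)

lemma fst_measurable_M[measurable]: "fst \<in> borel_measurable M"
  by (intro measurable_restrict_space1) (auto simp: borel_measurable_continuous_onI continuous_on_fst)

lemma snd_measurable_M[measurable]: "snd \<in> borel_measurable M"
  by (intro measurable_restrict_space1) (auto simp: borel_measurable_continuous_onI continuous_on_snd)

lemma K_measurable: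
  assumes q: "q \<in> C"
  shows "K q \<in> borel_measurable M"
proof -
  define G' where "G' = (\<lambda>(t, x, z). indicator ({0<..T} \<times> closure D \<times> D) (t, x, z) * G t x z)"
  have [measurable]: "G' \<in> borel_measurable borel"
    using G_measurable by (simp add: G'_def set_borel_measurable_def case_prod_beta')
  have "K q \<in> borel_measurable M
      \<longleftrightarrow> (\<lambda>p. if fst p < fst q then G' (fst q - fst p, snd q, snd p) else 0) \<in> borel_measurable M"
  proof (rule measurable_cong)
    fix p assume "p \<in> space M"
    then have "p \<in> S" by (simp add: space_M)
    then have "0 < fst p" "fst p < T" "snd p \<in> D" by (auto simp: cyl_def)
    then show "K q p = (if fst p < fst q then G' (fst q - fst p, snd q, snd p) else 0)"
      using q by (auto simp: K_def G'_def ccyl_def indicator_def)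
  qed
  then show ?thesis by simp
qed

lemma Kn_measurable:
  assumes n: "n \<ge> 1" and q: "q \<in> C"
  shows "Kn n q \<in> borel_measurable M"
proof -
  let ?A = "{(t, r, x, z). 0 \<le> r \<and> r < t \<and> t \<le> T \<and> x \<in> closure D \<and> z \<in> D}"
  define G' where "G' = (\<lambda>(t, r, x, z). indicator ?A (t, r, x, z) * Gn n t r x z)"
  have [measurable]: "G' \<in> borel_measurable borel"
    using Gn_measurable[OF n] by (simp add: G'_def set_borel_measurable_def case_prod_beta')
  have "Kn n q \<in> borel_measurable M
      \<longleftrightarrow> (\<lambda>p. if fst p < fst q then G' (fst q, grid_floor T (m n) (fst p), snd q, snd p) else 0)
        \<in> borel_measurable M"
  proof (rule measurable_cong)
    fix p assume "p \<in> space M"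
    then have "p \<in> S" by (simp add: space_M)
    then have "0 < fst p" "fst p < T" "snd p \<in> D" by (auto simp: cyl_def)
    then show "Kn n q p = (if fst p < fst q then G' (fst q, grid_floor T (m n) (fst p), snd q, snd p) else 0)"
      using q grid_floor_bounds[of "fst p" T "m n"] m_pos[OF n] by (auto simp: Kn_def G'_def ccyl_def)
  qed
  then show ?thesis by simp
qed

text \<open>Being constant on finitely many Borel cells, the map is a simple function; outside
  \<open>D\<close> its values are unknown, hence the truncation.\<close>

lemma \<kappa>_measurable:
  assumes n: "n \<ge> 1"
  shows "(\<lambda>z. indicator D z *\<^sub>R \<kappa> n z) \<in> borel_measurable borel"
proof -
  have fin: "finite (\<T> n)" and part: "partition_on D (\<T> n)" and bor: "\<T> n \<subseteq> sets borel"
    using mesh[OF n] by (auto simp: finite_mesh_def)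
  have "\<exists>c. \<forall>z\<in>A. \<kappa> n z = c" if "A \<in> \<T> n" for A
    using \<kappa>_constant[OF n that] by (auto simp: constant_on_def)
  then obtain c where c: "\<And>A z. A \<in> \<T> n \<Longrightarrow> z \<in> A \<Longrightarrow> \<kappa> n z = c A" by metis
  have "indicator D z *\<^sub>R \<kappa> n z = (\<Sum>A\<in>\<T> n. indicator A z *\<^sub>R c A)" for z
  proof (cases "z \<in> D")
    case True
    then obtain A where A: "A \<in> \<T> n" "z \<in> A" using partition_onD1[OF part] by auto
    have "A' = A" if "A' \<in> \<T> n" "z \<in> A'" for A'
      using partition_onD2[OF part] that A by (auto simp: disjoint_def)
    then have "(\<Sum>A'\<in>\<T> n. indicator A' z *\<^sub>R c A') = (\<Sum>A'\<in>\<T> n. if A' = A then c A else 0)"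
      using A by (intro sum.cong refl) (metis indicator_simps scaleR_one scaleR_zero_left)
    then show ?thesis using True A fin c[OF A] by simp
  next
    case False
    then have "indicator A z = (0::real)" if "A \<in> \<T> n" for A
      using partition_onD1[OF part] that by (auto simp: indicator_def)
    then show ?thesis using False by simp
  qed
  then have eq: "(\<lambda>z. indicator D z *\<^sub>R \<kappa> n z) = (\<lambda>z. \<Sum>A\<in>\<T> n. indicator A z *\<^sub>R c A)" by auto
  show ?thesis unfolding eq
    using bor by (intro borel_measurable_sum borel_measurable_scaleR borel_measurable_indicator) auto
qed

lemma comp_P_measurable:
  assumes n: "n \<ge> 1" and u: "u \<in> Cspace C"
  shows "(\<lambda>p. u (P n p)) \<in> borel_measurable M"
proof -
  note [measurable] = Cspace_measurable[OF D_open D_bounded u] \<kappa>_measurable[OF n]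
  define v where "v = (\<lambda>p. indicator C p * u p)"
  define k where "k = (\<lambda>z. indicator D z *\<^sub>R \<kappa> n z)"
  have [measurable]: "v \<in> borel_measurable borel" "k \<in> borel_measurable borel"
    unfolding v_def k_def by measurable
  have "(\<lambda>p. u (P n p)) \<in> borel_measurable M
      \<longleftrightarrow> (\<lambda>p. v (grid_floor T (m n) (fst p), k (snd p))) \<in> borel_measurable M"
  proof (rule measurable_cong)
    fix p assume "p \<in> space M"
    then have p: "p \<in> S" by (simp add: space_M)
    then have "snd p \<in> D" by (auto simp: cyl_def)
    then show "u (P n p) = v (grid_floor T (m n) (fst p), k (snd p))"
      using P_in_C[OF n p] by (simp add: v_def k_def P_def)
  qed
  then show ?thesis by simp
qed

lemma Cspace_measurable_M:
  assumes "u \<in> Cspace C"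
  shows "u \<in> borel_measurable M"
proof -
  have "u \<in> borel_measurable M \<longleftrightarrow> (\<lambda>p. indicator C p * u p) \<in> borel_measurable M"
    by (rule measurable_cong) (simp add: space_M S_sub)
  moreover have "(\<lambda>p. indicator C p * u p) \<in> borel_measurable M"
    using Cspace_measurable[OF D_open D_bounded assms] by (intro measurable_restrict_space1) simp
  ultimately show ?thesis by simp
qed

text \<open>A continuous \<open>f\<close> need not be bounded, but \<open>v\<close> takes values in
  a compact interval. This covers b, \<sigma> and later 1/\<sigma>.\<close>

lemma comp_square_integrable:
  fixes f :: "real \<Rightarrow> real"
  assumes "continuous_on UNIV f" "v \<in> borel_measurable M" "\<And>p. p \<in> S \<Longrightarrow> \<bar>v p\<bar> \<le> R" "h \<in> square_integrable M"
  shows "(\<lambda>p. f (v p) * h p) \<in> square_integrable M"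
proof -
  obtain B where B: "\<And>r. \<bar>r\<bar> \<le> R \<Longrightarrow> \<bar>f r\<bar> \<le> B"
    using bounded_image_continuous[OF assms(1)] by blast
  show ?thesis
  proof (rule square_integrable_bounded_mult[OF assms(4)])
    show "(\<lambda>p. f (v p)) \<in> borel_measurable M"
      using assms(2) borel_measurable_continuous_onI[OF assms(1)] by simp
    show "\<bar>f (v p)\<bar> \<le> B" if "p \<in> space M" for p
      using that B assms(3) by (simp add: space_M)
  qed
qed

lemma F_square_integrable:
  fixes R :: real
  assumes "v \<in> borel_measurable M" "\<And>p. p \<in> S \<Longrightarrow> \<bar>v p\<bar> \<le> R" "h \<in> square_integrable M"
  shows "F v h \<in> square_integrable M"
proof -
  have comp: "(\<lambda>p. f (v p) * k p) \<in> square_integrable M"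
    if "continuous_on UNIV f" "k \<in> square_integrable M" for f :: "real \<Rightarrow> real" and k
    using assms(2) by (intro comp_square_integrable[OF that(1) assms(1) _ that(2)])
  have "(\<lambda>p. b (v p) * 1 + \<sigma> (v p) * h p) \<in> square_integrable M"
    by (rule square_integrable_add[OF comp[OF b_cont M.square_integrable_const] comp[OF \<sigma>_cont assms(3)]])
  then show ?thesis by (simp add: F_def[abs_def])
qed

lemma F_Cspace:
  assumes "u \<in> Cspace C" "h \<in> square_integrable M"
  shows "F u h \<in> square_integrable M"
proof -
  obtain R where R: "\<And>p. p \<in> C \<Longrightarrow> \<bar>u p\<bar> \<le> R" using bounded_Cspace[OF D_bounded assms(1)] by blast
  show ?thesis
    by (rule F_square_integrable[OF Cspace_measurable_M[OF assms(1)] R[OF S_sub] assms(2)])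
qed

lemma F_P_Cspace:
  assumes "n \<ge> 1" "u \<in> Cspace C" "h \<in> square_integrable M"
  shows "F (\<lambda>p. u (P n p)) h \<in> square_integrable M"
proof -
  obtain R where R: "\<And>p. p \<in> C \<Longrightarrow> \<bar>u p\<bar> \<le> R" using bounded_Cspace[OF D_bounded assms(2)] by blast
  show ?thesis
    by (rule F_square_integrable[OF comp_P_measurable[OF assms(1,2)] R[OF P_in_C[OF assms(1)]] assms(3)])
qed

section \<open>Estimates of the kernels\<close>

lemma Gn_section_measurable:
  assumes "n \<ge> 1" "0 \<le> r" "r < t" "t \<le> T" "x \<in> closure D"
  shows "(\<lambda>z. indicator D z * Gn n t r x z) \<in> borel_measurable borel"
proof -
  let ?A = "{(t, r, x, z). 0 \<le> r \<and> r < t \<and> t \<le> T \<and> x \<in> closure D \<and> z \<in> D}"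
  define G' where "G' = (\<lambda>(t, r, x, z). indicator ?A (t, r, x, z) * Gn n t r x z)"
  have [measurable]: "G' \<in> borel_measurable borel"
    using Gn_measurable[OF assms(1)] by (simp add: G'_def set_borel_measurable_def case_prod_beta')
  have "(\<lambda>z. indicator D z * Gn n t r x z) = (\<lambda>z. G' (t, r, x, z))"
    using assms by (auto simp: G'_def indicator_def fun_eq_iff)
  then show ?thesis by simp
qed

text \<open>\<open>\<eta> n\<close> is the supremum in the convergence hypothesis. It stays in
  \<open>ennreal\<close>, since it may be infinite for some n.\<close>

lemma Kn_approx_K:
  obtains \<eta> :: "nat \<Rightarrow> ennreal" where "\<eta> \<longlonglongrightarrow> 0"
    and "\<And>n q. n \<ge> 1 \<Longrightarrow> q \<in> C \<Longrightarrow> (\<integral>\<^sup>+p. ennreal ((Kn n q p - K q p)\<^sup>2) \<partial>M) \<le> \<eta> n"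
proof -
  define I where "I n q = (\<integral>\<^sup>+s\<in>{0<..<fst q}. (\<integral>\<^sup>+z\<in>D.
      ennreal (\<bar>Gn n (fst q) (grid_floor T (m n) s) (snd q) z - G (fst q - s) (snd q) z\<bar>\<^sup>2)
      \<partial>lborel) \<partial>lborel)" for n q
  have "(\<lambda>n. SUP q\<in>C. I n q) \<longlonglongrightarrow> 0"
    using Gn_lim by (simp add: I_def case_prod_beta')
  moreover have "(\<integral>\<^sup>+p. ennreal ((Kn n q p - K q p)\<^sup>2) \<partial>M) \<le> (SUP q\<in>C. I n q)"
    if n: "n \<ge> 1" and q: "q \<in> C" for n q
  proof -
    let ?f = "\<lambda>p. ennreal (\<bar>Gn n (fst q) (grid_floor T (m n) (fst p)) (snd q) (snd p)
      - G (fst q - fst p) (snd q) (snd p)\<bar>\<^sup>2)"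
    have t: "fst q \<le> T" using q by (auto simp: ccyl_def)
    have eq: "(\<lambda>p. if fst p < fst q then ?f p else 0) = (\<lambda>p. ennreal ((Kn n q p - K q p)\<^sup>2))"
      by (auto simp: K_def Kn_def fun_eq_iff)
    have "(\<lambda>p. if fst p < fst q then ?f p else 0) \<in> borel_measurable M"
      unfolding eq using K_measurable[OF q] Kn_measurable[OF n q] by measurable
    from nn_integral_iterated_cyl[OF D_open t this]
    have "I n q = (\<integral>\<^sup>+p. ennreal ((Kn n q p - K q p)\<^sup>2) \<partial>M)"
      unfolding eq by (simp add: I_def)
    then show ?thesis using q by (metis SUP_upper)
  qed
  ultimately show thesis by (rule that)
qed

text \<open>\<open>\<theta>\<close> is the Laplace transform of the majorant \<open>\<rho>\<close>:
  finite at 0 by integrability and arbitrarily small for large \<beta>. The weight exp(\<beta> s)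
  against the majorant in t - s is a convolution, so exp(\<beta> t) factors out and the bound is
  uniform in n and in the evaluation point.\<close>

lemma Kn_weighted:
  obtains \<theta> :: "real \<Rightarrow> ennreal" where "\<theta> 0 < \<infinity>"
    and "\<And>e. e > 0 \<Longrightarrow> \<exists>\<beta>>0. \<theta> \<beta> \<le> ennreal e"
    and "\<And>n q \<beta>. n \<ge> 1 \<Longrightarrow> q \<in> C \<Longrightarrow> \<beta> \<ge> 0 \<Longrightarrow>
      (\<integral>\<^sup>+p. ennreal ((Kn n q p)\<^sup>2 * exp (\<beta> * fst p)) \<partial>M) \<le> ennreal (exp (\<beta> * fst q)) * \<theta> \<beta>"
proof -
  obtain \<rho> :: "real \<Rightarrow> real" where anti: "antimono_on {0<..T} \<rho>" and int: "set_integrable lborel {0<..T} \<rho>"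
    and pos: "\<And>r. r \<in> {0<..T} \<Longrightarrow> 0 \<le> \<rho> r"
    and bnd: "\<And>n t r x. n \<ge> 1 \<Longrightarrow> 0 \<le> r \<Longrightarrow> r < t \<Longrightarrow> t \<le> T \<Longrightarrow> x \<in> closure D \<Longrightarrow>
      (\<integral>\<^sup>+z\<in>D. ennreal (\<bar>Gn n t r x z\<bar>\<^sup>2) \<partial>lborel) \<le> ennreal (\<rho> (t - r))"
    using Gn_bound by blast
  \<comment> \<open>Extension by zero lets the substitution r = t - s below run over the whole
    line.\<close>
  define \<rho>' where "\<rho>' = (\<lambda>r. indicator {0<..T} r * \<rho> r)"
  have int': "integrable lborel \<rho>'"
    using int by (simp add: \<rho>'_def set_integrable_def)
  then have [measurable]: "\<rho>' \<in> borel_measurable borel"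
    using borel_measurable_integrable by fastforce
  have pos': "0 \<le> \<rho>' r" for r using pos by (simp add: \<rho>'_def indicator_def)
  define \<theta> where "\<theta> \<beta> = (\<integral>\<^sup>+r. ennreal (\<rho>' r * exp (- \<beta> * r)) \<partial>lborel)" for \<beta>
  have fin: "\<theta> 0 < \<infinity>"
    using int' pos' by (simp add: \<theta>_def nn_integral_eq_integral)
  have dom: "norm (\<rho>' r * exp (- \<beta> * r)) \<le> \<rho>' r" if "\<beta> \<ge> 0" for \<beta> r
  proof (cases "r > 0")
    case True
    then have "exp (- \<beta> * r) \<le> 1" using that by simp
    then show ?thesis using pos'[of r] by (simp add: abs_mult mult_left_le)
  qed (simp add: \<rho>'_def)
  \<comment> \<open>Dominated convergence with majorant \<open>\<rho>'\<close>; natural numbers as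
    exponents suffice to find one good \<beta>.\<close>
  have "(\<lambda>k. \<integral>r. \<rho>' r * exp (- real k * r) \<partial>lborel) \<longlonglongrightarrow> integral\<^sup>L lborel (\<lambda>r::real. 0)"
  proof (rule integral_dominated_convergence[where w = \<rho>'])
    show "AE r in lborel. (\<lambda>k. \<rho>' r * exp (- real k * r)) \<longlonglongrightarrow> 0"
    proof (rule AE_I2)
      fix r :: real
      show "(\<lambda>k. \<rho>' r * exp (- real k * r)) \<longlonglongrightarrow> 0"
      proof (cases "r > 0")
        case True
        have "(\<lambda>k. exp (- r) ^ k) \<longlonglongrightarrow> 0"
          using True by (intro LIMSEQ_realpow_zero) auto
        then have "(\<lambda>k. exp (- real k * r)) \<longlonglongrightarrow> 0"
          by (simp add: exp_of_nat_mult[symmetric])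
        then show ?thesis by (rule tendsto_mult_right_zero)
      qed (simp add: \<rho>'_def)
    qed
    show "AE r in lborel. norm (\<rho>' r * exp (- real k * r)) \<le> \<rho>' r" for k
      using dom[of "real k"] by simp
  qed (use int' in auto)
  then have lim: "(\<lambda>k. \<integral>r. \<rho>' r * exp (- real k * r) \<partial>lborel) \<longlonglongrightarrow> 0" by simp
  have small: "\<exists>\<beta>>0. \<theta> \<beta> \<le> ennreal e" if "e > 0" for e
  proof -
    have "\<forall>\<^sub>F k in sequentially. (\<integral>r. \<rho>' r * exp (- real k * r) \<partial>lborel) < e"
      using lim that by (rule order_tendstoD)
    then have "\<forall>\<^sub>F k in sequentially. (\<integral>r. \<rho>' r * exp (- real k * r) \<partial>lborel) < e \<and> k \<ge> 1"
      by (intro eventually_conj eventually_ge_at_top)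
    then obtain k where k: "(\<integral>r. \<rho>' r * exp (- real k * r) \<partial>lborel) < e" "k \<ge> 1"
      using eventually_happens' sequentially_bot by blast
    have "integrable lborel (\<lambda>r. \<rho>' r * exp (- real k * r))"
      by (rule Bochner_Integration.integrable_bound[OF int']) (use dom[of "real k"] pos' in auto)
    then have "\<theta> (real k) = ennreal (\<integral>r. \<rho>' r * exp (- real k * r) \<partial>lborel)"
      unfolding \<theta>_def by (intro nn_integral_eq_integral) (use pos' in auto)
    then show ?thesis using k by (intro exI[of _ "real k"]) (auto intro: ennreal_leI)
  qed
  have main: "(\<integral>\<^sup>+p. ennreal ((Kn n q p)\<^sup>2 * exp (\<beta> * fst p)) \<partial>M) \<le> ennreal (exp (\<beta> * fst q)) * \<theta> \<beta>"
    if n: "n \<ge> 1" and q: "q \<in> C" and \<beta>: "\<beta> \<ge> 0" for n q \<beta>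
  proof -
    obtain t x where tx: "q = (t, x)" "0 \<le> t" "t \<le> T" "x \<in> closure D" using q by (auto simp: ccyl_def)
    let ?fl = "grid_floor T (m n)"
    let ?f = "\<lambda>p. ennreal (\<bar>Gn n t (?fl (fst p)) x (snd p)\<bar>\<^sup>2 * exp (\<beta> * fst p))"
    have eq: "(\<lambda>p. if fst p < t then ?f p else 0) = (\<lambda>p. ennreal ((Kn n q p)\<^sup>2 * exp (\<beta> * fst p)))"
      by (auto simp: Kn_def fun_eq_iff tx)
    have "(\<lambda>p. if fst p < t then ?f p else 0) \<in> borel_measurable M"
      unfolding eq using Kn_measurable[OF n q] by measurable
    from nn_integral_iterated_cyl[OF D_open tx(3) this]
    have "(\<integral>\<^sup>+p. ennreal ((Kn n q p)\<^sup>2 * exp (\<beta> * fst p)) \<partial>M)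
      = (\<integral>\<^sup>+s\<in>{0<..<t}. (\<integral>\<^sup>+z\<in>D. ennreal (\<bar>Gn n t (?fl s) x z\<bar>\<^sup>2 * exp (\<beta> * s)) \<partial>lborel) \<partial>lborel)"
      unfolding eq by simp
    also have "\<dots> \<le> (\<integral>\<^sup>+s. ennreal (\<rho>' (t - s) * exp (\<beta> * s)) \<partial>lborel)"
    proof (rule nn_integral_mono)
      fix s
      show "(\<integral>\<^sup>+z\<in>D. ennreal (\<bar>Gn n t (?fl s) x z\<bar>\<^sup>2 * exp (\<beta> * s)) \<partial>lborel) * indicator {0<..<t} s
        \<le> ennreal (\<rho>' (t - s) * exp (\<beta> * s))"
      proof (cases "s \<in> {0<..<t}")
        case True
        then have fl: "0 \<le> ?fl s" "?fl s \<le> s"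
          using grid_floor_bounds[of s T "m n"] m_pos[OF n] tx by auto
        have [measurable]: "(\<lambda>z. indicator D z * Gn n t (?fl s) x z) \<in> borel_measurable borel"
          by (rule Gn_section_measurable) (use n fl True tx in auto)
        have "(\<integral>\<^sup>+z\<in>D. ennreal (\<bar>Gn n t (?fl s) x z\<bar>\<^sup>2 * exp (\<beta> * s)) \<partial>lborel)
          = (\<integral>\<^sup>+z. ennreal (\<bar>indicator D z * Gn n t (?fl s) x z\<bar>\<^sup>2) * ennreal (exp (\<beta> * s)) \<partial>lborel)"
          by (rule nn_integral_cong) (auto simp: indicator_def ennreal_mult)
        also have "\<dots> = (\<integral>\<^sup>+z. ennreal (\<bar>indicator D z * Gn n t (?fl s) x z\<bar>\<^sup>2) \<partial>lborel) * ennreal (exp (\<beta> * s))"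
          by (rule nn_integral_multc) measurable
        also have "(\<integral>\<^sup>+z. ennreal (\<bar>indicator D z * Gn n t (?fl s) x z\<bar>\<^sup>2) \<partial>lborel)
          = (\<integral>\<^sup>+z\<in>D. ennreal (\<bar>Gn n t (?fl s) x z\<bar>\<^sup>2) \<partial>lborel)"
          by (rule nn_integral_cong) (auto simp: indicator_def)
        also have "\<dots> \<le> ennreal (\<rho> (t - ?fl s))"
          using True fl tx by (intro bnd n) auto
        \<comment> \<open>The hypothesis bounds the kernel frozen at the grid time; since that time
          is at most s and the majorant is nonincreasing, the freezing does no harm.\<close>
        also have "\<rho> (t - ?fl s) \<le> \<rho> (t - s)"
          using True fl tx by (intro monotone_onD[OF anti]) auto
        also have "\<rho> (t - s) = \<rho>' (t - s)" using True tx by (simp add: \<rho>'_def)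
        finally show ?thesis
          using True pos' by (simp add: ennreal_mult mult_right_mono ennreal_leI)
      qed simp
    qed
    also have "\<dots> = (\<integral>\<^sup>+r. ennreal (\<rho>' r * exp (\<beta> * (t - r))) \<partial>lborel)"
      using nn_integral_real_affine[of "\<lambda>r. ennreal (\<rho>' r * exp (\<beta> * (t - r)))" "-1" t] by simp
    also have "\<dots> = (\<integral>\<^sup>+r. ennreal (exp (\<beta> * t)) * ennreal (\<rho>' r * exp (- \<beta> * r)) \<partial>lborel)"
    proof (rule nn_integral_cong)
      fix r
      have "\<rho>' r * exp (\<beta> * (t - r)) = exp (\<beta> * t) * (\<rho>' r * exp (- \<beta> * r))"
        by (simp add: right_diff_distrib exp_diff exp_minus field_simps)
      then show "ennreal (\<rho>' r * exp (\<beta> * (t - r))) = ennreal (exp (\<beta> * t)) * ennreal (\<rho>' r * exp (- \<beta> * r))"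
        using pos'[of r] by (simp only: ennreal_mult[symmetric] exp_ge_zero mult_nonneg_nonneg)
    qed
    also have "\<dots> = ennreal (exp (\<beta> * t)) * \<theta> \<beta>"
      unfolding \<theta>_def by (rule nn_integral_cmult) measurable
    finally show ?thesis by (simp add: tx)
  qed
  show thesis by (rule that[OF fin small main])
qed

text \<open>The bound passes from the discrete kernels to their limit as n tends to infinity; the
  factor 2 is the price of splitting the square.\<close>

lemma K_weighted:
  obtains \<theta> :: "real \<Rightarrow> ennreal" where "\<theta> 0 < \<infinity>"
    and "\<And>e. e > 0 \<Longrightarrow> \<exists>\<beta>>0. \<theta> \<beta> \<le> ennreal e"
    and "\<And>q \<beta>. q \<in> C \<Longrightarrow> \<beta> \<ge> 0 \<Longrightarrow>
      (\<integral>\<^sup>+p. ennreal ((K q p)\<^sup>2 * exp (\<beta> * fst p)) \<partial>M) \<le> 2 * (ennreal (exp (\<beta> * fst q)) * \<theta> \<beta>)"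
proof -
  obtain \<theta> where \<theta>: "\<theta> 0 < \<infinity>" "\<And>e. e > 0 \<Longrightarrow> \<exists>\<beta>>0. \<theta> \<beta> \<le> ennreal e"
    and Kn: "\<And>n q \<beta>. n \<ge> 1 \<Longrightarrow> q \<in> C \<Longrightarrow> \<beta> \<ge> 0 \<Longrightarrow>
      (\<integral>\<^sup>+p. ennreal ((Kn n q p)\<^sup>2 * exp (\<beta> * fst p)) \<partial>M) \<le> ennreal (exp (\<beta> * fst q)) * \<theta> \<beta>"
    using Kn_weighted by blast
  obtain \<eta> where \<eta>: "\<eta> \<longlonglongrightarrow> 0"
    "\<And>n q. n \<ge> 1 \<Longrightarrow> q \<in> C \<Longrightarrow> (\<integral>\<^sup>+p. ennreal ((Kn n q p - K q p)\<^sup>2) \<partial>M) \<le> \<eta> n"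
    using Kn_approx_K by blast
  have "(\<integral>\<^sup>+p. ennreal ((K q p)\<^sup>2 * exp (\<beta> * fst p)) \<partial>M) \<le> 2 * (ennreal (exp (\<beta> * fst q)) * \<theta> \<beta>)"
    if q: "q \<in> C" and \<beta>: "\<beta> \<ge> 0" for q \<beta>
  proof (rule LIMSEQ_le_const)
    let ?c = "2 * (ennreal (exp (\<beta> * fst q)) * \<theta> \<beta>)"
    \<comment> \<open>On the cylinder the weight is at most exp(\<beta> T), which may be large but
      is fixed while \<open>\<eta> n\<close> tends to 0.\<close>
    let ?k = "ennreal (2 * exp (\<beta> * T))"
    have "(\<lambda>n. ?k * \<eta> n + ?c) \<longlonglongrightarrow> ?k * 0 + ?c"
      by (intro tendsto_add tendsto_const ennreal_tendsto_cmult \<eta>(1)) simp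
    then show "(\<lambda>n. ?k * \<eta> n + ?c) \<longlonglongrightarrow> ?c" by simp
    have "(\<integral>\<^sup>+p. ennreal ((K q p)\<^sup>2 * exp (\<beta> * fst p)) \<partial>M) \<le> ?k * \<eta> n + ?c" if n: "n \<ge> 1" for n
    proof -
      note [measurable] = K_measurable[OF q] Kn_measurable[OF n q]
      have "(\<integral>\<^sup>+p. ennreal ((K q p)\<^sup>2 * exp (\<beta> * fst p)) \<partial>M)
        \<le> (\<integral>\<^sup>+p. ?k * ennreal ((Kn n q p - K q p)\<^sup>2) + 2 * ennreal ((Kn n q p)\<^sup>2 * exp (\<beta> * fst p)) \<partial>M)"
      proof (rule nn_integral_mono)
        fix p assume "p \<in> space M"
        then have "p \<in> S" by (simp add: space_M)
        then have e: "exp (\<beta> * fst p) \<le> exp (\<beta> * T)" using \<beta> by (auto simp: cyl_def intro!: mult_left_mono)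
        define a c where "a = Kn n q p" and "c = K q p"
        \<comment> \<open>Indeed 2(a-c)^2 + 2a^2 - c^2 = (2a-c)^2.\<close>
        have "0 \<le> (2 * a - c)\<^sup>2" by simp
        then have "c\<^sup>2 \<le> 2 * (a - c)\<^sup>2 + 2 * a\<^sup>2" by (simp add: power2_eq_square algebra_simps)
        then have "c\<^sup>2 * exp (\<beta> * fst p) \<le> (2 * (a - c)\<^sup>2 + 2 * a\<^sup>2) * exp (\<beta> * fst p)"
          by (rule mult_right_mono) simp
        also have "\<dots> = 2 * (a - c)\<^sup>2 * exp (\<beta> * fst p) + 2 * (a\<^sup>2 * exp (\<beta> * fst p))"
          by (simp add: algebra_simps)
        also have "\<dots> \<le> 2 * (a - c)\<^sup>2 * exp (\<beta> * T) + 2 * (a\<^sup>2 * exp (\<beta> * fst p))"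
          using e by (intro add_right_mono mult_left_mono) auto
        finally have "ennreal (c\<^sup>2 * exp (\<beta> * fst p))
          \<le> ennreal (2 * exp (\<beta> * T) * (a - c)\<^sup>2 + 2 * (a\<^sup>2 * exp (\<beta> * fst p)))"
          by (intro ennreal_leI) (simp add: mult_ac)
        also have "\<dots> = ?k * ennreal ((a - c)\<^sup>2) + 2 * ennreal (a\<^sup>2 * exp (\<beta> * fst p))"
          by (simp add: ennreal_plus ennreal_mult)
        finally show "ennreal ((K q p)\<^sup>2 * exp (\<beta> * fst p))
          \<le> ?k * ennreal ((Kn n q p - K q p)\<^sup>2) + 2 * ennreal ((Kn n q p)\<^sup>2 * exp (\<beta> * fst p))"
          by (simp add: a_def c_def)
      qed
      also have "\<dots> = ?k * (\<integral>\<^sup>+p. ennreal ((Kn n q p - K q p)\<^sup>2) \<partial>M)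
          + 2 * (\<integral>\<^sup>+p. ennreal ((Kn n q p)\<^sup>2 * exp (\<beta> * fst p)) \<partial>M)"
        by (simp add: nn_integral_add nn_integral_cmult)
      also have "\<dots> \<le> ?k * \<eta> n + ?c"
        using \<eta>(2)[OF n q] Kn[OF n q \<beta>] by (intro add_mono mult_left_mono) auto
      finally show ?thesis .
    qed
    then show "\<exists>N. \<forall>n\<ge>N. (\<integral>\<^sup>+p. ennreal ((K q p)\<^sup>2 * exp (\<beta> * fst p)) \<partial>M) \<le> ?k * \<eta> n + ?c" by blast
  qed
  with \<theta> show thesis by (rule that)
qed

lemma Kn_square_integrable:
  assumes "n \<ge> 1" "q \<in> C"
  shows "Kn n q \<in> square_integrable M"
proof -
  obtain \<theta> where "\<theta> 0 < \<infinity>" and small: "\<And>e. e > 0 \<Longrightarrow> \<exists>\<beta>>0. \<theta> \<beta> \<le> ennreal e"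
    and Kn: "\<And>n q \<beta>. n \<ge> 1 \<Longrightarrow> q \<in> C \<Longrightarrow> \<beta> \<ge> 0 \<Longrightarrow>
      (\<integral>\<^sup>+p. ennreal ((Kn n q p)\<^sup>2 * exp (\<beta> * fst p)) \<partial>M) \<le> ennreal (exp (\<beta> * fst q)) * \<theta> \<beta>"
    using Kn_weighted by blast
  then show ?thesis
    using Kn[OF assms, of 0] Kn_measurable[OF assms] by (intro square_integrable_nnI) (auto intro: le_less_trans)
qed

lemma K_bounded:
  obtains R where "R > 0" "\<And>q. q \<in> C \<Longrightarrow> K q \<in> square_integrable M" "\<And>q. q \<in> C \<Longrightarrow> l2_norm M (K q) \<le> R"
proof -
  obtain \<theta> where fin: "\<theta> 0 < \<infinity>" and small: "\<And>e. e > 0 \<Longrightarrow> \<exists>\<beta>>0. \<theta> \<beta> \<le> ennreal e"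
    and K: "\<And>q \<beta>. q \<in> C \<Longrightarrow> \<beta> \<ge> 0 \<Longrightarrow>
      (\<integral>\<^sup>+p. ennreal ((K q p)\<^sup>2 * exp (\<beta> * fst p)) \<partial>M) \<le> 2 * (ennreal (exp (\<beta> * fst q)) * \<theta> \<beta>)"
    using K_weighted by blast
  obtain r where r: "\<theta> 0 = ennreal r" "r \<ge> 0" using fin by (cases "\<theta> 0") auto
  \<comment> \<open>The weight is trivial at \<beta> = 0. The summand 1 keeps the resulting bound
    positive, so that it can be divided by.\<close>
  have le: "(\<integral>\<^sup>+p. ennreal ((K q p)\<^sup>2) \<partial>M) \<le> ennreal ((sqrt (2 * r + 1))\<^sup>2)" if "q \<in> C" for q
  proof -
    have "(\<integral>\<^sup>+p. ennreal ((K q p)\<^sup>2) \<partial>M) \<le> 2 * ennreal r" using K[OF that, of 0] r by simp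
    also have "\<dots> = ennreal (2 * r)" using r by (simp add: ennreal_mult)
    also have "\<dots> \<le> ennreal (2 * r + 1)" by (rule ennreal_leI) simp
    finally show ?thesis using r by simp
  qed
  show thesis
  proof (rule that[of "sqrt (2 * r + 1)"])
    show "sqrt (2 * r + 1) > 0" using r by simp
    show "K q \<in> square_integrable M" if "q \<in> C" for q
      using le[OF that] K_measurable[OF that] by (intro square_integrable_nnI) (auto intro: le_less_trans)
    show "l2_norm M (K q) \<le> sqrt (2 * r + 1)" if "q \<in> C" for q
      using le[OF that] K_measurable[OF that] r by (intro l2_norm_le_nnI) auto
  qed
qed

lemma K_square_integrable: "q \<in> C \<Longrightarrow> K q \<in> square_integrable M"
  by (rule K_bounded)

text \<open>The form in which the estimate enters the Gronwall argument: \<open>c\<close> is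
  arbitrary, so any Lipschitz factor can be beaten. Squaring the weight doubles its exponent, whence
  \<beta> is half of the parameter found for \<open>\<theta>\<close>.\<close>

lemma Kn_weighted_norm:
  assumes "c > 0"
  obtains \<beta> where "\<beta> > 0"
    and "\<And>n q. n \<ge> 1 \<Longrightarrow> q \<in> C \<Longrightarrow> (\<lambda>p. Kn n q p * exp (\<beta> * fst p)) \<in> square_integrable M"
    and "\<And>n q. n \<ge> 1 \<Longrightarrow> q \<in> C \<Longrightarrow> l2_norm M (\<lambda>p. Kn n q p * exp (\<beta> * fst p)) \<le> c * exp (\<beta> * fst q)"
proof -
  obtain \<theta> where "\<theta> 0 < \<infinity>" and \<theta>: "\<And>e. e > 0 \<Longrightarrow> \<exists>\<beta>>0. \<theta> \<beta> \<le> ennreal e"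
    and Kn: "\<And>n q \<beta>. n \<ge> 1 \<Longrightarrow> q \<in> C \<Longrightarrow> \<beta> \<ge> 0 \<Longrightarrow>
      (\<integral>\<^sup>+p. ennreal ((Kn n q p)\<^sup>2 * exp (\<beta> * fst p)) \<partial>M) \<le> ennreal (exp (\<beta> * fst q)) * \<theta> \<beta>"
    using Kn_weighted by blast
  obtain \<beta>' where \<beta>': "\<beta>' > 0" "\<theta> \<beta>' \<le> ennreal (c\<^sup>2)" using \<theta>[of "c\<^sup>2"] assms by auto
  define \<beta> where "\<beta> = \<beta>' / 2"
  have "\<beta> > 0" using \<beta>' by (simp add: \<beta>_def)
  have sq: "(Kn n q p * exp (\<beta> * fst p))\<^sup>2 = (Kn n q p)\<^sup>2 * exp (\<beta>' * fst p)" for n q p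
    using exp_double_power2[of \<beta> "fst p"] by (simp add: \<beta>_def power_mult_distrib)
  have le: "(\<integral>\<^sup>+p. ennreal ((Kn n q p * exp (\<beta> * fst p))\<^sup>2) \<partial>M) \<le> ennreal ((c * exp (\<beta> * fst q))\<^sup>2)"
    if "n \<ge> 1" "q \<in> C" for n q
  proof -
    have "(\<integral>\<^sup>+p. ennreal ((Kn n q p * exp (\<beta> * fst p))\<^sup>2) \<partial>M) \<le> ennreal (exp (\<beta>' * fst q)) * \<theta> \<beta>'"
      unfolding sq using that \<beta>' by (intro Kn) auto
    also have "\<dots> \<le> ennreal (exp (\<beta>' * fst q)) * ennreal (c\<^sup>2)" using \<beta>' by (intro mult_left_mono) auto
    also have "\<dots> = ennreal ((c * exp (\<beta> * fst q))\<^sup>2)"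
      using exp_double_power2[of \<beta> "fst q"]
      by (simp add: \<beta>_def power_mult_distrib ennreal_mult[symmetric] mult.commute)
    finally show ?thesis .
  qed
  have meas: "(\<lambda>p. Kn n q p * exp (\<beta> * fst p)) \<in> borel_measurable M" if "n \<ge> 1" "q \<in> C" for n q
    using Kn_measurable[OF that] by measurable
  show thesis
  proof (rule that[OF \<open>\<beta> > 0\<close>])
    show "(\<lambda>p. Kn n q p * exp (\<beta> * fst p)) \<in> square_integrable M" if "n \<ge> 1" "q \<in> C" for n q
      using le[OF that] meas[OF that] by (intro square_integrable_nnI) (auto intro: le_less_trans)
    show "l2_norm M (\<lambda>p. Kn n q p * exp (\<beta> * fst p)) \<le> c * exp (\<beta> * fst q)" if "n \<ge> 1" "q \<in> C" for n q
      using le[OF that] meas[OF that] assms by (intro l2_norm_le_nnI) auto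
  qed
qed

lemma Kn_tendsto_K:
  assumes "e > 0"
  shows "\<forall>\<^sub>F n in sequentially. \<forall>q\<in>C. l2_norm M (\<lambda>p. Kn n q p - K q p) \<le> e"
proof -
  obtain \<eta> where \<eta>: "\<eta> \<longlonglongrightarrow> 0"
    "\<And>n q. n \<ge> 1 \<Longrightarrow> q \<in> C \<Longrightarrow> (\<integral>\<^sup>+p. ennreal ((Kn n q p - K q p)\<^sup>2) \<partial>M) \<le> \<eta> n"
    using Kn_approx_K by blast
  have "\<forall>\<^sub>F n in sequentially. \<eta> n < ennreal (e\<^sup>2)"
    using \<eta>(1) by (rule order_tendstoD) (use assms in simp)
  moreover have "\<forall>\<^sub>F n in sequentially. n \<ge> (1::nat)" by (rule eventually_ge_at_top)
  ultimately show ?thesis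
  proof eventually_elim
    case (elim n)
    show ?case
    proof
      fix q assume q: "q \<in> C"
      note [measurable] = K_measurable[OF q] Kn_measurable[OF elim(2) q]
      show "l2_norm M (\<lambda>p. Kn n q p - K q p) \<le> e"
        by (rule l2_norm_le_nnI) (use \<eta>(2)[OF elim(2) q] elim(1) assms in auto)
    qed
  qed
qed

text \<open>The hypothesis controls the difference only for s below the smaller time t'. On the
  remaining strip t' <= s < t only the later kernel is present, and the weighted bound makes its
  mass small when t - t' is at most 1/\<beta>.\<close>

lemma K_equicontinuous:
  assumes "e > 0"
  shows "\<exists>d>0. \<forall>q\<in>C. \<forall>q'\<in>C. dist q q' < d \<longrightarrow> l2_norm M (\<lambda>p. K q p - K q' p) < e"
proof -
  obtain \<theta> where "\<theta> 0 < \<infinity>" and \<theta>: "\<And>e. e > 0 \<Longrightarrow> \<exists>\<beta>>0. \<theta> \<beta> \<le> ennreal e"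
    and K: "\<And>q \<beta>. q \<in> C \<Longrightarrow> \<beta> \<ge> 0 \<Longrightarrow>
      (\<integral>\<^sup>+p. ennreal ((K q p)\<^sup>2 * exp (\<beta> * fst p)) \<partial>M) \<le> 2 * (ennreal (exp (\<beta> * fst q)) * \<theta> \<beta>)"
    using K_weighted by blast
  \<comment> \<open>The common interval contributes e' and the strip 2e', together 3e^2/16, which is
    below (e/2)^2.\<close>
  define e' where "e' = e\<^sup>2 / 16"
  have e': "e' > 0" using assms by (simp add: e'_def)
  obtain \<beta> where \<beta>: "\<beta> > 0" "\<theta> \<beta> \<le> ennreal (e' / exp 1)" using \<theta>[of "e' / exp 1"] e' by auto
  define A where "A \<delta> = {(t, t', x, x'). 0 \<le> t' \<and> t' \<le> t \<and> t \<le> T \<and>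
      x \<in> closure D \<and> x' \<in> closure D \<and> \<bar>t - t'\<bar> + norm (x - x') \<le> \<delta>}" for \<delta>
  define I where "I = (\<lambda>(t, t', x, x'). \<integral>\<^sup>+s\<in>{0<..<t'}. (\<integral>\<^sup>+z\<in>D.
      ennreal (\<bar>G (t - s) x z - G (t' - s) x' z\<bar>\<^sup>2) \<partial>lborel) \<partial>lborel)"
  have "((\<lambda>\<delta>. SUP y\<in>A \<delta>. I y) \<longlongrightarrow> 0) (at_right 0)"
    using G_equicontinuous by (simp add: A_def I_def case_prod_beta')
  then have "\<forall>\<^sub>F \<delta> in at_right 0. (SUP y\<in>A \<delta>. I y) < ennreal e'"
    by (rule order_tendstoD) (use e' in simp)
  then obtain \<delta> where \<delta>: "\<delta> > 0" "(SUP y\<in>A \<delta>. I y) < ennreal e'"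
    using eventually_happens'[OF trivial_limit_at_right_real]
      eventually_conj[OF _ eventually_at_right_less[of 0]] by (metis (no_types, lifting))
  \<comment> \<open>The bound 1/\<beta> on the time difference gives exp(\<beta>(t - t')) <= exp 1,
    which cancels the divisor \<open>exp 1\<close> in the choice of \<beta>.\<close>
  define d where "d = min (\<delta> / 2) (1 / \<beta>)"
  have "d > 0" using \<delta> \<beta> by (simp add: d_def)
  have half: "l2_norm M (\<lambda>p. K q p - K q' p) < e"
    if q: "q \<in> C" and q': "q' \<in> C" and dist: "dist q q' < d" and le: "fst q' \<le> fst q" for q q'
  proof -
    note [measurable] = K_measurable[OF q] K_measurable[OF q']
    obtain t x t' x' where tx: "q = (t, x)" "q' = (t', x')" by (cases q, cases q') auto
    have dt: "\<bar>t - t'\<bar> < d" using le_less_trans[OF dist_fst_le dist] by (simp add: tx dist_real_def)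
    have dx: "norm (x - x') < d" using le_less_trans[OF dist_snd_le dist] by (simp add: tx dist_norm)
    have in_A: "(t, t', x, x') \<in> A \<delta>"
      using q q' le dt dx by (auto simp: A_def tx ccyl_def d_def)
    have t': "t' \<le> T" using q' by (auto simp: tx ccyl_def)
    let ?f = "\<lambda>p. ennreal (\<bar>G (t - fst p) x (snd p) - G (t' - fst p) x' (snd p)\<bar>\<^sup>2)"
    let ?g = "\<lambda>p. if fst p < t' then ennreal ((K q p - K q' p)\<^sup>2) else 0"
    have eq: "(\<lambda>p. if fst p < t' then ?f p else 0) = ?g"
      using le by (auto simp: K_def fun_eq_iff tx)
    have "(\<lambda>p. if fst p < t' then ?f p else 0) \<in> borel_measurable M"
      unfolding eq by measurable
    from nn_integral_iterated_cyl[OF D_open t' this]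
    have "(\<integral>\<^sup>+p. ?g p \<partial>M) = I (t, t', x, x')" unfolding eq by (simp add: I_def)
    also have "\<dots> \<le> (SUP y\<in>A \<delta>. I y)" using in_A by (rule SUP_upper)
    finally have 1: "(\<integral>\<^sup>+p. ?g p \<partial>M) \<le> ennreal e'" using \<delta>(2) by simp
    let ?h = "\<lambda>p. ennreal ((K q p)\<^sup>2 * exp (\<beta> * fst p))"
    have "(\<integral>\<^sup>+p. ennreal ((K q p - K q' p)\<^sup>2) \<partial>M) \<le> (\<integral>\<^sup>+p. ?g p + ennreal (exp (- \<beta> * t')) * ?h p \<partial>M)"
    proof (rule nn_integral_mono)
      fix p
      show "ennreal ((K q p - K q' p)\<^sup>2) \<le> ?g p + ennreal (exp (- \<beta> * t')) * ?h p"
      proof (cases "fst p < t'")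
        \<comment> \<open>Here s >= t', so inserting the factor exp(\<beta>(s - t')) >= 1 only
          enlarges the integrand and produces the weighted integral.\<close>
        case False
        then have "K q' p = 0" by (simp add: K_def tx)
        moreover have "(K q p)\<^sup>2 * 1 \<le> (K q p)\<^sup>2 * exp (\<beta> * fst p - \<beta> * t')"
          using False \<beta> by (intro mult_left_mono) (auto simp: right_diff_distrib[symmetric])
        moreover have "exp (- \<beta> * t') * ((K q p)\<^sup>2 * exp (\<beta> * fst p)) = (K q p)\<^sup>2 * exp (\<beta> * fst p - \<beta> * t')"
          by (simp add: exp_diff exp_minus field_simps)
        ultimately have "(K q p - K q' p)\<^sup>2 \<le> exp (- \<beta> * t') * ((K q p)\<^sup>2 * exp (\<beta> * fst p))"
          by (simp only: mult_1_right diff_zero)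
        then show ?thesis using False by (simp add: ennreal_mult[symmetric] ennreal_leI)
      qed simp
    qed
    also have "\<dots> = (\<integral>\<^sup>+p. ?g p \<partial>M) + ennreal (exp (- \<beta> * t')) * (\<integral>\<^sup>+p. ?h p \<partial>M)"
      by (subst nn_integral_add) (auto simp: nn_integral_cmult)
    also have "\<dots> \<le> ennreal e' + ennreal (exp (- \<beta> * t')) * (2 * (ennreal (exp (\<beta> * t)) * ennreal (e' / exp 1)))"
    proof (intro add_mono 1 mult_left_mono)
      have "(\<integral>\<^sup>+p. ?h p \<partial>M) \<le> 2 * (ennreal (exp (\<beta> * t)) * \<theta> \<beta>)"
        using K[OF q, of \<beta>] \<beta> by (simp add: tx)
      also have "\<dots> \<le> 2 * (ennreal (exp (\<beta> * t)) * ennreal (e' / exp 1))"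
        using \<beta>(2) by (intro mult_left_mono) auto
      finally show "(\<integral>\<^sup>+p. ?h p \<partial>M) \<le> 2 * (ennreal (exp (\<beta> * t)) * ennreal (e' / exp 1))" .
    qed auto
    also have "\<dots> = ennreal (e' + 2 * exp (\<beta> * (t - t')) * (e' / exp 1))"
    proof -
      have "exp (- \<beta> * t') * (2 * (exp (\<beta> * t) * (e' / exp 1))) = 2 * exp (\<beta> * (t - t')) * (e' / exp 1)"
        by (simp add: right_diff_distrib exp_diff exp_minus field_simps)
      moreover have "ennreal a * (2 * (ennreal c * ennreal k)) = ennreal (a * (2 * (c * k)))"
        if "0 \<le> a" "0 \<le> c" "0 \<le> k" for a c k :: real
        using that by (simp add: ennreal_mult)
      then have "ennreal (exp (- \<beta> * t')) * (2 * (ennreal (exp (\<beta> * t)) * ennreal (e' / exp 1)))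
          = ennreal (exp (- \<beta> * t') * (2 * (exp (\<beta> * t) * (e' / exp 1))))"
        using e' by (metis divide_nonneg_nonneg exp_ge_zero less_eq_real_def)
      ultimately show ?thesis using e' by (simp add: ennreal_plus)
    qed
    also have "\<dots> \<le> ennreal (e' + 2 * exp 1 * (e' / exp 1))"
    proof -
      have "\<beta> * (t - t') \<le> \<beta> * (1 / \<beta>)" using dt \<beta> by (intro mult_left_mono) (auto simp: d_def)
      then have "exp (\<beta> * (t - t')) \<le> exp 1" using \<beta> by simp
      then show ?thesis
        using e' by (intro ennreal_leI add_left_mono mult_right_mono mult_left_mono) auto
    qed
    also have "\<dots> \<le> ennreal ((e / 2)\<^sup>2)"
      using e' by (intro ennreal_leI) (simp add: e'_def power_divide)
    finally have "l2_norm M (\<lambda>p. K q p - K q' p) \<le> e / 2"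
      by (rule l2_norm_le_nnI) (use assms in auto)
    then show ?thesis using assms by simp
  qed
  have "l2_norm M (\<lambda>p. K q p - K q' p) < e" if "q \<in> C" "q' \<in> C" "dist q q' < d" for q q'
  proof (cases "fst q' \<le> fst q")
    case True
    then show ?thesis using half that by blast
  next
    case False
    then have "l2_norm M (\<lambda>p. K q' p - K q p) < e" using half that by (simp add: dist_commute)
    then show ?thesis by (subst l2_norm_minus_commute)
  qed
  with \<open>d > 0\<close> show ?thesis by blast
qed

end

section \<open>Convergence of the discrete solution maps\<close>

lemma sup_norm_le:
  assumes "S \<noteq> {}" "\<And>p. p \<in> S \<Longrightarrow> \<bar>f p\<bar> \<le> c"
  shows "sup_norm S f \<le> c"
  unfolding sup_norm_def using assms by (rule cSUP_least)

lemma abs_le_sup_norm: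
  assumes "compact S" "continuous_on S f" "p \<in> S"
  shows "\<bar>f p\<bar> \<le> sup_norm S f"
  unfolding sup_norm_def
proof (rule cSUP_upper[OF assms(3)])
  have "compact ((\<lambda>p. \<bar>f p\<bar>) ` S)"
    using assms by (intro compact_continuous_image continuous_intros)
  then show "bdd_above ((\<lambda>p. \<bar>f p\<bar>) ` S)"
    by (intro bounded_imp_bdd_above compact_imp_bounded)
qed

lemma continuous_on_Cspace_diff:
  "f \<in> Cspace S \<Longrightarrow> g \<in> Cspace S \<Longrightarrow> continuous_on S (\<lambda>p. f p - g p)"
  by (auto simp: Cspace_def intro: continuous_intros)

context skeleton_scheme
begin

section \<open>The skeleton equations as inner product identities\<close>

lemma sup_norm_nonneg:
  assumes "f \<in> Cspace C" "f' \<in> Cspace C"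
  shows "0 \<le> sup_norm C (\<lambda>p. f p - f' p)"
proof -
  obtain p where "p \<in> C" using C_nonempty by auto
  from abs_le_sup_norm[OF C_compact continuous_on_Cspace_diff[OF assms] this]
  show ?thesis by linarith
qed

text \<open>The integrability clause holds automatically for continuous u, because the integrand is
  a product of two square-integrable functions; Fubini then identifies the iterated integral with
  the inner product.\<close>

lemma skeleton_solution_iff:
  assumes h: "h \<in> square_integrable M"
  shows "skeleton_solution T D G b \<sigma> g h u
    \<longleftrightarrow> u \<in> Cspace C \<and> (\<forall>q\<in>C. u q = g q + l2_inner M (K q) (F u h))"
proof (cases "u \<in> Cspace C")
  case True
  have *: "set_integrable lborel ({0<..<t} \<times> D)
        (\<lambda>(s, z). G (t - s) x z * (b (u (s, z)) + \<sigma> (u (s, z)) * h (s, z)))"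
    "(LINT s:{0<..<t}|lborel. LINT z:D|lborel.
        G (t - s) x z * (b (u (s, z)) + \<sigma> (u (s, z)) * h (s, z))) = l2_inner M (K (t, x)) (F u h)"
    if tx: "t \<in> {0..T}" "x \<in> closure D" for t x
  proof -
    have q: "(t, x) \<in> C" and t: "t \<le> T" using tx by (auto simp: ccyl_def)
    let ?f = "\<lambda>(s, z). G (t - s) x z * (b (u (s, z)) + \<sigma> (u (s, z)) * h (s, z))"
    have eq: "(\<lambda>p. if fst p < t then ?f p else 0) = (\<lambda>p. K (t, x) p * F u h p)"
      by (auto simp: K_def F_def fun_eq_iff)
    have "integrable M (\<lambda>p. K (t, x) p * F u h p)"
      by (rule square_integrable_mult[OF K_square_integrable[OF q] F_Cspace[OF True h]])
    then show int: "set_integrable lborel ({0<..<t} \<times> D) ?f"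
      unfolding set_integrable_cyl_iff[OF D_open t] eq .
    show "(LINT s:{0<..<t}|lborel. LINT z:D|lborel.
        G (t - s) x z * (b (u (s, z)) + \<sigma> (u (s, z)) * h (s, z))) = l2_inner M (K (t, x)) (F u h)"
      using set_integral_iterated_cyl[OF D_open t int] unfolding eq l2_inner_def by simp
  qed
  show ?thesis
    unfolding skeleton_solution_def using True * by (auto simp: ccyl_def)
qed (simp add: skeleton_solution_def)

lemma discrete_skeleton_solution_iff:
  assumes n: "n \<ge> 1" and h: "h \<in> square_integrable M"
  shows "discrete_skeleton_solution T D (m n) (\<kappa> n) (Gn n) b \<sigma> (gn n) h u
    \<longleftrightarrow> u \<in> Cspace C \<and> (\<forall>q\<in>C. u q = gn n q + l2_inner M (Kn n q) (F (\<lambda>p. u (P n p)) h))"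
proof (cases "u \<in> Cspace C")
  case True
  let ?fl = "grid_floor T (m n)"
  have *: "set_integrable lborel ({0<..<t} \<times> D)
        (\<lambda>(s, z). Gn n t (?fl s) x z * (b (u (?fl s, \<kappa> n z)) + \<sigma> (u (?fl s, \<kappa> n z)) * h (s, z)))"
    "(LINT s:{0<..<t}|lborel. LINT z:D|lborel.
        Gn n t (?fl s) x z * (b (u (?fl s, \<kappa> n z)) + \<sigma> (u (?fl s, \<kappa> n z)) * h (s, z)))
      = l2_inner M (Kn n (t, x)) (F (\<lambda>p. u (P n p)) h)"
    if tx: "t \<in> {0..T}" "x \<in> closure D" for t x
  proof -
    have q: "(t, x) \<in> C" and t: "t \<le> T" using tx by (auto simp: ccyl_def)
    let ?f = "\<lambda>(s, z). Gn n t (?fl s) x z * (b (u (?fl s, \<kappa> n z)) + \<sigma> (u (?fl s, \<kappa> n z)) * h (s, z))"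
    have eq: "(\<lambda>p. if fst p < t then ?f p else 0) = (\<lambda>p. Kn n (t, x) p * F (\<lambda>p. u (P n p)) h p)"
      by (auto simp: Kn_def F_def P_def fun_eq_iff)
    have "integrable M (\<lambda>p. Kn n (t, x) p * F (\<lambda>p. u (P n p)) h p)"
      by (rule square_integrable_mult[OF Kn_square_integrable[OF n q] F_P_Cspace[OF n True h]])
    then show int: "set_integrable lborel ({0<..<t} \<times> D) ?f"
      unfolding set_integrable_cyl_iff[OF D_open t] eq .
    show "(LINT s:{0<..<t}|lborel. LINT z:D|lborel.
        Gn n t (?fl s) x z * (b (u (?fl s, \<kappa> n z)) + \<sigma> (u (?fl s, \<kappa> n z)) * h (s, z)))
      = l2_inner M (Kn n (t, x)) (F (\<lambda>p. u (P n p)) h)"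
      using set_integral_iterated_cyl[OF D_open t int] unfolding eq l2_inner_def by simp
  qed
  show ?thesis
    unfolding discrete_skeleton_solution_def using True * by (auto simp: ccyl_def)
qed (simp add: discrete_skeleton_solution_def)

lemma \<Upsilon>_solution:
  assumes "h \<in> square_integrable M"
  shows "\<Upsilon> h \<in> Cspace C" "\<And>q. q \<in> C \<Longrightarrow> \<Upsilon> h q = g q + l2_inner M (K q) (F (\<Upsilon> h) h)"
proof -
  have "skeleton_solution T D G b \<sigma> g h (\<Upsilon> h)"
    unfolding skeleton_map_def using assms by (intro theI'[OF skeleton_ex1]) (simp add: L2_eq)
  then show "\<Upsilon> h \<in> Cspace C" "\<And>q. q \<in> C \<Longrightarrow> \<Upsilon> h q = g q + l2_inner M (K q) (F (\<Upsilon> h) h)"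
    unfolding skeleton_solution_iff[OF assms] by auto
qed

lemma \<Upsilon>_eqI:
  assumes "h \<in> square_integrable M" "u \<in> Cspace C" "\<And>q. q \<in> C \<Longrightarrow> u q = g q + l2_inner M (K q) (F u h)"
  shows "\<Upsilon> h = u"
proof -
  have "skeleton_solution T D G b \<sigma> g h u"
    unfolding skeleton_solution_iff[OF assms(1)] using assms(2,3) by blast
  moreover have "h \<in> L2 S" using assms(1) by (simp add: L2_eq)
  ultimately show ?thesis
    unfolding skeleton_map_def by (intro the1_equality[OF skeleton_ex1])
qed

lemma \<Upsilon>n_solution:
  assumes "n \<ge> 1" "h \<in> X n"
  shows "\<Upsilon>n n h \<in> Cspace C"
    "\<And>q. q \<in> C \<Longrightarrow> \<Upsilon>n n h q = gn n q + l2_inner M (Kn n q) (F (\<lambda>p. \<Upsilon>n n h (P n p)) h)"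
proof -
  have "discrete_skeleton_solution T D (m n) (\<kappa> n) (Gn n) b \<sigma> (gn n) h (\<Upsilon>n n h)"
    unfolding discrete_skeleton_map_def by (rule theI'[OF discrete_ex1[OF assms]])
  then show "\<Upsilon>n n h \<in> Cspace C"
    "\<And>q. q \<in> C \<Longrightarrow> \<Upsilon>n n h q = gn n q + l2_inner M (Kn n q) (F (\<lambda>p. \<Upsilon>n n h (P n p)) h)"
    unfolding discrete_skeleton_solution_iff[OF assms(1) X_square_integrable[OF assms(2)]] by auto
qed

text \<open>The envelope 1 + |h| measures how strongly \<open>F\<close> reacts to its state at
  control h: the 1 stems from b, the |h| from \<sigma>.\<close>

lemma one_plus_abs:
  assumes "h \<in> square_integrable M"
  shows "(\<lambda>p. 1 + \<bar>h p\<bar>) \<in> square_integrable M"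
    "l2_norm M (\<lambda>p. 1 + \<bar>h p\<bar>) \<le> l2_norm M (\<lambda>p. 1) + l2_norm M h"
proof -
  note 1 = M.square_integrable_const[of 1] and a = square_integrable_abs[OF assms]
  show "(\<lambda>p. 1 + \<bar>h p\<bar>) \<in> square_integrable M" by (rule square_integrable_add[OF 1 a])
  have "l2_norm M (\<lambda>p. \<bar>h p\<bar>) = l2_norm M h" by (simp add: l2_norm_def)
  then show "l2_norm M (\<lambda>p. 1 + \<bar>h p\<bar>) \<le> l2_norm M (\<lambda>p. 1) + l2_norm M h"
    using l2_norm_triangle[OF 1 a] by simp
qed

section \<open>Stability of the discrete equation\<close>

lemma F_diff_le: "\<bar>F v h p - F v' h p\<bar> \<le> L * \<bar>v p - v' p\<bar> * (1 + \<bar>h p\<bar>)"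
proof -
  have "F v h p - F v' h p = (b (v p) - b (v' p)) + (\<sigma> (v p) - \<sigma> (v' p)) * h p"
    by (simp add: F_def algebra_simps)
  then have "\<bar>F v h p - F v' h p\<bar> \<le> \<bar>b (v p) - b (v' p)\<bar> + \<bar>\<sigma> (v p) - \<sigma> (v' p)\<bar> * \<bar>h p\<bar>"
    by (metis abs_mult abs_triangle_ineq)
  also have "\<dots> \<le> L * \<bar>v p - v' p\<bar> + L * \<bar>v p - v' p\<bar> * \<bar>h p\<bar>"
    by (intro add_mono mult_right_mono b_lipschitz \<sigma>_lipschitz) auto
  finally show ?thesis by (simp add: distrib_left)
qed

text \<open>Gronwall's argument for a singular convolution kernel: the weight \<open>exp (- \<beta> t)\<close> turns the
  feedback term into a contraction with factor \<open>1/2\<close>.\<close>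

lemma discrete_stability:
  assumes n: "n \<ge> 1" and h: "h \<in> X n" and u: "u \<in> Cspace C" and \<beta>: "\<beta> > 0"
    and Kw: "\<And>q. q \<in> C \<Longrightarrow> (\<lambda>p. Kn n q p * exp (\<beta> * fst p)) \<in> square_integrable M"
      "\<And>q. q \<in> C \<Longrightarrow> l2_norm M (\<lambda>p. Kn n q p * exp (\<beta> * fst p)) \<le> c * exp (\<beta> * fst q)"
    and H: "l2_norm M (\<lambda>p. 1 + \<bar>h p\<bar>) \<le> H" and c: "c \<ge> 0" "c * L * H \<le> 1 / 2"
    and res: "\<And>q. q \<in> C \<Longrightarrow> \<bar>gn n q + l2_inner M (Kn n q) (F (\<lambda>p. u (P n p)) h) - u q\<bar> \<le> \<epsilon>"
    and q: "q \<in> C"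
  shows "\<bar>\<Upsilon>n n h q - u q\<bar> \<le> 2 * exp (\<beta> * T) * \<epsilon>"
proof -
  define v where "v = \<Upsilon>n n h"
  note hs = X_square_integrable[OF h]
  have v: "v \<in> Cspace C" and v_eq: "\<And>q. q \<in> C \<Longrightarrow> v q = gn n q + l2_inner M (Kn n q) (F (\<lambda>p. v (P n p)) h)"
    using \<Upsilon>n_solution[OF n h] by (auto simp: v_def)
  \<comment> \<open>The weighted error is continuous on a compact set, so its supremum
    \<open>A\<close> is attained and finite; this is what permits absorbing A/2 at the end.\<close>
  define e where "e q = exp (- \<beta> * fst q) * \<bar>v q - u q\<bar>" for q
  have "continuous_on C e"
    unfolding e_def[abs_def] by (intro continuous_intros continuous_on_Cspace_diff v u)
  then obtain q0 where q0: "q0 \<in> C" and max: "\<And>q. q \<in> C \<Longrightarrow> e q \<le> e q0"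
    using continuous_attains_sup[OF C_compact C_nonempty] by blast
  define A where "A = e q0"
  have A0: "0 \<le> A" by (simp add: A_def e_def)
  have e_eq: "\<bar>v q - u q\<bar> = exp (\<beta> * fst q) * e q" for q
    by (simp add: e_def exp_minus field_simps)
  let ?d = "\<lambda>p. F (\<lambda>p. v (P n p)) h p - F (\<lambda>p. u (P n p)) h p"
  let ?H = "\<lambda>p. 1 + \<bar>h p\<bar>"
  have Fv: "F (\<lambda>p. v (P n p)) h \<in> square_integrable M" and Fu: "F (\<lambda>p. u (P n p)) h \<in> square_integrable M"
    using n v u hs by (auto intro: F_P_Cspace)
  have d: "?d \<in> square_integrable M" by (rule square_integrable_diff[OF Fv Fu])
  have [measurable]: "?d \<in> borel_measurable M" using d by (rule square_integrable_measurable)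
  have weighted: "\<bar>exp (- \<beta> * fst p) * ?d p\<bar> \<le> \<bar>(A * L) * ?H p\<bar>" if p: "p \<in> space M" for p
  proof -
    have pS: "p \<in> S" using p by (simp add: space_M)
    \<comment> \<open>The discrete equation looks back to the grid time, which is not later than p;
      hence the weight there is dominated by the weight at p.\<close>
    have fl: "fst (P n p) \<le> fst p"
      using grid_floor_bounds(2)[of "fst p" T "m n"] m_pos[OF n] pS by (auto simp: P_def cyl_def)
    have "\<bar>v (P n p) - u (P n p)\<bar> = exp (\<beta> * fst (P n p)) * e (P n p)" by (rule e_eq)
    also have "\<dots> \<le> exp (\<beta> * fst p) * A"
      unfolding A_def using fl \<beta> max[OF P_in_C[OF n pS]] by (intro mult_mono) (auto simp: e_def)
    finally have le: "\<bar>v (P n p) - u (P n p)\<bar> \<le> exp (\<beta> * fst p) * A" .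
    have "\<bar>?d p\<bar> \<le> L * \<bar>v (P n p) - u (P n p)\<bar> * ?H p" by (rule F_diff_le)
    also have "\<dots> \<le> L * (exp (\<beta> * fst p) * A) * ?H p"
      using le L_nonneg by (intro mult_right_mono mult_left_mono) auto
    finally have "exp (- \<beta> * fst p) * \<bar>?d p\<bar> \<le> exp (- \<beta> * fst p) * (L * (exp (\<beta> * fst p) * A) * ?H p)"
      by (intro mult_left_mono) auto
    also have "\<dots> = (A * L) * ?H p" by (simp add: exp_minus field_simps)
    finally show ?thesis by (simp add: abs_mult A0 L_nonneg)
  qed
  have norm_d: "l2_norm M (\<lambda>p. exp (- \<beta> * fst p) * ?d p) \<le> A * L * H"
    and sq_d: "(\<lambda>p. exp (- \<beta> * fst p) * ?d p) \<in> square_integrable M"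
  proof -
    note sqH = square_integrable_cmult[OF one_plus_abs(1)[OF hs], of "A * L"]
    have ae: "AE p in M. \<bar>exp (- \<beta> * fst p) * ?d p\<bar> \<le> \<bar>(A * L) * ?H p\<bar>" using weighted by (rule AE_I2)
    have meas: "(\<lambda>p. exp (- \<beta> * fst p) * ?d p) \<in> borel_measurable M" by measurable
    show "(\<lambda>p. exp (- \<beta> * fst p) * ?d p) \<in> square_integrable M"
      by (rule square_integrable_bound[OF sqH meas ae])
    have "l2_norm M (\<lambda>p. exp (- \<beta> * fst p) * ?d p) \<le> l2_norm M (\<lambda>p. (A * L) * ?H p)"
      by (rule l2_norm_mono[OF sqH meas ae])
    also have "\<dots> = \<bar>A * L\<bar> * l2_norm M ?H" by (rule l2_norm_cmult)
    also have "\<dots> \<le> A * L * H" using H A0 L_nonneg by (simp add: mult_left_mono)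
    finally show "l2_norm M (\<lambda>p. exp (- \<beta> * fst p) * ?d p) \<le> A * L * H" .
  qed
  have bound: "e q \<le> \<epsilon> + A / 2" if q: "q \<in> C" for q
  proof -
    have "v q - u q = (gn n q + l2_inner M (Kn n q) (F (\<lambda>p. u (P n p)) h) - u q) + l2_inner M (Kn n q) ?d"
      using v_eq[OF q] l2_inner_diff_right[OF Kn_square_integrable[OF n q] Fv Fu] by simp
    then have "\<bar>v q - u q\<bar> \<le> \<epsilon> + \<bar>l2_inner M (Kn n q) ?d\<bar>"
      using res[OF q] by linarith
    \<comment> \<open>The weight is inserted with both signs: the growing factor goes to the kernel,
      the decaying one to the error.\<close>
    also have "l2_inner M (Kn n q) ?d = l2_inner M (\<lambda>p. Kn n q p * exp (\<beta> * fst p)) (\<lambda>p. exp (- \<beta> * fst p) * ?d p)"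
      unfolding l2_inner_def by (rule Bochner_Integration.integral_cong[OF refl]) (simp add: exp_minus field_simps)
    also have "\<bar>\<dots>\<bar> \<le> l2_norm M (\<lambda>p. Kn n q p * exp (\<beta> * fst p)) * l2_norm M (\<lambda>p. exp (- \<beta> * fst p) * ?d p)"
      by (rule abs_l2_inner_le[OF Kw(1)[OF q] sq_d])
    also have "\<dots> \<le> c * exp (\<beta> * fst q) * (A * L * H)"
      by (rule mult_mono[OF Kw(2)[OF q] norm_d]) (use c(1) in \<open>auto simp: l2_norm_nonneg\<close>)
    also have "\<dots> = exp (\<beta> * fst q) * (A * (c * L * H))" by (simp add: mult_ac)
    also have "\<dots> \<le> exp (\<beta> * fst q) * (A * (1 / 2))"
      using c(2) A0 by (intro mult_left_mono) auto
    finally have "\<bar>v q - u q\<bar> \<le> \<epsilon> + exp (\<beta> * fst q) * (A / 2)" by simp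
    then have "e q \<le> exp (- \<beta> * fst q) * (\<epsilon> + exp (\<beta> * fst q) * (A / 2))"
      unfolding e_def by (intro mult_left_mono) auto
    also have "\<dots> = exp (- \<beta> * fst q) * \<epsilon> + A / 2"
      by (simp add: exp_minus field_simps)
    also have "\<dots> \<le> \<epsilon> + A / 2"
    proof -
      have "0 \<le> \<epsilon>" using res[OF q] by linarith
      moreover have "exp (- \<beta> * fst q) \<le> 1" using q \<beta> by (auto simp: ccyl_def)
      ultimately show ?thesis by (simp add: mult_right_le_one_le mult_left_le_one_le)
    qed
    finally show ?thesis .
  qed
  \<comment> \<open>At the maximum point the bound reads A <= \<epsilon> + A/2.\<close>
  have A: "A \<le> 2 * \<epsilon>" using bound[OF q0] by (simp add: A_def)
  have "\<bar>v q - u q\<bar> = exp (\<beta> * fst q) * e q" by (rule e_eq)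
  also have "\<dots> \<le> exp (\<beta> * T) * (2 * \<epsilon>)"
    using max[OF q] A q \<beta> by (intro mult_mono) (auto simp: A_def e_def ccyl_def)
  finally show ?thesis by (simp add: v_def)
qed

section \<open>Consistency and convergence of the discrete solutions\<close>

lemma P_uniformly_close:
  assumes "d > 0"
  shows "\<forall>\<^sub>F n in sequentially. \<forall>p\<in>S. dist (P n p) p < d"
proof -
  have "(\<lambda>n. T / real (m n)) \<longlonglongrightarrow> 0"
    by (intro tendsto_divide_0[OF tendsto_const] filterlim_at_top_imp_at_infinity
        filterlim_compose[OF filterlim_real_sequentially m_lim])
  then have "\<forall>\<^sub>F n in sequentially. T / real (m n) < d / 2"
    by (rule order_tendstoD) (use assms in simp)
  moreover have "\<forall>\<^sub>F n in sequentially. (SUP z\<in>D. norm (z - \<kappa> n z)) < d / 2"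
    using \<kappa>_lim by (rule order_tendstoD) (use assms in simp)
  moreover have "\<forall>\<^sub>F n in sequentially. n \<ge> (1::nat)" by (rule eventually_ge_at_top)
  ultimately show ?thesis
  proof eventually_elim
    case (elim n)
    show ?case
    proof
      fix p assume p: "p \<in> S"
      obtain s z where sz: "p = (s, z)" "0 < s" "s < T" "z \<in> D" using p by (auto simp: cyl_def)
      obtain R where R: "\<And>y. y \<in> closure D \<Longrightarrow> norm y \<le> R"
        using bounded_closure[OF D_bounded] by (auto simp: bounded_iff)
      \<comment> \<open>A real supremum dominates its members only if they are bounded above;
        boundedness of \<open>D\<close> provides this.\<close>
      have "norm (y - \<kappa> n y) \<le> R + R" if "y \<in> D" for y
        using norm_triangle_ineq4[of y "\<kappa> n y"] R[of y] R[of "\<kappa> n y"] \<kappa>_range[OF elim(3) that] that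
          closure_subset by fastforce
      then have "bdd_above ((\<lambda>z. norm (z - \<kappa> n z)) ` D)" by (rule bdd_aboveI2)
      then have "norm (z - \<kappa> n z) \<le> (SUP z\<in>D. norm (z - \<kappa> n z))"
        using sz by (intro cSUP_upper) auto
      then have k: "dist (\<kappa> n z) z < d / 2" using elim(2) by (simp add: dist_norm norm_minus_commute)
      have t: "dist (grid_floor T (m n) s) s < d / 2"
        using grid_floor_bounds[of s T "m n"] sz m_pos[OF elim(3)] elim(1) unfolding dist_real_def by linarith
      have "dist (P n p) p \<le> dist (grid_floor T (m n) s) s + dist (\<kappa> n z) z"
        unfolding P_def sz dist_Pair_Pair fst_conv snd_conv
        by (rule sqrt_sum_squares_le_sum) auto
      then show "dist (P n p) p < d" using k t by simp
    qed
  qed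
qed

lemma comp_P_uniform_limit:
  assumes u: "u \<in> Cspace C" and e: "e > 0"
  shows "\<forall>\<^sub>F n in sequentially. \<forall>p\<in>S. \<bar>u (P n p) - u p\<bar> \<le> e"
proof -
  have "uniformly_continuous_on C u"
    using u C_compact by (intro compact_uniformly_continuous) (auto simp: Cspace_def)
  then obtain d where d: "d > 0" "\<And>p q. p \<in> C \<Longrightarrow> q \<in> C \<Longrightarrow> dist q p < d \<Longrightarrow> dist (u q) (u p) < e"
    using e unfolding uniformly_continuous_on_def by metis
  have "\<forall>\<^sub>F n in sequentially. n \<ge> (1::nat)" by (rule eventually_ge_at_top)
  with P_uniformly_close[OF d(1)] show ?thesis
  proof eventually_elim
    case (elim n)
    show ?case
    proof
      fix p assume p: "p \<in> S"
      have "dist (u (P n p)) (u p) < e"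
        using d(2)[OF S_sub[OF p] P_in_C[OF elim(2) p]] elim(1) p by blast
      then show "\<bar>u (P n p) - u p\<bar> \<le> e" by (simp add: dist_real_def)
    qed
  qed
qed

end

lemma mesh_functions_convex_combination:
  assumes "open D" "f \<in> mesh_functions T D m \<T>" "h \<in> mesh_functions T D m \<T>"
  shows "(\<lambda>p. a * f p + c * h p) \<in> mesh_functions T D m \<T>"
proof -
  note eq = L2_eq_square_integrable[OF cyl_borel[OF assms(1)], of T]
  have "(\<lambda>p. a * f p + c * h p) \<in> L2 (cyl T D)"
    unfolding eq using assms by (intro square_integrable_add square_integrable_cmult)
      (auto simp: mesh_functions_def eq)
  moreover have "(\<lambda>p. a * f p + c * h p) constant_on A" if "f constant_on A" "h constant_on A" for A
    using that unfolding constant_on_def by metis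
  ultimately show ?thesis using assms by (simp add: mesh_functions_def)
qed

context skeleton_scheme
begin

text \<open>The limit u is inserted into the discrete equation with control \<open>h i\<close>. The
  residual consists of four terms: the data error, the kernel error, the error of evaluating u at
  grid points, and the pairing of a fixed compact family of kernels with \<open>h i - w\<close>.
  Stability turns a small residual into a small error.\<close>

lemma \<Upsilon>n_tendsto:
  assumes k: "filterlim k at_top sequentially" "\<And>i. k i \<ge> 1"
    and h: "\<And>i. h i \<in> X (k i)" and B: "\<And>i. l2_norm M (h i) \<le> B"
    and w: "w \<in> square_integrable M" and lim: "l2_weak_limit M h w"
  shows "(\<lambda>i. sup_norm C (\<lambda>p. \<Upsilon>n (k i) (h i) p - \<Upsilon> w p)) \<longlonglongrightarrow> 0"
proof -
  define u where "u = \<Upsilon> w"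
  have u: "u \<in> Cspace C" and u_eq: "\<And>q. q \<in> C \<Longrightarrow> u q = g q + l2_inner M (K q) (F u w)"
    using \<Upsilon>_solution[OF w] by (auto simp: u_def)
  have hs: "h i \<in> square_integrable M" for i using h X_square_integrable by blast
  define H where "H = l2_norm M (\<lambda>p. 1) + B + 1"
  have "0 \<le> B" using l2_norm_nonneg[of M "h 0"] B[of 0] by linarith
  then have H: "H > 0" using l2_norm_nonneg[of M "\<lambda>p. 1"] by (simp add: H_def)
  have hH: "l2_norm M (\<lambda>p. 1 + \<bar>h i p\<bar>) \<le> H" for i
    using one_plus_abs(2)[OF hs[of i]] B[of i] by (simp add: H_def)
  \<comment> \<open>Then c L H <= 1/2, as the contraction requires, also when L = 0.\<close>
  define c where "c = 1 / (2 * (L * H + 1))"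
  have LH: "L * H \<ge> 0" using L_nonneg H by simp
  then have c: "c > 0" "c * L * H \<le> 1 / 2" by (auto simp: c_def divide_simps)
  obtain \<beta> where \<beta>: "\<beta> > 0"
    and Kw: "\<And>n q. n \<ge> 1 \<Longrightarrow> q \<in> C \<Longrightarrow> (\<lambda>p. Kn n q p * exp (\<beta> * fst p)) \<in> square_integrable M"
      "\<And>n q. n \<ge> 1 \<Longrightarrow> q \<in> C \<Longrightarrow> l2_norm M (\<lambda>p. Kn n q p * exp (\<beta> * fst p)) \<le> c * exp (\<beta> * fst q)"
    using Kn_weighted_norm[OF c(1)] by blast
  obtain R where R: "R > 0" and K: "\<And>q. q \<in> C \<Longrightarrow> K q \<in> square_integrable M"
      "\<And>q. q \<in> C \<Longrightarrow> l2_norm M (K q) \<le> R"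
    using K_bounded by blast
  obtain Ru where Ru: "\<And>p. p \<in> C \<Longrightarrow> \<bar>u p\<bar> \<le> Ru" using bounded_Cspace[OF D_bounded u] by blast
  obtain B1 B2 where B12: "B1 > 0" "\<And>r. \<bar>r\<bar> \<le> Ru \<Longrightarrow> \<bar>b r\<bar> \<le> B1" "B2 > 0" "\<And>r. \<bar>r\<bar> \<le> Ru \<Longrightarrow> \<bar>\<sigma> r\<bar> \<le> B2"
    using bounded_image_continuous[OF b_cont] bounded_image_continuous[OF \<sigma>_cont] by metis
  define Bu where "Bu = B1 + B2"
  have Bu: "Bu > 0" and bu: "\<And>p. p \<in> C \<Longrightarrow> \<bar>b (u p)\<bar> \<le> Bu" and \<sigma>u: "\<And>p. p \<in> C \<Longrightarrow> \<bar>\<sigma> (u p)\<bar> \<le> Bu"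
    using B12 Ru by (fastforce simp: Bu_def intro: add_increasing add_increasing2)+
  \<comment> \<open>Moving the multiplier \<sigma>(u) to the kernel yields a family that is
    independent of i and inherits equicontinuity from \<open>K\<close>.\<close>
  define \<psi> where "\<psi> q = (\<lambda>p. \<sigma> (u p) * K q p)" for q
  have \<sigma>u_meas: "(\<lambda>p. \<sigma> (u p)) \<in> borel_measurable M"
    using Cspace_measurable_M[OF u] by measurable
  have \<sigma>u_mult: "(\<lambda>p. \<sigma> (u p) * f p) \<in> square_integrable M"
    "l2_norm M (\<lambda>p. \<sigma> (u p) * f p) \<le> Bu * l2_norm M f" if f: "f \<in> square_integrable M" for f
  proof -
    show sq: "(\<lambda>p. \<sigma> (u p) * f p) \<in> square_integrable M"
      by (rule square_integrable_bounded_mult[OF f \<sigma>u_meas]) (use \<sigma>u S_sub in \<open>auto simp: space_M\<close>)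
    have "l2_norm M (\<lambda>p. \<sigma> (u p) * f p) \<le> l2_norm M (\<lambda>p. Bu * f p)"
    proof (rule l2_norm_mono[OF square_integrable_cmult[OF f]])
      show "(\<lambda>p. \<sigma> (u p) * f p) \<in> borel_measurable M" using sq by (rule square_integrable_measurable)
      show "AE p in M. \<bar>\<sigma> (u p) * f p\<bar> \<le> \<bar>Bu * f p\<bar>"
        using \<sigma>u S_sub Bu by (intro AE_I2) (auto simp: space_M abs_mult intro!: mult_right_mono)
    qed
    then show "l2_norm M (\<lambda>p. \<sigma> (u p) * f p) \<le> Bu * l2_norm M f"
      using Bu by (simp add: l2_norm_cmult)
  qed
  have \<psi>_equi: "\<exists>d>0. \<forall>q\<in>C. \<forall>q'\<in>C. dist q q' < d \<longrightarrow> l2_norm M (\<lambda>p. \<psi> q p - \<psi> q' p) < e"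
    if e: "e > 0" for e
  proof -
    obtain d where d: "d > 0" "\<And>q q'. q \<in> C \<Longrightarrow> q' \<in> C \<Longrightarrow> dist q q' < d \<Longrightarrow> l2_norm M (\<lambda>p. K q p - K q' p) < e / Bu"
      using K_equicontinuous[OF divide_pos_pos[OF e Bu]] by blast
    have "l2_norm M (\<lambda>p. \<psi> q p - \<psi> q' p) < e" if q: "q \<in> C" "q' \<in> C" "dist q q' < d" for q q'
    proof -
      have "l2_norm M (\<lambda>p. \<psi> q p - \<psi> q' p) \<le> Bu * l2_norm M (\<lambda>p. K q p - K q' p)"
        using \<sigma>u_mult(2)[OF square_integrable_diff[OF K(1)[OF q(1)] K(1)[OF q(2)]]]
        by (simp add: \<psi>_def right_diff_distrib)
      also have "\<dots> < Bu * (e / Bu)" using d(2)[OF q] Bu by (intro mult_strict_left_mono) auto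
      finally show ?thesis using Bu by simp
    qed
    with d(1) show ?thesis by blast
  qed
  show ?thesis
  proof (rule tendstoI)
    fix e :: real assume e: "e > 0"
    \<comment> \<open>Four residual terms of size \<epsilon>, amplified by 2 exp(\<beta> T), amount
      to e/2.\<close>
    define \<epsilon> where "\<epsilon> = e / (16 * exp (\<beta> * T))"
    have \<epsilon>: "\<epsilon> > 0" using e by (simp add: \<epsilon>_def)
    note ev = eventually_compose_filterlim[OF _ k(1)]
    have "\<forall>\<^sub>F i in sequentially. sup_norm C (\<lambda>p. gn (k i) p - g p) < \<epsilon>"
      by (rule ev) (rule order_tendstoD(2)[OF gn_lim \<epsilon>])
    moreover have "\<forall>\<^sub>F i in sequentially. \<forall>q\<in>C. l2_norm M (\<lambda>p. Kn (k i) q p - K q p) \<le> \<epsilon> / (Bu * H)"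
      by (rule ev) (rule Kn_tendsto_K, use \<epsilon> Bu H in simp)
    \<comment> \<open>The divisor collects the kernel norm R, the Lipschitz constant and the
      envelope norm H; L + 1 keeps it positive.\<close>
    moreover have "\<forall>\<^sub>F i in sequentially. \<forall>p\<in>S. \<bar>u (P (k i) p) - u p\<bar> \<le> \<epsilon> / (R * (L + 1) * H)"
      by (rule ev) (rule comp_P_uniform_limit[OF u], use \<epsilon> R L_nonneg H in simp)
    moreover have "\<forall>\<^sub>F i in sequentially. \<forall>q\<in>C. \<bar>l2_inner M (\<psi> q) (\<lambda>p. h i p - w p)\<bar> < \<epsilon>"
    proof (rule l2_weak_limit_uniform[OF C_compact _ \<psi>_equi hs B w lim \<epsilon>])
      show "\<psi> q \<in> square_integrable M" if "q \<in> C" for q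
        unfolding \<psi>_def by (rule \<sigma>u_mult(1)[OF K(1)[OF that]])
    qed
    ultimately show "\<forall>\<^sub>F i in sequentially. dist (sup_norm C (\<lambda>p. \<Upsilon>n (k i) (h i) p - \<Upsilon> w p)) 0 < e"
    proof eventually_elim
      case (elim i)
      define n where "n = k i"
      have n: "n \<ge> 1" using k(2) by (simp add: n_def)
      have hX: "h i \<in> X n" using h by (simp add: n_def)
      define FP where "FP = F (\<lambda>p. u (P n p)) (h i)"
      have FP: "FP \<in> square_integrable M" unfolding FP_def by (rule F_P_Cspace[OF n u hs])
      have Fh: "F u (h i) \<in> square_integrable M" and Fw: "F u w \<in> square_integrable M"
        using F_Cspace[OF u] hs w by auto
      note sqH = one_plus_abs(1)[OF hs[of i]]
      have FP_norm: "l2_norm M FP \<le> Bu * H"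
      proof -
        have "l2_norm M FP \<le> l2_norm M (\<lambda>p. Bu * (1 + \<bar>h i p\<bar>))"
        proof (rule l2_norm_mono[OF square_integrable_cmult[OF sqH] square_integrable_measurable[OF FP]], rule AE_I2)
          fix p assume "p \<in> space M"
          then have PC: "P n p \<in> C" using P_in_C[OF n] by (simp add: space_M)
          have "\<bar>FP p\<bar> \<le> \<bar>b (u (P n p))\<bar> + \<bar>\<sigma> (u (P n p))\<bar> * \<bar>h i p\<bar>"
            unfolding FP_def F_def abs_mult[symmetric] by (rule abs_triangle_ineq)
          also have "\<dots> \<le> Bu + Bu * \<bar>h i p\<bar>"
            using bu[OF PC] \<sigma>u[OF PC] by (intro add_mono mult_right_mono) auto
          finally show "\<bar>FP p\<bar> \<le> \<bar>Bu * (1 + \<bar>h i p\<bar>)\<bar>" using Bu by (simp add: distrib_left)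
        qed
        also have "\<dots> = Bu * l2_norm M (\<lambda>p. 1 + \<bar>h i p\<bar>)" using Bu by (simp add: l2_norm_cmult)
        also have "\<dots> \<le> Bu * H" using Bu hH by (intro mult_left_mono) auto
        finally show ?thesis .
      qed
      have diff_norm: "l2_norm M (\<lambda>p. FP p - F u (h i) p) \<le> \<epsilon> / R"
      proof -
        define y where "y = \<epsilon> / (R * (L + 1) * H)"
        have y: "y \<ge> 0" using \<epsilon> R L_nonneg H by (simp add: y_def)
        have "l2_norm M (\<lambda>p. FP p - F u (h i) p) \<le> l2_norm M (\<lambda>p. (L * y) * (1 + \<bar>h i p\<bar>))"
        proof (rule l2_norm_mono[OF square_integrable_cmult[OF sqH]], rule square_integrable_measurable, rule square_integrable_diff[OF FP Fh], rule AE_I2)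
          fix p assume "p \<in> space M"
          then have "\<bar>u (P n p) - u p\<bar> \<le> y" using elim(3) by (simp add: space_M n_def y_def)
          then have "L * \<bar>u (P n p) - u p\<bar> * (1 + \<bar>h i p\<bar>) \<le> L * y * (1 + \<bar>h i p\<bar>)"
            using L_nonneg by (intro mult_right_mono mult_left_mono) auto
          with F_diff_le[of "\<lambda>p. u (P n p)" "h i" p u]
          have "\<bar>FP p - F u (h i) p\<bar> \<le> L * y * (1 + \<bar>h i p\<bar>)" unfolding FP_def by (rule order_trans)
          then show "\<bar>FP p - F u (h i) p\<bar> \<le> \<bar>L * y * (1 + \<bar>h i p\<bar>)\<bar>" by linarith
        qed
        also have "\<dots> = L * y * l2_norm M (\<lambda>p. 1 + \<bar>h i p\<bar>)" using y L_nonneg by (simp add: l2_norm_cmult)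
        also have "\<dots> \<le> (L + 1) * y * H" using y L_nonneg hH by (intro mult_mono) (auto simp: l2_norm_nonneg)
        also have "\<dots> = \<epsilon> / R"
        proof -
          have "a * (\<epsilon> / (R * a * H)) * H = \<epsilon> / R" if "a > 0" for a
            using that H by simp
          from this[of "L + 1"] show ?thesis using L_nonneg by (simp add: y_def)
        qed
        finally show ?thesis .
      qed
      have res: "\<bar>gn n q + l2_inner M (Kn n q) FP - u q\<bar> \<le> 4 * \<epsilon>" if q: "q \<in> C" for q
      proof -
        note Knq = Kn_square_integrable[OF n q] and Kq = K(1)[OF q]
        have a1: "\<bar>gn n q - g q\<bar> \<le> \<epsilon>"
          using abs_le_sup_norm[OF C_compact continuous_on_Cspace_diff[OF gn_Cspace[OF n] g_Cspace] q] elim(1)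
          by (simp add: n_def)
        have "\<bar>l2_inner M (\<lambda>p. Kn n q p - K q p) FP\<bar> \<le> l2_norm M (\<lambda>p. Kn n q p - K q p) * l2_norm M FP"
          by (rule abs_l2_inner_le[OF square_integrable_diff[OF Knq Kq] FP])
        also have "\<dots> \<le> \<epsilon> / (Bu * H) * (Bu * H)"
          using elim(2) q FP_norm \<epsilon> Bu H by (intro mult_mono) (auto simp: n_def l2_norm_nonneg)
        also have "\<dots> = \<epsilon>" using Bu H by simp
        finally have a2: "\<bar>l2_inner M (Kn n q) FP - l2_inner M (K q) FP\<bar> \<le> \<epsilon>"
          by (simp add: l2_inner_diff_left[OF FP Knq Kq])
        have "\<bar>l2_inner M (K q) (\<lambda>p. FP p - F u (h i) p)\<bar> \<le> l2_norm M (K q) * l2_norm M (\<lambda>p. FP p - F u (h i) p)"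
          by (rule abs_l2_inner_le[OF Kq square_integrable_diff[OF FP Fh]])
        also have "\<dots> \<le> R * (\<epsilon> / R)"
          using K(2)[OF q] diff_norm R by (intro mult_mono) (auto simp: l2_norm_nonneg)
        also have "\<dots> = \<epsilon>" using R by simp
        finally have a3: "\<bar>l2_inner M (K q) FP - l2_inner M (K q) (F u (h i))\<bar> \<le> \<epsilon>"
          by (simp add: l2_inner_diff_right[OF Kq FP Fh])
        \<comment> \<open>The b-terms cancel because both integrands use the same state u; what
          remains is linear in the control, so weak convergence is enough.\<close>
        have "l2_inner M (K q) (\<lambda>p. F u (h i) p - F u w p) = l2_inner M (\<psi> q) (\<lambda>p. h i p - w p)"
          unfolding l2_inner_def
          by (rule Bochner_Integration.integral_cong[OF refl]) (simp add: F_def \<psi>_def algebra_simps)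
        then have a4: "\<bar>l2_inner M (K q) (F u (h i)) - l2_inner M (K q) (F u w)\<bar> \<le> \<epsilon>"
          using elim(4) q by (simp add: l2_inner_diff_right[OF Kq Fh Fw] less_imp_le)
        show ?thesis using a1 a2 a3 a4 u_eq[OF q] by linarith
      qed
      have "\<bar>\<Upsilon>n n (h i) q - u q\<bar> \<le> 2 * exp (\<beta> * T) * (4 * \<epsilon>)" if q: "q \<in> C" for q
        by (rule discrete_stability[OF n hX u \<beta> Kw[OF n] hH _ c(2) _ q])
          (use c(1) res in \<open>auto simp: FP_def\<close>)
      then have "sup_norm C (\<lambda>p. \<Upsilon>n n (h i) p - u p) \<le> 2 * exp (\<beta> * T) * (4 * \<epsilon>)"
        by (intro sup_norm_le C_nonempty)
      also have "\<dots> < e" using e by (simp add: \<epsilon>_def)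
      finally show ?case
        using sup_norm_nonneg[OF \<Upsilon>n_solution(1)[OF n hX] u] by (simp add: n_def u_def)
    qed
  qed
qed

lemma \<Upsilon>n_tendsto_pointwise:
  assumes k: "\<And>i. k i \<ge> 1" and h: "\<And>i. h i \<in> X (k i)" and w: "w \<in> square_integrable M"
    and lim: "(\<lambda>i. sup_norm C (\<lambda>p. \<Upsilon>n (k i) (h i) p - \<Upsilon> w p)) \<longlonglongrightarrow> 0" and q: "q \<in> C"
  shows "(\<lambda>i. \<Upsilon>n (k i) (h i) q) \<longlonglongrightarrow> \<Upsilon> w q"
proof -
  have "\<bar>\<Upsilon>n (k i) (h i) q - \<Upsilon> w q\<bar> \<le> sup_norm C (\<lambda>p. \<Upsilon>n (k i) (h i) p - \<Upsilon> w p)" for i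
    by (rule abs_le_sup_norm[OF C_compact continuous_on_Cspace_diff[OF \<Upsilon>n_solution(1)[OF k h] \<Upsilon>_solution(1)[OF w]] q])
  then have "(\<lambda>i. \<Upsilon>n (k i) (h i) q - \<Upsilon> w q) \<longlonglongrightarrow> 0"
    by (intro Lim_null_comparison[OF _ lim]) simp
  then show ?thesis by (simp add: LIM_zero_iff)
qed

end

locale skeleton_approximation = skeleton_scheme T D G g b \<sigma> L m \<T> \<kappa> Gn gn
  for T :: real and D :: "'a::euclidean_space set"
    and G g b \<sigma> L m \<T> \<kappa> Gn gn +
  fixes x0 :: 'a and Q :: "nat \<Rightarrow> (real \<times> 'a \<Rightarrow> real) \<Rightarrow> (real \<times> 'a \<Rightarrow> real)"
  assumes x0: "x0 \<in> D"
    and \<sigma>_nonzero: "\<And>r. \<sigma> r \<noteq> 0"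
    and \<Upsilon>n_continuous: "\<And>n h e. n \<ge> 1 \<Longrightarrow> h \<in> X n \<Longrightarrow> e > 0 \<Longrightarrow> \<exists>d>0. \<forall>h'\<in>X n.
           L2_norm_on S (\<lambda>p. h' p - h p) < d \<longrightarrow> sup_norm C (\<lambda>p. \<Upsilon>n n h' p - \<Upsilon>n n h p) < e"
    and G_nondegenerate: "(\<integral>\<^sup>+s\<in>{0<..<T}. (\<integral>\<^sup>+z\<in>D. ennreal (\<bar>G (T - s) x0 z\<bar>\<^sup>2) \<partial>lborel) \<partial>lborel) > 0"
    and Q_range: "\<And>n h. n \<ge> 1 \<Longrightarrow> h \<in> L2 S \<Longrightarrow> Q n h \<in> X n"
    and Q_lim: "\<And>h. h \<in> L2 S \<Longrightarrow> (\<lambda>n. L2_norm_on S (\<lambda>p. Q n h p - h p)) \<longlonglongrightarrow> 0"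
begin

section \<open>Weak compactness and perturbation of controls\<close>

lemma p0_in_C: "(T, x0) \<in> C"
  using x0 T_pos closure_subset by (auto simp: ccyl_def)

text \<open>The test set \<open>E\<close> consists of the indicators of all cells of all meshes. It
  is countable, and its span is dense because \<open>Q n \<phi>\<close> lies in it and converges to
  \<open>\<phi>\<close>.\<close>

lemma weak_compactness:
  assumes h: "\<And>i. h i \<in> square_integrable M" and B: "\<And>i. l2_norm M (h i) \<le> B"
  obtains r :: "nat \<Rightarrow> nat" and w
  where "strict_mono r" "w \<in> square_integrable M" "l2_weak_limit M (\<lambda>i. h (r i)) w"
proof -
  define cell where "cell n = (\<lambda>(j, A). indicator ({grid_time T (m n) j..<grid_time T (m n) (Suc j)} \<times> A)
    :: real \<times> 'a \<Rightarrow> real)" for n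
  define E where "E = (\<Union>n\<in>{1..}. cell n ` ({..<m n} \<times> \<T> n))"
  have fin: "finite ({..<m n} \<times> \<T> n)" if "n \<ge> 1" for n
    using mesh[OF that] by (simp add: finite_mesh_def)
  show thesis
  proof (rule M.l2_weakly_compact[OF h B, of E])
    show "countable E"
      unfolding E_def by (rule countable_UN) (auto intro!: countable_finite finite_imageI fin)
    show "E \<subseteq> square_integrable M"
      unfolding E_def cell_def
      using mesh mesh_functions_cell_indicator_square_integrable[OF D_open D_bounded] by fastforce
  next
    fix \<phi> e assume \<phi>: "\<phi> \<in> square_integrable M" and e: "(e::real) > 0"
    have "\<forall>\<^sub>F n in sequentially. l2_norm M (\<lambda>p. Q n \<phi> p - \<phi> p) < e"
      using order_tendstoD(2)[OF Q_lim e] \<phi> by (simp add: L2_eq L2_norm_eq)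
    then have "\<forall>\<^sub>F n in sequentially. l2_norm M (\<lambda>p. Q n \<phi> p - \<phi> p) < e \<and> n \<ge> 1"
      by (intro eventually_conj eventually_ge_at_top)
    then obtain n where n: "l2_norm M (\<lambda>p. Q n \<phi> p - \<phi> p) < e" "n \<ge> 1"
      using eventually_happens' sequentially_bot by blast
    have QX: "Q n \<phi> \<in> X n" using Q_range[OF n(2)] \<phi> by (simp add: L2_eq)
    let ?J = "{..<m n} \<times> \<T> n"
    obtain c where c: "\<And>p. p \<in> S \<Longrightarrow> Q n \<phi> p = (\<Sum>(j, A)\<in>?J. c j A *
        indicator ({grid_time T (m n) j..<grid_time T (m n) (Suc j)} \<times> A) p)"
      using mesh_functions_sum[OF QX mesh[OF n(2)] m_pos[OF n(2)]] by blast
    \<comment> \<open>\<open>E\<close> is a set of functions, not of index pairs, so the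
      coefficients of all pairs with the same indicator are added up.\<close>
    define a where "a f = (\<Sum>y\<in>{y \<in> ?J. cell n y = f}. case_prod c y)" for f
    have "Q n \<phi> p = (\<Sum>f\<in>cell n ` ?J. a f * f p)" if "p \<in> S" for p
    proof -
      have "Q n \<phi> p = (\<Sum>y\<in>?J. case_prod c y * cell n y p)"
        unfolding c[OF that] by (rule sum.cong) (auto simp: cell_def)
      also have "\<dots> = (\<Sum>f\<in>cell n ` ?J. \<Sum>y\<in>{y \<in> ?J. cell n y = f}. case_prod c y * cell n y p)"
        by (rule sum.image_gen[OF fin[OF n(2)]])
      also have "\<dots> = (\<Sum>f\<in>cell n ` ?J. a f * f p)"
        unfolding a_def sum_distrib_right by (intro sum.cong refl) auto
      finally show ?thesis .
    qed
    moreover have "cell n ` ?J \<subseteq> E" using n(2) by (auto simp: E_def)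
    moreover have "l2_norm M (\<lambda>p. \<phi> p - Q n \<phi> p) < e"
      using n(1) by (subst l2_norm_minus_commute)
    ultimately show "\<exists>\<psi> F a. \<psi> \<in> square_integrable M \<and> l2_norm M (\<lambda>x. \<phi> x - \<psi> x) < e \<and> F \<subseteq> E \<and>
        (\<forall>x\<in>space M. \<psi> x = (\<Sum>f\<in>F. a f * f x))"
      using X_square_integrable[OF QX] unfolding space_M by blast
  qed (rule that)
qed

text \<open>Since \<open>\<sigma>\<close> does not vanish, adding \<open>l * \<langle>K q, K (T, x0)\<rangle>\<close> to a solution gives the solution of a
  modified control, obtained by solving the integrand for the control.\<close>

lemma control_perturbation:
  assumes h: "h \<in> square_integrable M" and e: "e > 0" and s: "\<bar>s\<bar> = 1"
  obtains h' where "h' \<in> square_integrable M" "l2_norm M (\<lambda>p. h' p - h p) < e"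
    "s * (\<Upsilon> h' (T, x0) - \<Upsilon> h (T, x0)) > 0"
proof -
  define u where "u = \<Upsilon> h"
  have u: "u \<in> Cspace C" and u_eq: "\<And>q. q \<in> C \<Longrightarrow> u q = g q + l2_inner M (K q) (F u h)"
    using \<Upsilon>_solution[OF h] by (auto simp: u_def)
  define \<phi> where "\<phi> = K (T, x0)"
  have \<phi>: "\<phi> \<in> square_integrable M" unfolding \<phi>_def by (rule K_square_integrable[OF p0_in_C])
  \<comment> \<open>This is the nondegeneracy hypothesis; it will be the speed at which the endpoint
    moves with \<open>l\<close>.\<close>
  have \<phi>_pos: "(l2_norm M \<phi>)\<^sup>2 > 0"
  proof -
    let ?f = "\<lambda>p. ennreal (\<bar>G (T - fst p) x0 (snd p)\<bar>\<^sup>2)"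
    have eq: "(\<lambda>p. if fst p < T then ?f p else 0) = (\<lambda>p. ennreal ((\<phi> p)\<^sup>2))"
      by (auto simp: \<phi>_def K_def fun_eq_iff)
    have "(\<lambda>p. if fst p < T then ?f p else 0) \<in> borel_measurable M"
      unfolding eq using square_integrable_measurable[OF \<phi>] by measurable
    from nn_integral_iterated_cyl[OF D_open order_refl this]
    have "(\<integral>\<^sup>+p. ennreal ((\<phi> p)\<^sup>2) \<partial>M) > 0" using G_nondegenerate unfolding eq by simp
    then show ?thesis by (simp add: nn_integral_power2_eq[OF \<phi>])
  qed
  define v where "v q = l2_inner M (K q) \<phi>" for q
  have v_cont: "continuous_on C v"
    unfolding continuous_on_iff
  proof (intro ballI allI impI)
    fix q e' assume q: "q \<in> C" and e': "(e'::real) > 0"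
    have n0: "l2_norm M \<phi> > 0" using \<phi>_pos l2_norm_nonneg[of M \<phi>] by (cases "l2_norm M \<phi> = 0") auto
    obtain d where d: "d > 0" "\<And>q q'. q \<in> C \<Longrightarrow> q' \<in> C \<Longrightarrow> dist q q' < d \<Longrightarrow>
        l2_norm M (\<lambda>p. K q p - K q' p) < e' / l2_norm M \<phi>"
      using K_equicontinuous[of "e' / l2_norm M \<phi>"] e' n0 by auto
    have "dist (v q') (v q) < e'" if q': "q' \<in> C" "dist q' q < d" for q'
    proof -
      have "\<bar>v q' - v q\<bar> \<le> l2_norm M (\<lambda>p. K q' p - K q p) * l2_norm M \<phi>"
        using abs_l2_inner_le[OF square_integrable_diff[OF K_square_integrable[OF q'(1)] K_square_integrable[OF q]] \<phi>]
        by (simp add: v_def l2_inner_diff_left[OF \<phi> K_square_integrable[OF q'(1)] K_square_integrable[OF q]])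
      also have "\<dots> < e' / l2_norm M \<phi> * l2_norm M \<phi>"
        using d(2)[OF q'(1) q q'(2)] n0 by (intro mult_strict_right_mono) auto
      finally show ?thesis using n0 by (simp add: dist_real_def)
    qed
    with d(1) show "\<exists>d>0. \<forall>q'\<in>C. dist q' q < d \<longrightarrow> dist (v q') (v q) < e'" by blast
  qed
  obtain Ru where Ru: "\<And>p. p \<in> C \<Longrightarrow> \<bar>u p\<bar> \<le> Ru" using bounded_Cspace[OF D_bounded u] by blast
  have "bounded (v ` C)" by (intro compact_imp_bounded compact_continuous_image v_cont C_compact)
  then obtain W where W: "W > 0" "\<And>p. p \<in> C \<Longrightarrow> \<bar>v p\<bar> \<le> W" by (auto simp: bounded_pos)
  \<comment> \<open>A nonvanishing \<sigma> need not be bounded away from 0 globally; it is so on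
    the compact range of the perturbed solutions.\<close>
  have inv_cont: "continuous_on UNIV (\<lambda>r. 1 / \<sigma> r)"
    using \<sigma>_nonzero by (intro continuous_intros \<sigma>_cont) auto
  obtain B where B: "B > 0" "\<And>r. \<bar>r\<bar> \<le> Ru + W \<Longrightarrow> \<bar>1 / \<sigma> r\<bar> \<le> B"
    using bounded_image_continuous[OF inv_cont] by blast
  \<comment> \<open>The cost of the perturbation per unit of |l|: the first term compensates the
    change of state in b and \<sigma>, the second adds the new forcing, and \<open>B\<close> bounds
    the division by \<sigma>.\<close>
  define c where "c = B * (L * W * l2_norm M (\<lambda>p. 1 + \<bar>h p\<bar>) + l2_norm M \<phi>)"
  have c: "c \<ge> 0" using B W L_nonneg by (simp add: c_def l2_norm_nonneg)
  \<comment> \<open>The cap 1 keeps the perturbed solution within Ru + W, where \<open>B\<close> is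
    valid; the second bound keeps the change of control below e. The sign s selects the
    direction.\<close>
  define l where "l = s * min 1 (e / (2 * (c + 1)))"
  have absl: "\<bar>l\<bar> = min 1 (e / (2 * (c + 1)))"
    using s e c by (simp add: l_def abs_mult)
  then have l1: "\<bar>l\<bar> \<le> 1" by simp
  have lc: "\<bar>l\<bar> * c < e"
  proof -
    have "\<bar>l\<bar> * c \<le> e / (2 * (c + 1)) * c" using absl c by (intro mult_right_mono) auto
    also have "\<dots> < e" using e c by (simp add: field_simps add_strict_increasing2)
    finally show ?thesis .
  qed
  define u' where "u' = restrict (\<lambda>q. u q + l * v q) C"
  have u': "u' \<in> Cspace C"
  proof -
    have "continuous_on C (\<lambda>q. u q + l * v q)"
      using u v_cont by (intro continuous_intros) (auto simp: Cspace_def)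
    then have "continuous_on C u'"
      by (rule continuous_on_eq) (simp add: u'_def)
    then show ?thesis by (simp add: Cspace_def u'_def)
  qed
  have u'_bound: "\<bar>u' p\<bar> \<le> Ru + W" if "p \<in> C" for p
  proof -
    have "\<bar>l * v p\<bar> \<le> 1 * W" unfolding abs_mult using l1 W(2)[OF that] by (intro mult_mono) auto
    then show ?thesis using Ru[OF that] that by (simp add: u'_def)
  qed
  \<comment> \<open>Solves \<open>F u' h' = F u h + l * \<phi>\<close> for the control. The factor 1
    only gives the b-term the shape of \<open>comp_square_integrable\<close>.\<close>
  define h' where "h' = (\<lambda>p. 1 / \<sigma> (u' p) * (F u h p + l * \<phi> p - b (u' p) * 1))"
  note inv_sq = comp_square_integrable[OF inv_cont Cspace_measurable_M[OF u'] u'_bound[OF S_sub]]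
  have h': "h' \<in> square_integrable M"
    unfolding h'_def
    by (intro inv_sq square_integrable_diff square_integrable_add square_integrable_cmult F_Cspace u h \<phi>
        comp_square_integrable[OF b_cont Cspace_measurable_M[OF u'] u'_bound[OF S_sub]] M.square_integrable_const)
  have F': "F u' h' p = F u h p + l * \<phi> p" for p
    using \<sigma>_nonzero[of "u' p"] by (simp add: F_def h'_def)
  have \<Upsilon>': "\<Upsilon> h' = u'"
  proof (rule \<Upsilon>_eqI[OF h' u'])
    fix q assume q: "q \<in> C"
    have "F u' h' = (\<lambda>p. F u h p + l * \<phi> p)" using F' by auto
    then have "l2_inner M (K q) (F u' h') = l2_inner M (K q) (F u h) + l * v q"
      using l2_inner_add_right[OF K_square_integrable[OF q] F_Cspace[OF u h] square_integrable_cmult[OF \<phi>, of l]]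
      by (simp add: l2_inner_cmult_right v_def)
    then show "u' q = g q + l2_inner M (K q) (F u' h')" using q u_eq[OF q] by (simp add: u'_def)
  qed
  have norm: "l2_norm M (\<lambda>p. h' p - h p) < e"
  proof -
    note sqH = one_plus_abs(1)[OF h]
    let ?k = "\<lambda>p. (\<bar>l\<bar> * B) * ((L * W) * (1 + \<bar>h p\<bar>) + \<bar>\<phi> p\<bar>)"
    have sq1: "(\<lambda>p. (L * W) * (1 + \<bar>h p\<bar>)) \<in> square_integrable M" by (rule square_integrable_cmult[OF sqH])
    have sqk: "?k \<in> square_integrable M"
      by (intro square_integrable_cmult square_integrable_add[OF sq1 square_integrable_abs[OF \<phi>]])
    have "l2_norm M (\<lambda>p. h' p - h p) \<le> l2_norm M ?k"
    proof (rule l2_norm_mono[OF sqk square_integrable_measurable[OF square_integrable_diff[OF h' h]]], rule AE_I2)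
      fix p assume "p \<in> space M"
      then have p: "p \<in> C" using S_sub by (simp add: space_M)
      \<comment> \<open>In this form both summands are of order l, the first by the Lipschitz bound
        for \<open>F\<close>.\<close>
      have "h' p - h p = 1 / \<sigma> (u' p) * ((F u h p - F u' h p) + l * \<phi> p)"
        using \<sigma>_nonzero[of "u' p"] by (simp add: h'_def F_def field_simps)
      then have "\<bar>h' p - h p\<bar> = \<bar>1 / \<sigma> (u' p)\<bar> * \<bar>(F u h p - F u' h p) + l * \<phi> p\<bar>"
        by (simp only: abs_mult)
      also have "\<dots> \<le> B * (\<bar>l\<bar> * ((L * W) * (1 + \<bar>h p\<bar>) + \<bar>\<phi> p\<bar>))"
      proof (intro mult_mono B(2) u'_bound p)
        have "\<bar>u p - u' p\<bar> = \<bar>l\<bar> * \<bar>v p\<bar>" using p by (simp add: u'_def abs_mult)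
        also have "\<dots> \<le> \<bar>l\<bar> * W" using W(2)[OF p] by (intro mult_left_mono) auto
        finally have "L * \<bar>u p - u' p\<bar> * (1 + \<bar>h p\<bar>) \<le> L * (\<bar>l\<bar> * W) * (1 + \<bar>h p\<bar>)"
          using L_nonneg by (intro mult_right_mono mult_left_mono) auto
        with F_diff_le[of u h p u'] have "\<bar>F u h p - F u' h p\<bar> \<le> L * (\<bar>l\<bar> * W) * (1 + \<bar>h p\<bar>)"
          by (rule order_trans)
        then have "\<bar>(F u h p - F u' h p) + l * \<phi> p\<bar> \<le> L * (\<bar>l\<bar> * W) * (1 + \<bar>h p\<bar>) + \<bar>l\<bar> * \<bar>\<phi> p\<bar>"
          unfolding abs_mult[symmetric] by (intro order_trans[OF abs_triangle_ineq] add_right_mono)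
        also have "\<dots> = \<bar>l\<bar> * ((L * W) * (1 + \<bar>h p\<bar>) + \<bar>\<phi> p\<bar>)" by (simp add: algebra_simps)
        finally show "\<bar>(F u h p - F u' h p) + l * \<phi> p\<bar> \<le> \<bar>l\<bar> * ((L * W) * (1 + \<bar>h p\<bar>) + \<bar>\<phi> p\<bar>)" .
      qed (use B in auto)
      also have "\<dots> = ?k p" by simp
      finally show "\<bar>h' p - h p\<bar> \<le> \<bar>?k p\<bar>" by linarith
    qed
    also have "\<dots> = \<bar>\<bar>l\<bar> * B\<bar> * l2_norm M (\<lambda>p. (L * W) * (1 + \<bar>h p\<bar>) + \<bar>\<phi> p\<bar>)" by (rule l2_norm_cmult)
    also have "\<dots> \<le> \<bar>\<bar>l\<bar> * B\<bar> * (l2_norm M (\<lambda>p. (L * W) * (1 + \<bar>h p\<bar>)) + l2_norm M (\<lambda>p. \<bar>\<phi> p\<bar>))"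
      by (intro mult_left_mono l2_norm_triangle[OF sq1 square_integrable_abs[OF \<phi>]]) auto
    also have "\<dots> = \<bar>l\<bar> * c"
    proof -
      have "l2_norm M (\<lambda>p. \<bar>\<phi> p\<bar>) = l2_norm M \<phi>" by (simp add: l2_norm_def)
      then show ?thesis
        unfolding l2_norm_cmult using B W L_nonneg by (simp add: c_def abs_mult)
    qed
    also have "\<dots> < e" by (rule lc)
    finally show ?thesis .
  qed
  have "s * (\<Upsilon> h' (T, x0) - \<Upsilon> h (T, x0)) = s * (l * (l2_norm M \<phi>)\<^sup>2)"
    using p0_in_C unfolding \<Upsilon>' u_def[symmetric]
    by (simp add: u'_def v_def \<phi>_def[symmetric] l2_inner_self)
  also have "\<dots> = (s * s) * (min 1 (e / (2 * (c + 1))) * (l2_norm M \<phi>)\<^sup>2)" by (simp add: l_def)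
  also have "s * s = 1" using s by (metis abs_mult_self_eq mult_1)
  finally have "s * (\<Upsilon> h' (T, x0) - \<Upsilon> h (T, x0)) > 0"
    using \<phi>_pos e c by simp
  with h' norm show thesis by (rule that)
qed

end

section \<open>Convergence of the rate functions\<close>

lemma C1_bounded_deriv_imp_lipschitz:
  fixes f :: "real \<Rightarrow> real"
  assumes "f C1_differentiable_on UNIV" "bounded (range (deriv f))"
  obtains L where "L \<ge> 0" "\<And>x y. \<bar>f x - f y\<bar> \<le> L * \<bar>x - y\<bar>"
proof -
  obtain L where L: "L > 0" "\<And>x. norm (deriv f x) \<le> L" using assms(2) by (auto simp: bounded_pos)
  have der: "(f has_field_derivative deriv f x) (at x)" for x
    using assms(1) DERIV_imp_deriv
    by (metis C1_differentiable_on_def UNIV_I has_real_derivative_iff_has_vector_derivative)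
  have "norm (f x - f y) \<le> L * norm (x - y)" for x y
    by (rule field_differentiable_bound[of UNIV f "deriv f"]) (use der L in auto)
  then show thesis using L(1) by (intro that[of L]) auto
qed

lemma tendsto_imp_bounded_above:
  fixes f :: "nat \<Rightarrow> real"
  assumes "f \<longlonglongrightarrow> a"
  obtains B where "\<And>i. f i \<le> B"
proof -
  have "Bseq f" using assms by (intro convergent_imp_Bseq convergentI)
  then obtain B where "\<forall>i. norm (f i) \<le> B" unfolding Bseq_def by blast
  then have "f i \<le> B" for i by (simp add: abs_le_iff)
  then show thesis by (rule that)
qed

section \<open>Elementary bounds for rate functions and the path functional\<close>

lemma rate_function_le:
  "h \<in> H \<Longrightarrow> \<Upsilon> h p = y \<Longrightarrow> rate_function S H \<Upsilon> p y \<le> ereal (1/2 * (L2_norm_on S h)\<^sup>2)"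
  unfolding rate_function_def by (rule Inf_lower) blast

lemma rate_function_lessE:
  assumes "rate_function S H \<Upsilon> p y < c"
  obtains h where "h \<in> H" "\<Upsilon> h p = y" "ereal (1/2 * (L2_norm_on S h)\<^sup>2) < c"
  using assms unfolding rate_function_def Inf_less_iff by blast

lemma rate_function_nonneg: "0 \<le> rate_function S H \<Upsilon> p y"
  unfolding rate_function_def by (rule Inf_greatest) auto

text \<open>Prescribing the path shrinks the set of admissible controls; the rate function is thus a
  lower bound for the functional at every path.\<close>

lemma rate_function_le_path_functional: "rate_function S H \<Upsilon> p y \<le> path_functional S H \<Upsilon> p y f"
  unfolding rate_function_def path_functional_def by (rule Inf_superset_mono) blast

context skeleton_approximation
begin

abbreviation I :: "real \<Rightarrow> ereal" where "I \<equiv> rate_function S (L2 S) \<Upsilon> (T, x0)"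
abbreviation In :: "nat \<Rightarrow> real \<Rightarrow> ereal" where "In n \<equiv> rate_function S (X n) (\<Upsilon>n n) (T, x0)"

text \<open>The discretised controls converge strongly, hence weakly, so convergence of the discrete
  solutions applies to them.\<close>

lemma Q_control:
  assumes h: "h \<in> square_integrable M" and e: "e > 0"
  shows "\<forall>\<^sub>F n in sequentially. n \<ge> 1 \<and> l2_norm M (\<lambda>p. Q n h p - h p) < e \<and>
    \<bar>\<Upsilon>n n (Q n h) (T, x0) - \<Upsilon> h (T, x0)\<bar> < e"
proof -
  have hL: "h \<in> L2 S" using h by (simp add: L2_eq)
  \<comment> \<open>The scheme is constrained only from index 1 on, hence the shift, which is undone
    in the limits.\<close>
  have QX: "Q (Suc i) h \<in> X (Suc i)" for i using Q_range[OF _ hL] by simp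
  note Qs = X_square_integrable[OF QX]
  have lim: "(\<lambda>n. l2_norm M (\<lambda>p. Q n h p - h p)) \<longlonglongrightarrow> 0"
    using Q_lim[OF hL] by (simp add: L2_norm_eq)
  then have lim': "(\<lambda>i. l2_norm M (\<lambda>p. Q (Suc i) h p - h p)) \<longlonglongrightarrow> 0"
    by (rule LIMSEQ_Suc)
  then obtain B where B: "\<And>i. l2_norm M (\<lambda>p. Q (Suc i) h p - h p) \<le> B"
    by (rule tendsto_imp_bounded_above) blast
  have "l2_norm M (Q (Suc i) h) \<le> l2_norm M h + B" for i
    by (rule order_trans[OF l2_norm_triangle_diff[OF Qs h] add_left_mono[OF B]])
  then have "(\<lambda>i. sup_norm C (\<lambda>p. \<Upsilon>n (Suc i) (Q (Suc i) h) p - \<Upsilon> h p)) \<longlonglongrightarrow> 0"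
    by (intro \<Upsilon>n_tendsto[OF filterlim_Suc _ QX _ h l2_strong_imp_weak_limit[OF Qs h lim']]) auto
  then have "(\<lambda>i. \<Upsilon>n (Suc i) (Q (Suc i) h) (T, x0)) \<longlonglongrightarrow> \<Upsilon> h (T, x0)"
    by (rule \<Upsilon>n_tendsto_pointwise[OF _ QX h _ p0_in_C, rotated]) simp
  then have "(\<lambda>n. \<Upsilon>n n (Q n h) (T, x0)) \<longlonglongrightarrow> \<Upsilon> h (T, x0)" by (rule LIMSEQ_imp_Suc)
  then have "\<forall>\<^sub>F n in sequentially. \<bar>\<Upsilon>n n (Q n h) (T, x0) - \<Upsilon> h (T, x0)\<bar> < e"
    unfolding dist_real_def[symmetric] using e by (rule tendstoD)
  moreover have "\<forall>\<^sub>F n in sequentially. l2_norm M (\<lambda>p. Q n h p - h p) < e"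
    using order_tendstoD(2)[OF lim e] .
  ultimately show ?thesis by (intro eventually_conj eventually_ge_at_top)
qed

text \<open>Two controls steering just above and just below the target are discretised; by continuity of
  \<open>\<Upsilon>\<^sub>n\<close> some control on the segment between them hits the target exactly.\<close>

lemma discrete_exact_control:
  assumes h: "h \<in> square_integrable M" and e: "e > 0"
  shows "\<forall>\<^sub>F n in sequentially. \<exists>h'\<in>X n. \<Upsilon>n n h' (T, x0) = \<Upsilon> h (T, x0) \<and> l2_norm M h' \<le> l2_norm M h + e"
proof -
  let ?y = "\<Upsilon> h (T, x0)"
  obtain h1 where h1: "h1 \<in> square_integrable M" "l2_norm M (\<lambda>p. h1 p - h p) < e / 2" "\<Upsilon> h1 (T, x0) < ?y"
    using control_perturbation[OF h half_gt_zero[OF e], of "-1"] by auto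
  obtain h2 where h2: "h2 \<in> square_integrable M" "l2_norm M (\<lambda>p. h2 p - h p) < e / 2" "?y < \<Upsilon> h2 (T, x0)"
    using control_perturbation[OF h half_gt_zero[OF e], of 1] by auto
  \<comment> \<open>Being at most both endpoint gaps, \<open>d\<close> keeps the discrete endpoints
    on their sides of the target; e/2 is left for the norm.\<close>
  define d where "d = min (e / 2) (min (?y - \<Upsilon> h1 (T, x0)) (\<Upsilon> h2 (T, x0) - ?y))"
  have d: "d > 0" using e h1 h2 by (simp add: d_def)
  from Q_control[OF h1(1) d] Q_control[OF h2(1) d] show ?thesis
  proof eventually_elim
    case (elim n)
    then have n: "n \<ge> 1" by simp
    define f where "f = Q n h1"
    define k where "k = Q n h2"
    have fX: "f \<in> X n" and kX: "k \<in> X n"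
      using Q_range[OF n] h1 h2 by (auto simp: f_def k_def L2_eq)
    note fs = X_square_integrable[OF fX] and ks = X_square_integrable[OF kX]
    have f_lt: "\<Upsilon>n n f (T, x0) \<le> ?y" and k_gt: "?y \<le> \<Upsilon>n n k (T, x0)"
      using elim unfolding f_def k_def d_def abs_less_iff by auto
    have norm_le: "l2_norm M v \<le> l2_norm M h + e"
      if "v \<in> square_integrable M" "w \<in> square_integrable M" "l2_norm M (\<lambda>p. v p - w p) < d" "l2_norm M (\<lambda>p. w p - h p) < e / 2" for v w
    proof -
      have "d \<le> e / 2" unfolding d_def by (rule min.cobounded1)
      then show ?thesis
        using l2_norm_triangle_diff[OF that(1,2)] l2_norm_triangle_diff[OF that(2) h] that(3,4) by argo
    qed
    have f_norm: "l2_norm M f \<le> l2_norm M h + e" and k_norm: "l2_norm M k \<le> l2_norm M h + e"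
      using norm_le[OF fs h1(1)] norm_le[OF ks h2(1)] elim h1(2) h2(2) by (auto simp: f_def k_def)
    \<comment> \<open>The segment stays in the mesh space, and by the triangle inequality its norms
      do not exceed the larger one at the two ends.\<close>
    define \<gamma> where "\<gamma> \<theta> = (\<lambda>p. (1 - \<theta>) * f p + \<theta> * k p)" for \<theta> :: real
    have \<gamma>X: "\<gamma> \<theta> \<in> X n" for \<theta>
      unfolding \<gamma>_def by (rule mesh_functions_convex_combination[OF D_open fX kX])
    have \<gamma>_diff: "l2_norm M (\<lambda>p. \<gamma> \<theta>' p - \<gamma> \<theta> p) = \<bar>\<theta>' - \<theta>\<bar> * l2_norm M (\<lambda>p. k p - f p)" for \<theta> \<theta>'
    proof -
      have "(\<lambda>p. \<gamma> \<theta>' p - \<gamma> \<theta> p) = (\<lambda>p. (\<theta>' - \<theta>) * (k p - f p))"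
        by (simp add: \<gamma>_def algebra_simps)
      then show ?thesis by (simp add: l2_norm_cmult)
    qed
    have cont: "continuous_on {0..1} (\<lambda>\<theta>. \<Upsilon>n n (\<gamma> \<theta>) (T, x0))"
      unfolding continuous_on_iff
    proof (intro ballI allI impI)
      fix \<theta> c :: real assume c: "c > 0"
      obtain \<delta> where \<delta>: "\<delta> > 0" "\<And>h'. h' \<in> X n \<Longrightarrow> l2_norm M (\<lambda>p. h' p - \<gamma> \<theta> p) < \<delta> \<Longrightarrow>
          sup_norm C (\<lambda>p. \<Upsilon>n n h' p - \<Upsilon>n n (\<gamma> \<theta>) p) < c"
        using \<Upsilon>n_continuous[OF n \<gamma>X c, of \<theta>] unfolding L2_norm_eq by blast
      define N where "N = l2_norm M (\<lambda>p. k p - f p) + 1"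
      have N: "N > 0" using l2_norm_nonneg[of M "\<lambda>p. k p - f p"] by (simp add: N_def)
      have "dist (\<Upsilon>n n (\<gamma> \<theta>') (T, x0)) (\<Upsilon>n n (\<gamma> \<theta>) (T, x0)) < c" if "dist \<theta>' \<theta> < \<delta> / N" for \<theta>'
      proof -
        have "\<bar>\<theta>' - \<theta>\<bar> * l2_norm M (\<lambda>p. k p - f p) \<le> \<bar>\<theta>' - \<theta>\<bar> * N"
          by (intro mult_left_mono) (auto simp: N_def)
        also have "\<dots> < \<delta>" using that N by (simp add: dist_real_def pos_less_divide_eq)
        finally have "sup_norm C (\<lambda>p. \<Upsilon>n n (\<gamma> \<theta>') p - \<Upsilon>n n (\<gamma> \<theta>) p) < c"
          by (intro \<delta>(2) \<gamma>X) (simp add: \<gamma>_diff)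
        then show ?thesis
          using abs_le_sup_norm[OF C_compact
              continuous_on_Cspace_diff[OF \<Upsilon>n_solution(1)[OF n \<gamma>X[of \<theta>']] \<Upsilon>n_solution(1)[OF n \<gamma>X[of \<theta>]]] p0_in_C]
          by (simp add: dist_real_def)
      qed
      then show "\<exists>d>0. \<forall>\<theta>'\<in>{0..1}. dist \<theta>' \<theta> < d \<longrightarrow> dist (\<Upsilon>n n (\<gamma> \<theta>') (T, x0)) (\<Upsilon>n n (\<gamma> \<theta>) (T, x0)) < c"
        using \<delta>(1) N by (intro exI[of _ "\<delta> / N"]) auto
    qed
    have "\<gamma> 0 = f" "\<gamma> 1 = k" by (auto simp: \<gamma>_def)
    then obtain \<theta> where \<theta>: "0 \<le> \<theta>" "\<theta> \<le> 1" "\<Upsilon>n n (\<gamma> \<theta>) (T, x0) = ?y"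
      using IVT'[of "\<lambda>\<theta>. \<Upsilon>n n (\<gamma> \<theta>) (T, x0)" 0 ?y 1] f_lt k_gt cont by auto
    have "l2_norm M (\<gamma> \<theta>) \<le> (1 - \<theta>) * l2_norm M f + \<theta> * l2_norm M k"
      using l2_norm_triangle[OF square_integrable_cmult[OF fs, of "1 - \<theta>"] square_integrable_cmult[OF ks, of \<theta>]] \<theta>
      by (simp add: \<gamma>_def l2_norm_cmult)
    also have "\<dots> \<le> (1 - \<theta>) * (l2_norm M h + e) + \<theta> * (l2_norm M h + e)"
      using f_norm k_norm \<theta> by (intro add_mono mult_left_mono) auto
    also have "\<dots> = l2_norm M h + e" by (simp add: algebra_simps)
    finally show ?case using \<gamma>X \<theta>(3) by blast
  qed
qed

text \<open>The limsup half. A control of cost below c leaves room for a slightly larger norm, which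
  is all that an exact discrete control needs.\<close>

lemma In_eventually_less:
  assumes "I y < c"
  shows "\<forall>\<^sub>F n in sequentially. In n y < c"
proof -
  obtain h where h: "h \<in> L2 S" "\<Upsilon> h (T, x0) = y" "ereal (1/2 * (L2_norm_on S h)\<^sup>2) < c"
    using rate_function_lessE[OF assms] .
  obtain r where r: "1/2 * (L2_norm_on S h)\<^sup>2 < r" "ereal r < c"
    using ereal_dense2[OF h(3)] by auto
  have hs: "h \<in> square_integrable M" using h(1) by (simp add: L2_eq)
  define N where "N = l2_norm M h"
  have N: "N \<ge> 0" "1/2 * N\<^sup>2 < r" using r(1) by (simp_all add: N_def l2_norm_nonneg L2_norm_eq)
  have "((\<lambda>e. 1/2 * (N + e)\<^sup>2) \<longlongrightarrow> 1/2 * (N + 0)\<^sup>2) (at_right 0)"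
    by (intro tendsto_intros)
  then have "\<forall>\<^sub>F e in at_right 0. 1/2 * (N + e)\<^sup>2 < r"
    by (rule order_tendstoD) (use N in simp)
  then have "\<forall>\<^sub>F e in at_right 0. 1/2 * (N + e)\<^sup>2 < r \<and> 0 < e"
    by (intro eventually_conj eventually_at_right_less)
  then obtain e where e: "1/2 * (N + e)\<^sup>2 < r" "e > 0"
    using eventually_happens'[OF trivial_limit_at_right_real] by blast
  from discrete_exact_control[OF hs e(2)] show ?thesis
  proof eventually_elim
    case (elim n)
    then obtain h' where h': "h' \<in> X n" "\<Upsilon>n n h' (T, x0) = y" "l2_norm M h' \<le> N + e"
      using h(2) by (auto simp: N_def)
    have "In n y \<le> ereal (1/2 * (L2_norm_on S h')\<^sup>2)" using h' by (intro rate_function_le)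
    also have "\<dots> \<le> ereal (1/2 * (N + e)\<^sup>2)"
      using h'(3) by (simp add: L2_norm_eq power_mono l2_norm_nonneg)
    also have "\<dots> \<le> ereal r" using e(1) by simp
    finally show ?case using r(2) by (rule le_less_trans)
  qed
qed

text \<open>The endpoint constraint survives the weak limit, because the solutions converge
  uniformly and may be evaluated at (T,x0).\<close>

lemma controls_weakly_compact:
  assumes k: "strict_mono k" "\<And>i. k i \<ge> 1" and h: "\<And>i. h i \<in> X (k i)" and B: "\<And>i. l2_norm M (h i) \<le> B"
    and y: "\<And>i. \<Upsilon>n (k i) (h i) (T, x0) = y"
  obtains r :: "nat \<Rightarrow> nat" and w where "strict_mono r" "w \<in> square_integrable M" "l2_weak_limit M (\<lambda>i. h (r i)) w"
    "(\<lambda>i. sup_norm C (\<lambda>p. \<Upsilon>n (k (r i)) (h (r i)) p - \<Upsilon> w p)) \<longlonglongrightarrow> 0" "\<Upsilon> w (T, x0) = y"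
proof -
  obtain r :: "nat \<Rightarrow> nat" and w
    where r: "strict_mono r" and w: "w \<in> square_integrable M" and weak: "l2_weak_limit M (\<lambda>i. h (r i)) w"
    by (rule weak_compactness[OF X_square_integrable[OF h] B])
  have "strict_mono (\<lambda>i. k (r i))" using k(1) r by (simp add: strict_mono_def)
  then have "filterlim (\<lambda>i. k (r i)) at_top sequentially" by (rule filterlim_subseq)
  then have lim: "(\<lambda>i. sup_norm C (\<lambda>p. \<Upsilon>n (k (r i)) (h (r i)) p - \<Upsilon> w p)) \<longlonglongrightarrow> 0"
    by (rule \<Upsilon>n_tendsto[OF _ k(2) h B w weak])
  have "(\<lambda>i. y) \<longlonglongrightarrow> \<Upsilon> w (T, x0)"
    using \<Upsilon>n_tendsto_pointwise[OF k(2) h w lim p0_in_C] by (simp add: y)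
  then have "\<Upsilon> w (T, x0) = y" by (metis LIMSEQ_const_iff)
  with r w weak lim show thesis by (rule that)
qed

text \<open>The liminf half: infinitely many cheap discrete controls would have a weak limit that is
  admissible for y and no more expensive.\<close>

lemma In_eventually_greater:
  assumes "c < I y"
  shows "\<forall>\<^sub>F n in sequentially. c < In n y"
proof (rule ccontr)
  assume "\<not> ?thesis"
  then have often: "\<exists>n\<ge>N. \<not> c < In n y" for N
    unfolding eventually_sequentially by blast
  have "\<exists>n>N. In n y \<le> c" for N
    using often[of "Suc N"] by (auto simp: Suc_le_eq not_less)
  then have "infinite {n. In n y \<le> c}"
    unfolding infinite_nat_iff_unbounded by blast
  then obtain k' :: "nat \<Rightarrow> nat" where k': "strict_mono k'" "\<And>i. In (k' i) y \<le> c"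
    using infinite_enumerate[of "{n. In n y \<le> c}"] by blast
  \<comment> \<open>Dropping the first index ensures k i >= 1.\<close>
  define k where "k i = k' (Suc i)" for i
  have k: "strict_mono k" "\<And>i. In (k i) y \<le> c"
    using k' by (auto simp: k_def strict_mono_def)
  have k1: "k i \<ge> 1" for i
    using strict_mono_imp_increasing[OF k'(1), of "Suc i"] by (simp add: k_def)
  \<comment> \<open>A real number in between yields a norm bound even when I y is infinite, so this
    case needs no separate treatment.\<close>
  obtain r where r: "c < ereal r" "ereal r < I y" using ereal_dense2[OF assms] by blast
  have "\<exists>h\<in>X (k i). \<Upsilon>n (k i) h (T, x0) = y \<and> 1/2 * (l2_norm M h)\<^sup>2 < r" for i
  proof -
    have "In (k i) y < ereal r" using k(2) r(1) by (rule le_less_trans)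
    then obtain h where "h \<in> X (k i)" "\<Upsilon>n (k i) h (T, x0) = y" "ereal (1/2 * (L2_norm_on S h)\<^sup>2) < ereal r"
      by (rule rate_function_lessE)
    then show ?thesis unfolding L2_norm_eq less_ereal.simps by blast
  qed
  then obtain h where h: "\<And>i. h i \<in> X (k i)" and y: "\<And>i. \<Upsilon>n (k i) (h i) (T, x0) = y"
    and le: "\<And>i. 1/2 * (l2_norm M (h i))\<^sup>2 < r" by metis
  have B: "l2_norm M (h i) \<le> sqrt (2 * r)" for i
    using le[of i] by (intro real_le_rsqrt) simp
  obtain q :: "nat \<Rightarrow> nat" and w where w: "strict_mono q" "w \<in> square_integrable M"
      "l2_weak_limit M (\<lambda>i. h (q i)) w"
      "(\<lambda>i. sup_norm C (\<lambda>p. \<Upsilon>n (k (q i)) (h (q i)) p - \<Upsilon> w p)) \<longlonglongrightarrow> 0" "\<Upsilon> w (T, x0) = y"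
    by (rule controls_weakly_compact[OF k(1) k1 h B y])
  have "l2_norm M w \<le> sqrt (2 * r)"
    by (rule l2_norm_weak_limit_le[OF w(3) _ w(2) B tendsto_const]) (rule X_square_integrable[OF h])
  then have "(l2_norm M w)\<^sup>2 \<le> (sqrt (2 * r))\<^sup>2" by (intro power_mono l2_norm_nonneg)
  moreover have "0 \<le> r" using le[of 0] zero_le_power2[of "l2_norm M (h 0)"] by linarith
  ultimately have "ereal (1/2 * (L2_norm_on S w)\<^sup>2) \<le> ereal r" by (simp add: L2_norm_eq)
  moreover have "I y \<le> ereal (1/2 * (L2_norm_on S w)\<^sup>2)"
    using w by (intro rate_function_le) (auto simp: L2_eq)
  ultimately show False using r(2) by (metis leD order_trans)
qed

lemma In_tendsto_I: "(\<lambda>n. In n y) \<longlonglongrightarrow> I y"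
  by (rule order_tendstoI) (auto intro: In_eventually_less In_eventually_greater)

text \<open>The costs are squeezed between the discrete rate functions and the same plus the
  tolerance, so the norms converge to sqrt(2 I y). A weak limit has at most this norm by lower
  semicontinuity and at least this norm because it is admissible; equality upgrades weak to strong
  convergence. Starting from an arbitrary subsequence \<open>k\<close> prepares the argument for
  full sequences.\<close>

lemma near_minimizers_subsequence:
  assumes fin: "I y < \<infinity>" and \<epsilon>: "\<epsilon> \<longlonglongrightarrow> 0"
    and k: "strict_mono k" "\<And>i. k i \<ge> 1" and h: "\<And>n. n \<ge> 1 \<Longrightarrow> h n \<in> X n"
    and y: "\<And>n. n \<ge> 1 \<Longrightarrow> \<Upsilon>n n (h n) (T, x0) = y"
    and le: "\<And>n. n \<ge> 1 \<Longrightarrow> ereal (1/2 * (L2_norm_on S (h n))\<^sup>2) \<le> In n y + ereal (\<epsilon> n)"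
  obtains r :: "nat \<Rightarrow> nat" and w where "strict_mono r" "w \<in> square_integrable M"
    "(\<lambda>i. l2_norm M (\<lambda>p. h (k (r i)) p - w p)) \<longlonglongrightarrow> 0"
    "(\<lambda>i. sup_norm C (\<lambda>p. \<Upsilon>n (k (r i)) (h (k (r i))) p - \<Upsilon> w p)) \<longlonglongrightarrow> 0"
    "rate_minimizer S (L2 S) \<Upsilon> (T, x0) y w"
proof -
  define a where "a = real_of_ereal (I y)"
  have "0 \<le> I y" by (rule rate_function_nonneg)
  then have a: "I y = ereal a" "a \<ge> 0" using fin by (cases "I y"; simp add: a_def)+
  have lim1: "(\<lambda>i. In (k i) y) \<longlonglongrightarrow> ereal a"
    using LIMSEQ_subseq_LIMSEQ[OF In_tendsto_I k(1), of y] a by (simp add: o_def)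
  have lim2: "(\<lambda>i. ereal (\<epsilon> (k i))) \<longlonglongrightarrow> ereal 0"
    using LIMSEQ_subseq_LIMSEQ[OF \<epsilon> k(1)] by (simp add: o_def)
  have "(\<lambda>i. In (k i) y + ereal (\<epsilon> (k i))) \<longlonglongrightarrow> ereal a + ereal 0"
    by (rule tendsto_add_ereal[OF _ _ lim1 lim2]) auto
  then have lim3: "(\<lambda>i. In (k i) y + ereal (\<epsilon> (k i))) \<longlonglongrightarrow> ereal a" by simp
  have "(\<lambda>i. ereal (1/2 * (L2_norm_on S (h (k i)))\<^sup>2)) \<longlonglongrightarrow> ereal a"
  proof (rule tendsto_sandwich[OF _ _ lim1 lim3])
    show "\<forall>\<^sub>F i in sequentially. In (k i) y \<le> ereal (1/2 * (L2_norm_on S (h (k i)))\<^sup>2)"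
      using h[OF k(2)] y[OF k(2)] by (intro always_eventually allI rate_function_le)
    show "\<forall>\<^sub>F i in sequentially. ereal (1/2 * (L2_norm_on S (h (k i)))\<^sup>2) \<le> In (k i) y + ereal (\<epsilon> (k i))"
      using le[OF k(2)] by (intro always_eventually allI)
  qed
  then have "(\<lambda>i. 2 * (1/2 * (l2_norm M (h (k i)))\<^sup>2)) \<longlonglongrightarrow> 2 * a"
    by (intro tendsto_mult tendsto_const) (simp add: L2_norm_eq)
  then have "(\<lambda>i. sqrt ((l2_norm M (h (k i)))\<^sup>2)) \<longlonglongrightarrow> sqrt (2 * a)"
    by (intro tendsto_real_sqrt) simp
  then have norms: "(\<lambda>i. l2_norm M (h (k i))) \<longlonglongrightarrow> sqrt (2 * a)" by (simp add: l2_norm_nonneg)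
  then obtain B where B: "\<And>i. l2_norm M (h (k i)) \<le> B"
    by (rule tendsto_imp_bounded_above) blast
  obtain r :: "nat \<Rightarrow> nat" and w where r: "strict_mono r" and w: "w \<in> square_integrable M"
      and weak: "l2_weak_limit M (\<lambda>i. h (k (r i))) w"
      and sup: "(\<lambda>i. sup_norm C (\<lambda>p. \<Upsilon>n (k (r i)) (h (k (r i))) p - \<Upsilon> w p)) \<longlonglongrightarrow> 0"
      and wy: "\<Upsilon> w (T, x0) = y"
    by (rule controls_weakly_compact[OF k(1,2) h[OF k(2)] B y[OF k(2)]])
  have norms_r: "(\<lambda>i. l2_norm M (h (k (r i)))) \<longlonglongrightarrow> sqrt (2 * a)"
    using LIMSEQ_subseq_LIMSEQ[OF norms r] by (simp add: o_def)
  have hs: "h (k (r i)) \<in> square_integrable M" for i by (rule X_square_integrable[OF h[OF k(2)]])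
  have "l2_norm M w \<le> sqrt (2 * a)"
    by (rule l2_norm_weak_limit_le[OF weak hs w order_refl norms_r])
  then have up: "(l2_norm M w)\<^sup>2 \<le> 2 * a"
    using power_mono[OF _ l2_norm_nonneg, of M w "sqrt (2 * a)" 2] a by simp
  have "I y \<le> ereal (1/2 * (L2_norm_on S w)\<^sup>2)"
    using w wy by (intro rate_function_le) (auto simp: L2_eq)
  then have eq: "(l2_norm M w)\<^sup>2 = 2 * a" using up a by (simp add: L2_norm_eq)
  then have "l2_norm M w = sqrt (2 * a)" using l2_norm_nonneg by (metis real_sqrt_unique)
  then have strong: "(\<lambda>i. l2_norm M (\<lambda>p. h (k (r i)) p - w p)) \<longlonglongrightarrow> 0"
    using norms_r by (intro l2_weak_limit_imp_strong[OF weak hs w]) simp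
  have "rate_minimizer S (L2 S) \<Upsilon> (T, x0) y w"
    unfolding rate_minimizer_def using w wy eq a by (simp add: L2_eq L2_norm_eq)
  with r w strong sup show thesis by (rule that)
qed

section \<open>Equality up to null sets and full sequences\<close>

lemma L2_eq_AE:
  assumes "L2_eq S h h'"
  shows "AE p in M. h p = h' p"
  using assms S_borel by (simp add: L2_eq_def AE_restrict_space_iff)

text \<open>Minimisers can be unique only as classes, whereas the solution map acts on
  representatives; uniqueness of the skeleton solution shows that it respects classes.\<close>

lemma \<Upsilon>_cong_L2_eq:
  assumes h: "h \<in> square_integrable M" "h' \<in> square_integrable M" and eq: "L2_eq S h h'"
  shows "\<Upsilon> h = \<Upsilon> h'"
proof (rule \<Upsilon>_eqI[OF h(1) \<Upsilon>_solution(1)[OF h(2)]])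
  fix q assume q: "q \<in> C"
  note u = \<Upsilon>_solution(1)[OF h(2)] and Kq = K_square_integrable[OF q]
  have "l2_inner M (K q) (F (\<Upsilon> h') h') = l2_inner M (K q) (F (\<Upsilon> h') h)"
    unfolding l2_inner_def
  proof (rule integral_cong_AE)
    show "AE p in M. K q p * F (\<Upsilon> h') h' p = K q p * F (\<Upsilon> h') h p"
      using L2_eq_AE[OF eq] by eventually_elim (simp add: F_def)
  qed (rule borel_measurable_integrable, rule square_integrable_mult[OF Kq F_Cspace[OF u]], use h in simp)+
  then show "\<Upsilon> h' q = g q + l2_inner M (K q) (F (\<Upsilon> h') h)"
    using \<Upsilon>_solution(2)[OF h(2) q] by simp
qed

lemma l2_norm_diff_cong_L2_eq:
  assumes "f \<in> square_integrable M" "h \<in> square_integrable M" "h' \<in> square_integrable M" "L2_eq S h h'"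
  shows "l2_norm M (\<lambda>p. f p - h p) = l2_norm M (\<lambda>p. f p - h' p)"
proof -
  have "(\<integral>p. (f p - h p)\<^sup>2 \<partial>M) = (\<integral>p. (f p - h' p)\<^sup>2 \<partial>M)"
  proof (rule integral_cong_AE)
    show "AE p in M. (f p - h p)\<^sup>2 = (f p - h' p)\<^sup>2"
      using L2_eq_AE[OF assms(4)] by eventually_elim simp
  qed (use assms in \<open>auto dest!: square_integrable_measurable\<close>)
  then show ?thesis by (simp add: l2_norm_def)
qed

text \<open>The subsequence principle: otherwise some subsequence keeps a positive distance, yet it
  has a further subsequence converging to a minimiser, which is \<open>w\<close> up to a null
  set.\<close>

lemma near_minimizers_full_sequence:
  assumes fin: "I y < \<infinity>" and \<epsilon>: "\<epsilon> \<longlonglongrightarrow> 0"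
    and h: "\<And>n. n \<ge> 1 \<Longrightarrow> h n \<in> X n"
    and y: "\<And>n. n \<ge> 1 \<Longrightarrow> \<Upsilon>n n (h n) (T, x0) = y"
    and le: "\<And>n. n \<ge> 1 \<Longrightarrow> ereal (1/2 * (L2_norm_on S (h n))\<^sup>2) \<le> In n y + ereal (\<epsilon> n)"
    and min: "rate_minimizer S (L2 S) \<Upsilon> (T, x0) y w"
    and unique: "\<And>w'. rate_minimizer S (L2 S) \<Upsilon> (T, x0) y w' \<Longrightarrow> L2_eq S w' w"
  shows "(\<lambda>n. l2_norm M (\<lambda>p. h n p - w p)) \<longlonglongrightarrow> 0"
    "(\<lambda>n. sup_norm C (\<lambda>p. \<Upsilon>n n (h n) p - \<Upsilon> w p)) \<longlonglongrightarrow> 0"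
proof -
  have w: "w \<in> square_integrable M" using min by (simp add: rate_minimizer_def L2_eq)
  \<comment> \<open>Adding both errors lets a single bad subsequence refute both limits; as each
    summand is nonnegative, the sum controls it.\<close>
  define \<Delta> where "\<Delta> n = l2_norm M (\<lambda>p. h n p - w p) + sup_norm C (\<lambda>p. \<Upsilon>n n (h n) p - \<Upsilon> w p)" for n
  have sup0: "0 \<le> sup_norm C (\<lambda>p. \<Upsilon>n n (h n) p - \<Upsilon> w p)" if "n \<ge> 1" for n
    by (rule sup_norm_nonneg[OF \<Upsilon>n_solution(1)[OF that h[OF that]] \<Upsilon>_solution(1)[OF w]])
  have lim: "(\<lambda>i. \<Delta> (Suc i)) \<longlonglongrightarrow> 0"
  proof (rule ccontr)
    assume "\<not> ?thesis"
    then obtain e where e: "e > 0" and often: "\<And>N. \<exists>i\<ge>N. \<not> \<bar>\<Delta> (Suc i)\<bar> < e"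
      unfolding LIMSEQ_iff real_norm_def diff_zero by blast
    have "\<exists>n>N. n \<ge> 1 \<and> e \<le> \<bar>\<Delta> n\<bar>" for N
    proof -
      obtain i where "i \<ge> N" "\<not> \<bar>\<Delta> (Suc i)\<bar> < e" using often by blast
      then show ?thesis by (intro exI[of _ "Suc i"]) auto
    qed
    then have "infinite {n. n \<ge> 1 \<and> e \<le> \<bar>\<Delta> n\<bar>}"
      unfolding infinite_nat_iff_unbounded by blast
    then obtain k :: "nat \<Rightarrow> nat" where k: "strict_mono k" "\<And>i. k i \<ge> 1" "\<And>i. e \<le> \<bar>\<Delta> (k i)\<bar>"
      using infinite_enumerate[of "{n. n \<ge> 1 \<and> e \<le> \<bar>\<Delta> n\<bar>}"] by blast
    obtain r :: "nat \<Rightarrow> nat" and w' where r: "strict_mono r" and w': "w' \<in> square_integrable M"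
      and 1: "(\<lambda>i. l2_norm M (\<lambda>p. h (k (r i)) p - w' p)) \<longlonglongrightarrow> 0"
      and 2: "(\<lambda>i. sup_norm C (\<lambda>p. \<Upsilon>n (k (r i)) (h (k (r i))) p - \<Upsilon> w' p)) \<longlonglongrightarrow> 0"
      and min': "rate_minimizer S (L2 S) \<Upsilon> (T, x0) y w'"
      by (rule near_minimizers_subsequence[OF fin \<epsilon> k(1,2) h y le])
    have eq: "L2_eq S w' w" by (rule unique[OF min'])
    have "l2_norm M (\<lambda>p. h (k (r i)) p - w' p) = l2_norm M (\<lambda>p. h (k (r i)) p - w p)" for i
      by (rule l2_norm_diff_cong_L2_eq[OF X_square_integrable[OF h[OF k(2)]] w' w eq])
    then have "(\<lambda>i. \<Delta> (k (r i))) \<longlonglongrightarrow> 0"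
      unfolding \<Delta>_def using tendsto_add[OF 1 2] \<Upsilon>_cong_L2_eq[OF w' w eq] by simp
    from tendstoD[OF this e] have "\<forall>\<^sub>F i in sequentially. \<bar>\<Delta> (k (r i))\<bar> < e"
      by (simp add: dist_real_def)
    then obtain i where "\<bar>\<Delta> (k (r i))\<bar> < e" using eventually_happens' sequentially_bot by blast
    then show False using k(3)[of "r i"] by simp
  qed
  have "(\<lambda>i. l2_norm M (\<lambda>p. h (Suc i) p - w p)) \<longlonglongrightarrow> 0"
    by (rule Lim_null_comparison[OF _ lim]) (simp add: \<Delta>_def sup0 l2_norm_nonneg)
  then show "(\<lambda>n. l2_norm M (\<lambda>p. h n p - w p)) \<longlonglongrightarrow> 0" by (rule LIMSEQ_imp_Suc)
  have "(\<lambda>i. sup_norm C (\<lambda>p. \<Upsilon>n (Suc i) (h (Suc i)) p - \<Upsilon> w p)) \<longlonglongrightarrow> 0"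
    by (rule Lim_null_comparison[OF _ lim]) (simp add: \<Delta>_def sup0 l2_norm_nonneg)
  then show "(\<lambda>n. sup_norm C (\<lambda>p. \<Upsilon>n n (h n) p - \<Upsilon> w p)) \<longlonglongrightarrow> 0" by (rule LIMSEQ_imp_Suc)
qed

end

theorem theorem2:
  fixes T :: real and D :: "'a::euclidean_space set" and x0 :: 'a
    and G :: "real \<Rightarrow> 'a \<Rightarrow> 'a \<Rightarrow> real" and g :: "real \<times> 'a \<Rightarrow> real"
    and b \<sigma> :: "real \<Rightarrow> real"
    and m :: "nat \<Rightarrow> nat" and \<T> :: "nat \<Rightarrow> 'a set set" and \<kappa> :: "nat \<Rightarrow> 'a \<Rightarrow> 'a"
    and Gn :: "nat \<Rightarrow> real \<Rightarrow> real \<Rightarrow> 'a \<Rightarrow> 'a \<Rightarrow> real" and gn :: "nat \<Rightarrow> real \<times> 'a \<Rightarrow> real"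
    and \<X> :: "nat \<Rightarrow> (real \<times> 'a \<Rightarrow> real) set"
    and \<Upsilon> :: "(real \<times> 'a \<Rightarrow> real) \<Rightarrow> real \<times> 'a \<Rightarrow> real"
    and \<Upsilon>n :: "nat \<Rightarrow> (real \<times> 'a \<Rightarrow> real) \<Rightarrow> real \<times> 'a \<Rightarrow> real"
    and I :: "real \<Rightarrow> ereal" and In :: "nat \<Rightarrow> real \<Rightarrow> ereal"
    and J :: "real \<Rightarrow> (real \<times> 'a \<Rightarrow> real) \<Rightarrow> ereal"
  assumes \<Upsilon>_eq: "\<Upsilon> = skeleton_map T D G b \<sigma> g"
    and \<X>_eq: "\<And>n. \<X> n = mesh_functions T D (m n) (\<T> n)"
    and \<Upsilon>n_eq: "\<And>n. \<Upsilon>n n = discrete_skeleton_map T D (m n) (\<kappa> n) (Gn n) b \<sigma> (gn n)"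
    and I_eq: "I = rate_function (cyl T D) (L2 (cyl T D)) \<Upsilon> (T, x0)"
    and In_eq: "\<And>n. In n = rate_function (cyl T D) (\<X> n) (\<Upsilon>n n) (T, x0)"
    and J_eq: "J = path_functional (cyl T D) (L2 (cyl T D)) \<Upsilon> (T, x0)"
    and "T > 0"
    and "open D" "connected D" "bounded D" "emeasure lborel (frontier D) = 0" "x0 \<in> D"
    and "set_borel_measurable borel ({0<..T} \<times> closure D \<times> D) (\<lambda>(t, x, z). G t x z)"
    and "g \<in> Cspace (ccyl T D)"
    and "\<forall>h\<in>L2 (cyl T D). \<exists>!u. skeleton_solution T D G b \<sigma> g h u"
    and "\<forall>n\<ge>1. m n > 0"
    and "\<forall>n\<ge>1. finite_mesh D (\<T> n)"
    and "\<forall>n\<ge>1. \<kappa> n ` D \<subseteq> closure D \<and> (\<forall>K\<in>\<T> n. \<kappa> n constant_on K)"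
    and "(\<lambda>n. SUP z\<in>D. norm (z - \<kappa> n z)) \<longlonglongrightarrow> 0"
    and "\<forall>n\<ge>1. set_borel_measurable borel
           {(t, r, x, z). 0 \<le> r \<and> r < t \<and> t \<le> T \<and> x \<in> closure D \<and> z \<in> D}
           (\<lambda>(t, r, x, z). Gn n t r x z)"
    and "\<forall>n\<ge>1. gn n \<in> Cspace (ccyl T D)"
    and "\<forall>n\<ge>1. \<forall>h\<in>\<X> n. \<exists>!u. discrete_skeleton_solution T D (m n) (\<kappa> n) (Gn n) b \<sigma> (gn n) h u"
    and "\<forall>n\<ge>1. \<forall>h\<in>\<X> n. \<forall>e>0. \<exists>d>0. \<forall>h'\<in>\<X> n.
           L2_norm_on (cyl T D) (\<lambda>p. h' p - h p) < d \<longrightarrow>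
           sup_norm (ccyl T D) (\<lambda>p. \<Upsilon>n n h' p - \<Upsilon>n n h p) < e"
    and "filterlim m at_top sequentially"
    and "b C1_differentiable_on UNIV" "bounded (range (deriv b))"
    and "\<sigma> C1_differentiable_on UNIV" "bounded (range (deriv \<sigma>))"
    and "\<forall>r. \<sigma> r \<noteq> 0"
    and A1: "(\<lambda>n. sup_norm (ccyl T D) (\<lambda>p. gn n p - g p)) \<longlonglongrightarrow> 0"
    and A2: "(\<lambda>n. SUP (t, x)\<in>ccyl T D.
                \<integral>\<^sup>+s\<in>{0<..<t}. (\<integral>\<^sup>+z\<in>D.
                  ennreal (\<bar>Gn n t (grid_floor T (m n) s) x z - G (t - s) x z\<bar>\<^sup>2) \<partial>lborel) \<partial>lborel)
             \<longlonglongrightarrow> 0"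
    and A3: "\<exists>\<rho> :: real \<Rightarrow> real. antimono_on {0<..T} \<rho> \<and> set_integrable lborel {0<..T} \<rho> \<and>
               (\<forall>r\<in>{0<..T}. 0 \<le> \<rho> r) \<and>
               (\<forall>n\<ge>1. \<forall>t r x. 0 \<le> r \<and> r < t \<and> t \<le> T \<and> x \<in> closure D \<longrightarrow>
                  (\<integral>\<^sup>+z\<in>D. ennreal (\<bar>Gn n t r x z\<bar>\<^sup>2) \<partial>lborel) \<le> ennreal (\<rho> (t - r)))"
    and A4: "((\<lambda>\<delta>. SUP (t, t', x, x') \<in> {(t, t', x, x'). 0 \<le> t' \<and> t' \<le> t \<and> t \<le> T \<and>
                        x \<in> closure D \<and> x' \<in> closure D \<and> \<bar>t - t'\<bar> + norm (x - x') \<le> \<delta>}.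
                 \<integral>\<^sup>+s\<in>{0<..<t'}. (\<integral>\<^sup>+z\<in>D.
                   ennreal (\<bar>G (t - s) x z - G (t' - s) x' z\<bar>\<^sup>2) \<partial>lborel) \<partial>lborel)
              \<longlongrightarrow> 0) (at_right 0)"
    and A5: "(\<integral>\<^sup>+s\<in>{0<..<T}. (\<integral>\<^sup>+z\<in>D. ennreal (\<bar>G (T - s) x0 z\<bar>\<^sup>2) \<partial>lborel) \<partial>lborel) > 0"
    and A6: "\<exists>Q :: nat \<Rightarrow> (real \<times> 'a \<Rightarrow> real) \<Rightarrow> (real \<times> 'a \<Rightarrow> real).
               (\<forall>n\<ge>1. \<forall>h\<in>L2 (cyl T D). Q n h \<in> \<X> n) \<and>
               (\<forall>h\<in>L2 (cyl T D). (\<lambda>n. L2_norm_on (cyl T D) (\<lambda>p. Q n h p - h p)) \<longlonglongrightarrow> 0)"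
  shows "(\<forall>y. (\<lambda>n. In n y) \<longlonglongrightarrow> I y) \<and>
    (\<forall>y \<epsilon> h.
       I y < \<infinity> \<and> (\<forall>n\<ge>1. (0::real) \<le> \<epsilon> n) \<and> \<epsilon> \<longlonglongrightarrow> 0 \<and>
       (\<forall>n\<ge>1. h n \<in> \<X> n \<and> \<Upsilon>n n (h n) (T, x0) = y \<and>
          ereal (1/2 * (L2_norm_on (cyl T D) (h n))\<^sup>2) \<le> In n y + ereal (\<epsilon> n)) \<longrightarrow>
       (\<exists>(k :: nat \<Rightarrow> nat) hs.
          strict_mono k \<and> (\<forall>i. k i \<ge> 1) \<and> hs \<in> L2 (cyl T D) \<and>
          (\<lambda>i. L2_norm_on (cyl T D) (\<lambda>p. h (k i) p - hs p)) \<longlonglongrightarrow> 0 \<and>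
          (\<lambda>i. sup_norm (ccyl T D) (\<lambda>p. \<Upsilon>n (k i) (h (k i)) p - \<Upsilon> hs p)) \<longlonglongrightarrow> 0 \<and>
          \<Upsilon> hs (T, x0) = y \<and>
          ereal (1/2 * (L2_norm_on (cyl T D) hs)\<^sup>2) = I y \<and>
          rate_minimizer (cyl T D) (L2 (cyl T D)) \<Upsilon> (T, x0) y hs \<and>
          \<Upsilon> hs \<in> Cspace (ccyl T D) \<and> (\<forall>f\<in>Cspace (ccyl T D). J y (\<Upsilon> hs) \<le> J y f) \<and>
          ((\<forall>h1 h2. rate_minimizer (cyl T D) (L2 (cyl T D)) \<Upsilon> (T, x0) y h1 \<and>
                    rate_minimizer (cyl T D) (L2 (cyl T D)) \<Upsilon> (T, x0) y h2 \<longrightarrow>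
                    L2_eq (cyl T D) h1 h2) \<longrightarrow>
             (\<lambda>n. L2_norm_on (cyl T D) (\<lambda>p. h n p - hs p)) \<longlonglongrightarrow> 0 \<and>
             (\<lambda>n. sup_norm (ccyl T D) (\<lambda>p. \<Upsilon>n n (h n) p - \<Upsilon> hs p)) \<longlonglongrightarrow> 0)))"
proof -
  obtain Lb where Lb: "Lb \<ge> 0" "\<And>r r'. \<bar>b r - b r'\<bar> \<le> Lb * \<bar>r - r'\<bar>"
    using C1_bounded_deriv_imp_lipschitz[OF \<open>b C1_differentiable_on UNIV\<close> \<open>bounded (range (deriv b))\<close>] by blast
  obtain Ls where Ls: "Ls \<ge> 0" "\<And>r r'. \<bar>\<sigma> r - \<sigma> r'\<bar> \<le> Ls * \<bar>r - r'\<bar>"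
    using C1_bounded_deriv_imp_lipschitz[OF \<open>\<sigma> C1_differentiable_on UNIV\<close> \<open>bounded (range (deriv \<sigma>))\<close>] by blast
  define L where "L = Lb + Ls"
  have b_lip: "\<bar>b r - b r'\<bar> \<le> L * \<bar>r - r'\<bar>" and \<sigma>_lip: "\<bar>\<sigma> r - \<sigma> r'\<bar> \<le> L * \<bar>r - r'\<bar>" for r r'
    using Lb(2)[of r r'] Ls(2)[of r r'] mult_right_mono[of Lb L "\<bar>r - r'\<bar>"] mult_right_mono[of Ls L "\<bar>r - r'\<bar>"]
      Lb(1) Ls(1) by (auto simp: L_def)
  obtain Q where Q: "\<And>n h. n \<ge> 1 \<Longrightarrow> h \<in> L2 (cyl T D) \<Longrightarrow> Q n h \<in> \<X> n"
      "\<And>h. h \<in> L2 (cyl T D) \<Longrightarrow> (\<lambda>n. L2_norm_on (cyl T D) (\<lambda>p. Q n h p - h p)) \<longlonglongrightarrow> 0"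
    using A6 by blast
  interpret A: skeleton_approximation T D G g b \<sigma> L m \<T> \<kappa> Gn gn x0 Q
  proof
    show "D \<noteq> {}" using \<open>x0 \<in> D\<close> by auto
    show "\<kappa> n z \<in> closure D" if "n \<ge> 1" "z \<in> D" for n z
      using \<open>\<forall>n\<ge>1. \<kappa> n ` D \<subseteq> closure D \<and> _ n\<close> that by blast
    show "\<kappa> n constant_on A" if "n \<ge> 1" "A \<in> \<T> n" for n A
      using \<open>\<forall>n\<ge>1. \<kappa> n ` D \<subseteq> closure D \<and> _ n\<close> that by blast
    show "Q n h \<in> mesh_functions T D (m n) (\<T> n)" if "n \<ge> 1" "h \<in> L2 (cyl T D)" for n h
      using Q(1)[OF that] by (simp only: \<X>_eq)
  qed (fact assms[unfolded \<X>_eq \<Upsilon>n_eq, rule_format] b_lip \<sigma>_lip Q(2))+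
  have I: "A.I = I" by (simp only: I_eq \<Upsilon>_eq)
  have In: "A.In n = In n" for n by (simp only: In_eq \<X>_eq \<Upsilon>n_eq)
  show ?thesis
  proof (intro conjI allI impI)
    show "(\<lambda>n. In n y) \<longlonglongrightarrow> I y" for y
      using A.In_tendsto_I[of y] by (simp only: I In)
  next
    fix y \<epsilon> h
    assume "I y < \<infinity> \<and> (\<forall>n\<ge>1. (0::real) \<le> \<epsilon> n) \<and> \<epsilon> \<longlonglongrightarrow> 0 \<and>
       (\<forall>n\<ge>1. h n \<in> \<X> n \<and> \<Upsilon>n n (h n) (T, x0) = y \<and>
          ereal (1/2 * (L2_norm_on (cyl T D) (h n))\<^sup>2) \<le> In n y + ereal (\<epsilon> n))"
    then have fin: "A.I y < \<infinity>" and \<epsilon>: "\<epsilon> \<longlonglongrightarrow> 0"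
      and h: "\<And>n. n \<ge> 1 \<Longrightarrow> h n \<in> A.X n" and y: "\<And>n. n \<ge> 1 \<Longrightarrow> A.\<Upsilon>n n (h n) (T, x0) = y"
      and le: "\<And>n. n \<ge> 1 \<Longrightarrow> ereal (1/2 * (L2_norm_on (cyl T D) (h n))\<^sup>2) \<le> A.In n y + ereal (\<epsilon> n)"
      unfolding I In unfolding \<X>_eq \<Upsilon>n_eq by blast+
    \<comment> \<open>The existence claim needs no prescribed subsequence; the shift merely starts
      the enumeration at 1.\<close>
    have Suc: "strict_mono Suc" "\<And>i. Suc i \<ge> 1" by (simp_all add: strict_mono_def)
    obtain r :: "nat \<Rightarrow> nat" and w where r: "strict_mono r" and w: "w \<in> square_integrable A.M"
      and strong: "(\<lambda>i. l2_norm A.M (\<lambda>p. h (Suc (r i)) p - w p)) \<longlonglongrightarrow> 0"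
      and sup: "(\<lambda>i. sup_norm A.C (\<lambda>p. A.\<Upsilon>n (Suc (r i)) (h (Suc (r i))) p - A.\<Upsilon> w p)) \<longlonglongrightarrow> 0"
      and min: "rate_minimizer A.S (L2 A.S) A.\<Upsilon> (T, x0) y w"
      by (rule A.near_minimizers_subsequence[OF fin \<epsilon> Suc h y le])
    have full: "(\<lambda>n. L2_norm_on (cyl T D) (\<lambda>p. h n p - w p)) \<longlonglongrightarrow> 0 \<and>
        (\<lambda>n. sup_norm (ccyl T D) (\<lambda>p. \<Upsilon>n n (h n) p - \<Upsilon> w p)) \<longlonglongrightarrow> 0"
      if "\<forall>h1 h2. rate_minimizer (cyl T D) (L2 (cyl T D)) \<Upsilon> (T, x0) y h1 \<and>
          rate_minimizer (cyl T D) (L2 (cyl T D)) \<Upsilon> (T, x0) y h2 \<longrightarrow> L2_eq (cyl T D) h1 h2"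
    proof -
      have uniq: "L2_eq A.S w' w" if "rate_minimizer A.S (L2 A.S) A.\<Upsilon> (T, x0) y w'" for w'
        using \<open>\<forall>h1 h2. _ h1 h2\<close> that min unfolding \<Upsilon>_eq by blast
      show ?thesis
        using A.near_minimizers_full_sequence[OF fin \<epsilon> h y le min uniq]
        unfolding \<Upsilon>_eq \<Upsilon>n_eq A.L2_norm_eq by blast
    qed
    have attained: "ereal (1/2 * (L2_norm_on (cyl T D) w)\<^sup>2) = I y" and hits: "\<Upsilon> w (T, x0) = y"
      using min unfolding rate_minimizer_def I \<Upsilon>_eq by blast+
    \<comment> \<open>The control \<open>w\<close> competes in the infimum for its own path, so the
      functional there is at most I y, a lower bound for its values at all paths.\<close>
    have "J y (\<Upsilon> w) \<le> ereal (1/2 * (L2_norm_on (cyl T D) w)\<^sup>2)"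
      unfolding J_eq path_functional_def using w hits by (intro Inf_lower) (auto simp: A.L2_eq)
    then have J_le: "J y (\<Upsilon> w) \<le> J y f" for f
      unfolding attained J_eq I_eq by (rule order_trans[OF _ rate_function_le_path_functional])
    show "\<exists>k hs. strict_mono k \<and> (\<forall>i. k i \<ge> 1) \<and> hs \<in> L2 (cyl T D) \<and>
          (\<lambda>i. L2_norm_on (cyl T D) (\<lambda>p. h (k i) p - hs p)) \<longlonglongrightarrow> 0 \<and>
          (\<lambda>i. sup_norm (ccyl T D) (\<lambda>p. \<Upsilon>n (k i) (h (k i)) p - \<Upsilon> hs p)) \<longlonglongrightarrow> 0 \<and>
          \<Upsilon> hs (T, x0) = y \<and>
          ereal (1/2 * (L2_norm_on (cyl T D) hs)\<^sup>2) = I y \<and>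
          rate_minimizer (cyl T D) (L2 (cyl T D)) \<Upsilon> (T, x0) y hs \<and>
          \<Upsilon> hs \<in> Cspace (ccyl T D) \<and> (\<forall>f\<in>Cspace (ccyl T D). J y (\<Upsilon> hs) \<le> J y f) \<and>
          ((\<forall>h1 h2. rate_minimizer (cyl T D) (L2 (cyl T D)) \<Upsilon> (T, x0) y h1 \<and>
                    rate_minimizer (cyl T D) (L2 (cyl T D)) \<Upsilon> (T, x0) y h2 \<longrightarrow>
                    L2_eq (cyl T D) h1 h2) \<longrightarrow>
             (\<lambda>n. L2_norm_on (cyl T D) (\<lambda>p. h n p - hs p)) \<longlonglongrightarrow> 0 \<and>
             (\<lambda>n. sup_norm (ccyl T D) (\<lambda>p. \<Upsilon>n n (h n) p - \<Upsilon> hs p)) \<longlonglongrightarrow> 0)"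
    proof (rule exI[of _ "\<lambda>i. Suc (r i)"], rule exI[of _ w], intro conjI ballI J_le attained hits)
      show "strict_mono (\<lambda>i. Suc (r i))" using r by (simp add: strict_mono_def)
      show "w \<in> L2 (cyl T D)" using w by (simp add: A.L2_eq)
      show "(\<lambda>i. L2_norm_on (cyl T D) (\<lambda>p. h (Suc (r i)) p - w p)) \<longlonglongrightarrow> 0"
        using strong by (simp only: A.L2_norm_eq)
      show "(\<lambda>i. sup_norm (ccyl T D) (\<lambda>p. \<Upsilon>n (Suc (r i)) (h (Suc (r i))) p - \<Upsilon> w p)) \<longlonglongrightarrow> 0"
        using sup by (simp only: \<Upsilon>_eq \<Upsilon>n_eq)
      show "rate_minimizer (cyl T D) (L2 (cyl T D)) \<Upsilon> (T, x0) y w" using min by (simp only: \<Upsilon>_eq)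
      show "\<Upsilon> w \<in> Cspace (ccyl T D)" unfolding \<Upsilon>_eq by (rule A.\<Upsilon>_solution(1)[OF w])
    qed (use full in simp_all)
  qed
qed

end
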